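(* Let $k$ be an algebraically closed field of characteristic zero, let $V$ be an $n$-dimensional $k$-vector space and let $A=SV=TV/(\wedge^2V)$ be its symmetric algebra. Then the simple $\underline{\mathrm{end}}(A)$-representations, when viewed as $M_{n\times n}$-representations, are of the form $S^{\lambda/\mu}V$ with $\lambda/\mu$ running through the set of rim hooks (for which $S^{\lambda/\mu}V\ne 0$).
   Context: Representations of a bialgebra mean (left) comodules. $\underline{\mathrm{end}}(A)$ is the bialgebra universal for having an algebra morphism $\delta:A\to\underline{\mathrm{end}}(A)\otimes A$ with $\delta(A_m)\subset\underline{\mathrm{end}}(A)\otimes A_m$ for all $m$. With a basis $(x_i)$ of $V$, dual basis $(x_i^* )$ and $z_i^j=x_j^*\otimes x_i$, it is generated by the $z_i^j$ (it is the quotient of $T(V^*\otimes V)$ by the ideal generated by the image of $R^\perp\otimes R$, $R=\wedge^2V\subset V^{\otimes 2}$, under $f_1\otimes f_2\otimes v_1\otimes v_2\mapsto f_1\otimes v_1\otimes f_2\otimes v_2$), with $\delta(x_i)=\sum_k z_i^k\otimes x_k$, $\Delta(z_i^j)=\sum_k z_i^k\otimes z_k^j$, $\epsilon(z_i^j)=\delta_i^j$. Let $\mathcal{O}=k[(z_i^j)_{i,j}]$ be the (commutative) coordinate ring of the monoid $M_{n\times n}$ of $n\times n$-matrices, a bialgebra by the same formulas for $\Delta,\epsilon$. Sending $z_i^j\mapsto z_i^j$ is a bialgebra homomorphism $\underline{\mathrm{end}}(A)\to\mathcal{O}$, through which every $\underline{\mathrm{end}}(A)$-comodule is viewed as an $\mathcal{O}$-comodule,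 i.e. as an $M_{n\times n}$-representation. For a skew diagram $\lambda/\mu$ with $p$ boxes (difference of the Young diagrams of two partitions $\mu\subset\lambda$; $\lambda',\mu'$ the conjugate partitions), labeled arbitrarily by $1,\dots,p$, $$S^{\lambda/\mu}V=\mathrm{im}\Bigl(\bigotimes_i\wedge^{\lambda_i'-\mu_i'}V\xrightarrow{\alpha}V^{\otimes p}\xrightarrow{\beta}\bigotimes_jS^{\lambda_j-\mu_j}V\Bigr),$$ where $\alpha$ embeds as the tensors antisymmetric in the places labeling each column and $\beta$ symmetrizes over the places labeling each row; it is independent of the labeling up to isomorphism. A rim hook is a connected skew diagram containing no $2\times2$-square; the empty diagram is allowed, with $S^{\emptyset}V=k$ the trivial representation. *)

theory Defs
  imports
    "HOL-Library.Poly_Mapping"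
    "HOL-Library.Product_Plus"
    "HOL-Combinatorics.Permutations"
    "HOL-Combinatorics.List_Permutation"
    "HOL-Computational_Algebra.Polynomial"
begin

section \<open>Words and monomial algebras\<close>

text \<open>Words form the free monoid under concatenation.  With this instance, the convolution
  product on \<^typ>\<open>'a list \<Rightarrow>\<^sub>0 'k\<close> makes it the free associative algebra over
  \<^typ>\<open>'k\<close> on \<^typ>\<open>'a\<close>; likewise
  \<^typ>\<open>('a \<Rightarrow>\<^sub>0 nat) \<Rightarrow>\<^sub>0 'k\<close> is the commutative polynomial ring.\<close>

instantiation list :: (type) monoid_add
begin

definition zero_list :: "'a list" where "zero_list = []"

definition plus_list :: "'a list \<Rightarrow> 'a list \<Rightarrow> 'a list" where "plus_list u v = u @ v"

instance by standard (simp_all add: zero_list_def plus_list_def)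

end

definition lsum :: "('w \<Rightarrow> 'm \<Rightarrow> 'b::comm_monoid_add) \<Rightarrow> ('w \<Rightarrow>\<^sub>0 'm::zero) \<Rightarrow> 'b" where
  "lsum g t = (\<Sum>w\<in>Poly_Mapping.keys t. g w (Poly_Mapping.lookup t w))"

text \<open>Let \<open>F\<close> be the free vector space on a set of monomials of type \<^typ>\<open>'w\<close>, and let
  \<open>M\<close> be a vector space of type \<^typ>\<open>'m\<close> with scalar multiplication \<open>s\<close>.  The tensor
  product \<open>F \<otimes> M\<close> is the type \<^typ>\<open>'w \<Rightarrow>\<^sub>0 'm\<close>: the element
  \<open>\<Sum> w \<otimes> m\<^sub>w\<close> is the finitely supported function \<open>w \<mapsto> m\<^sub>w\<close>.\<close>

definition pscale :: "('k \<Rightarrow> 'm \<Rightarrow> 'm::zero) \<Rightarrow> 'k \<Rightarrow> ('w \<Rightarrow>\<^sub>0 'm) \<Rightarrow> ('w \<Rightarrow>\<^sub>0 'm)" where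
  "pscale s c t = Poly_Mapping.map (s c) t"

abbreviation fscale :: "'k::mult_zero \<Rightarrow> ('w \<Rightarrow>\<^sub>0 'k) \<Rightarrow> ('w \<Rightarrow>\<^sub>0 'k)" where
  "fscale \<equiv> pscale (*)"

definition pure_tensor ::
  "('k::zero \<Rightarrow> 'm \<Rightarrow> 'm::zero) \<Rightarrow> ('w \<Rightarrow>\<^sub>0 'k) \<Rightarrow> 'm \<Rightarrow> ('w \<Rightarrow>\<^sub>0 'm)" where
  "pure_tensor s f m = Poly_Mapping.map (\<lambda>c. s c m) f"

definition tensors :: "'w set \<Rightarrow> 'm::zero set \<Rightarrow> ('w \<Rightarrow>\<^sub>0 'm) set" where
  "tensors G W = {t. Poly_Mapping.keys t \<subseteq> G \<and> (\<forall>w. Poly_Mapping.lookup t w \<in> insert 0 W)}"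

definition subspace_tensor ::
  "('k::field \<Rightarrow> 'm \<Rightarrow> 'm::ab_group_add) \<Rightarrow> ('w \<Rightarrow>\<^sub>0 'k) set \<Rightarrow> 'm set \<Rightarrow> ('w \<Rightarrow>\<^sub>0 'm) set" where
  "subspace_tensor s J W = module.span (pscale s) {pure_tensor s f m | f m. f \<in> J \<and> m \<in> W}"

definition free_tensor ::
  "('v \<Rightarrow>\<^sub>0 'k) \<Rightarrow> ('w \<Rightarrow>\<^sub>0 'k) \<Rightarrow> ('v \<times> 'w \<Rightarrow>\<^sub>0 'k::comm_ring_1)" where
  "free_tensor f g = lsum (\<lambda>u a. lsum (\<lambda>v b. Poly_Mapping.single (u, v) (a * b)) g) f"


section \<open>Coalgebras and comodules\<close>

text \<open>A coalgebra is given as a quotient \<open>C = F / I\<close>, where \<open>F\<close> is the free vector space on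
  the set \<open>monoms\<close>, the subspace \<open>I\<close> is \<open>rels\<close>, and the coproduct and counit are induced by
  linear maps \<open>F \<rightarrow> F \<otimes> F\<close> and \<open>F \<rightarrow> k\<close>, given on monomials.\<close>

record (overloaded) ('w, 'k) coalg =
  monoms :: "'w set"
  rels :: "('w \<Rightarrow>\<^sub>0 'k::zero) set"
  comul :: "'w \<Rightarrow> ('w \<times> 'w \<Rightarrow>\<^sub>0 'k)"
  counit :: "'w \<Rightarrow> 'k"

definition carrier_coalg :: "('w, 'k::zero) coalg \<Rightarrow> ('w \<Rightarrow>\<^sub>0 'k) set" where
  "carrier_coalg C = {f. Poly_Mapping.keys f \<subseteq> monoms C}"

text \<open>The kernel \<open>I \<otimes> F + F \<otimes> I\<close> of \<open>F \<otimes> F \<rightarrow> C \<otimes> C\<close> is spanned by the following set.\<close>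

definition rels2 :: "('w, 'k::field) coalg \<Rightarrow> ('w \<times> 'w \<Rightarrow>\<^sub>0 'k) set" where
  "rels2 C = {free_tensor f g | f g. f \<in> rels C \<and> g \<in> carrier_coalg C}
           \<union> {free_tensor f g | f g. f \<in> carrier_coalg C \<and> g \<in> rels C}"

definition comul_tensor_id ::
  "('w, 'k::field) coalg \<Rightarrow> ('k \<Rightarrow> 'm \<Rightarrow> 'm::ab_group_add) \<Rightarrow> ('w \<Rightarrow>\<^sub>0 'm) \<Rightarrow> ('w \<times> 'w \<Rightarrow>\<^sub>0 'm)" where
  "comul_tensor_id C s = lsum (\<lambda>w m. pure_tensor s (comul C w) m)"

definition id_tensor_coact ::
  "('m \<Rightarrow> ('w \<Rightarrow>\<^sub>0 'm)) \<Rightarrow> ('w \<Rightarrow>\<^sub>0 'm::ab_group_add) \<Rightarrow> ('w \<times> 'w \<Rightarrow>\<^sub>0 'm)" where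
  "id_tensor_coact \<rho> =
     lsum (\<lambda>w m. lsum (\<lambda>w' m'. Poly_Mapping.single (w, w') m') (\<rho> m))"

text \<open>A left comodule over \<open>C = F / I\<close> on a subspace \<open>W\<close> of \<open>M\<close>.  A linear map
  \<open>W \<rightarrow> C \<otimes> W = (F \<otimes> W) / (I \<otimes> W)\<close> is represented by a linear lift
  \<open>\<rho>\<close> with values in \<open>F \<otimes> W\<close> (over a field such a lift always exists, and it extends to a
  linear map on \<open>M\<close>; values outside \<open>W\<close> are irrelevant).  All identities in \<open>C \<otimes> W\<close>
  and \<open>C \<otimes> C \<otimes> W\<close> are therefore stated modulo \<open>I \<otimes> W\<close> and
  \<open>(I \<otimes> F + F \<otimes> I) \<otimes> W\<close>.\<close>

definition comodule ::
  "('w, 'k::field) coalg \<Rightarrow> ('k \<Rightarrow> 'm \<Rightarrow> 'm::ab_group_add) \<Rightarrow> 'm set \<Rightarrow> ('m \<Rightarrow> ('w \<Rightarrow>\<^sub>0 'm)) \<Rightarrow> bool"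
where
  "comodule C s W \<rho> \<longleftrightarrow>
     vector_space s \<and> module.subspace s W \<and>
     Vector_Spaces.linear s (pscale s) \<rho> \<and>
     (\<forall>m\<in>W. \<rho> m \<in> tensors (monoms C) W) \<and>
     (\<forall>m\<in>W. lsum (\<lambda>w m'. s (counit C w) m') (\<rho> m) = m) \<and>
     (\<forall>m\<in>W. comul_tensor_id C s (\<rho> m) - id_tensor_coact \<rho> (\<rho> m)
              \<in> subspace_tensor s (rels2 C) W)"

definition subcomodule ::
  "('w, 'k::field) coalg \<Rightarrow> ('k \<Rightarrow> 'm \<Rightarrow> 'm::ab_group_add) \<Rightarrow> 'm set \<Rightarrow> ('m \<Rightarrow> ('w \<Rightarrow>\<^sub>0 'm))
     \<Rightarrow> 'm set \<Rightarrow> bool" where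
  "subcomodule C s W \<rho> N \<longleftrightarrow>
     module.subspace s N \<and> N \<subseteq> W \<and>
     (\<forall>m\<in>N. \<exists>t\<in>tensors (monoms C) N. \<rho> m - t \<in> subspace_tensor s (rels C) W)"

definition simple_comodule ::
  "('w, 'k::field) coalg \<Rightarrow> ('k \<Rightarrow> 'm \<Rightarrow> 'm::ab_group_add) \<Rightarrow> 'm set \<Rightarrow> ('m \<Rightarrow> ('w \<Rightarrow>\<^sub>0 'm)) \<Rightarrow> bool"
where
  "simple_comodule C s W \<rho> \<longleftrightarrow>
     comodule C s W \<rho> \<and> W \<noteq> {0} \<and> (\<forall>N. subcomodule C s W \<rho> N \<longrightarrow> N = {0} \<or> N = W)"

text \<open>A linear map defined on \<open>W\<close> only extends to the ambient space, so quantifying over linear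
  maps of ambient spaces loses nothing.\<close>

definition comodule_iso ::
  "('w, 'k::field) coalg
     \<Rightarrow> ('k \<Rightarrow> 'm \<Rightarrow> 'm::ab_group_add) \<Rightarrow> 'm set \<Rightarrow> ('m \<Rightarrow> ('w \<Rightarrow>\<^sub>0 'm))
     \<Rightarrow> ('k \<Rightarrow> 'n \<Rightarrow> 'n::ab_group_add) \<Rightarrow> 'n set \<Rightarrow> ('n \<Rightarrow> ('w \<Rightarrow>\<^sub>0 'n)) \<Rightarrow> bool" where
  "comodule_iso C s W \<rho> s' W' \<rho>' \<longleftrightarrow>
     (\<exists>f. Vector_Spaces.linear s s' f \<and> bij_betw f W W' \<and>
          (\<forall>m\<in>W. \<rho>' (f m) - Poly_Mapping.map f (\<rho> m) \<in> subspace_tensor s' (rels C) W'))"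


section \<open>Tensor powers of V\<close>

text \<open>Throughout, \<open>X\<close> is a basis of \<open>V\<close>, and basis vectors serve as their own indices.
  The tensor power \<open>V\<^sup>\<otimes>\<^sup>p\<close> has as basis the words of length \<open>p\<close> over \<open>X\<close>.\<close>

definition words :: "'v set \<Rightarrow> nat \<Rightarrow> 'v list set" where
  "words X p = {w. length w = p \<and> set w \<subseteq> X}"

definition tensor_power :: "'v set \<Rightarrow> nat \<Rightarrow> ('v list \<Rightarrow>\<^sub>0 'k::zero) set" where
  "tensor_power X p = {t. Poly_Mapping.keys t \<subseteq> words X p}"

definition wedge2 :: "'v set \<Rightarrow> ('v list \<Rightarrow>\<^sub>0 'k::field) set" where
  "wedge2 X = module.span fscale
     {Poly_Mapping.single [i, j] 1 - Poly_Mapping.single [j, i] 1 | i j. i \<in> X \<and> j \<in> X}"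

text \<open>The annihilator of \<open>\<wedge>\<^sup>2V\<close> in \<open>V\<^sup>* \<otimes> V\<^sup>*\<close>; here the word \<open>[a, b]\<close> stands for the
  tensor of dual basis vectors \<open>x\<^sub>a\<^sup>* \<otimes> x\<^sub>b\<^sup>*\<close>.\<close>

definition wedge2_perp :: "'v set \<Rightarrow> ('v list \<Rightarrow>\<^sub>0 'k::field) set" where
  "wedge2_perp X = {\<phi> \<in> tensor_power X 2.
     \<forall>t\<in>wedge2 X. (\<Sum>w\<in>words X 2. Poly_Mapping.lookup \<phi> w * Poly_Mapping.lookup t w) = 0}"


section \<open>The bialgebra end(SV)\<close>

text \<open>The generator \<open>z\<^sub>i\<^sup>j = x\<^sub>j\<^sup>* \<otimes> x\<^sub>i\<close> is the pair \<open>(i, j)\<close>.  Hence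
  \<open>f\<^sub>1 \<otimes> f\<^sub>2 \<otimes> v\<^sub>1 \<otimes> v\<^sub>2 \<mapsto> f\<^sub>1 \<otimes> v\<^sub>1 \<otimes> f\<^sub>2 \<otimes> v\<^sub>2\<close> sends, for words \<open>a\<close>, \<open>c\<close> of length two,
  \<open>x\<^sub>a\<^sup>* \<otimes> x\<^sub>c\<close> to the word \<open>zip c a\<close>.\<close>

definition shuffle_tensor ::
  "('v list \<Rightarrow>\<^sub>0 'k) \<Rightarrow> ('v list \<Rightarrow>\<^sub>0 'k) \<Rightarrow> (('v \<times> 'v) list \<Rightarrow>\<^sub>0 'k::field)" where
  "shuffle_tensor \<phi> t =
     lsum (\<lambda>a x. lsum (\<lambda>c y. Poly_Mapping.single (zip c a) (x * y)) t) \<phi>"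

definition end_words :: "'v set \<Rightarrow> ('v \<times> 'v) list set" where
  "end_words X = {w. set w \<subseteq> X \<times> X}"

definition end_ideal :: "'v set \<Rightarrow> (('v \<times> 'v) list \<Rightarrow>\<^sub>0 'k::field) set" where
  "end_ideal X = module.span fscale
     {f * shuffle_tensor \<phi> t * g | f \<phi> t g.
        Poly_Mapping.keys f \<subseteq> end_words X \<and> Poly_Mapping.keys g \<subseteq> end_words X \<and>
        \<phi> \<in> wedge2_perp X \<and> t \<in> wedge2 X}"

text \<open>The coproduct is an algebra morphism for the componentwise multiplication of
  \<open>F \<otimes> F\<close>, which is the convolution product over pairs of monomials.\<close>

definition end_comul ::
  "'v set \<Rightarrow> ('v \<times> 'v) list \<Rightarrow> (('v \<times> 'v) list \<times> ('v \<times> 'v) list \<Rightarrow>\<^sub>0 'k::field)" where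
  "end_comul X w =
     prod_list (map (\<lambda>(i, j). \<Sum>l\<in>X. Poly_Mapping.single ([(i, l)], [(l, j)]) 1) w)"

definition end_counit :: "('v \<times> 'v) list \<Rightarrow> 'k::field" where
  "end_counit w = prod_list (map (\<lambda>(i, j). of_bool (i = j)) w)"

definition end_SV :: "'v set \<Rightarrow> (('v \<times> 'v) list, 'k::field) coalg" where
  "end_SV X = \<lparr>monoms = end_words X, rels = end_ideal X,
               comul = end_comul X, counit = end_counit\<rparr>"


section \<open>The coordinate ring of the monoid of matrices\<close>

type_synonym 'v monomial = "('v \<times> 'v) \<Rightarrow>\<^sub>0 nat"

definition mat_comul ::
  "'v set \<Rightarrow> 'v monomial \<Rightarrow> ('v monomial \<times> 'v monomial \<Rightarrow>\<^sub>0 'k::field)" where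
  "mat_comul X e =
     (\<Prod>(i, j)\<in>Poly_Mapping.keys e.
        (\<Sum>l\<in>X. Poly_Mapping.single
                  (Poly_Mapping.single (i, l) 1, Poly_Mapping.single (l, j) 1) 1)
        ^ Poly_Mapping.lookup e (i, j))"

definition mat_counit :: "'v monomial \<Rightarrow> 'k::field" where
  "mat_counit e =
     (\<Prod>(i, j)\<in>Poly_Mapping.keys e. of_bool (i = j) ^ Poly_Mapping.lookup e (i, j))"

definition mat_O :: "'v set \<Rightarrow> ('v monomial, 'k::field) coalg" where
  "mat_O X = \<lparr>monoms = {e. Poly_Mapping.keys e \<subseteq> X \<times> X}, rels = {0},
              comul = mat_comul X, counit = mat_counit\<rparr>"

definition monomial_of_word :: "('v \<times> 'v) list \<Rightarrow> 'v monomial" where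
  "monomial_of_word w = sum_list (map (\<lambda>z. Poly_Mapping.single z 1) w)"

text \<open>Composition of a coaction of \<^const>\<open>end_SV\<close> with the homomorphism to \<^const>\<open>mat_O\<close>
  given by \<open>z\<^sub>i\<^sup>j \<mapsto> z\<^sub>i\<^sup>j\<close>.\<close>

definition as_mat_rep ::
  "('m \<Rightarrow> (('v \<times> 'v) list \<Rightarrow>\<^sub>0 'm)) \<Rightarrow> 'm \<Rightarrow> ('v monomial \<Rightarrow>\<^sub>0 'm::ab_group_add)" where
  "as_mat_rep \<rho> m = lsum (\<lambda>w m'. Poly_Mapping.single (monomial_of_word w) m') (\<rho> m)"

text \<open>The tensor powers of the standard comodule \<open>x\<^sub>i \<mapsto> \<Sum>\<^sub>l z\<^sub>i\<^sup>l \<otimes> x\<^sub>l\<close>.\<close>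

definition mat_coact ::
  "'v set \<Rightarrow> ('v list \<Rightarrow>\<^sub>0 'k::field) \<Rightarrow> ('v monomial \<Rightarrow>\<^sub>0 ('v list \<Rightarrow>\<^sub>0 'k))" where
  "mat_coact X = lsum (\<lambda>w c. \<Sum>u\<in>words X (length w).
     Poly_Mapping.single (monomial_of_word (zip w u)) (Poly_Mapping.single u c))"


section \<open>Skew diagrams and skew Schur functors\<close>

text \<open>Partitions are weakly decreasing, eventually zero sequences (rows indexed from 0); the box
  in row \<open>i\<close> and column \<open>j\<close> is \<open>(i, j)\<close>.\<close>

definition is_partition :: "(nat \<Rightarrow> nat) \<Rightarrow> bool" where
  "is_partition lam \<longleftrightarrow> antimono lam \<and> finite {i. lam i \<noteq> 0}"

definition young_diagram :: "(nat \<Rightarrow> nat) \<Rightarrow> (nat \<times> nat) set" where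
  "young_diagram lam = {(i, j). j < lam i}"

definition skew_diagram :: "(nat \<Rightarrow> nat) \<Rightarrow> (nat \<Rightarrow> nat) \<Rightarrow> (nat \<times> nat) set" where
  "skew_diagram lam mu = young_diagram lam - young_diagram mu"

definition adjacent :: "nat \<times> nat \<Rightarrow> nat \<times> nat \<Rightarrow> bool" where
  "adjacent b c \<longleftrightarrow>
     (fst b = fst c \<and> (snd c = Suc (snd b) \<or> snd b = Suc (snd c))) \<or>
     (snd b = snd c \<and> (fst c = Suc (fst b) \<or> fst b = Suc (fst c)))"

definition connected_diagram :: "(nat \<times> nat) set \<Rightarrow> bool" where
  "connected_diagram D \<longleftrightarrow>
     (\<forall>b\<in>D. \<forall>c\<in>D. (b, c) \<in> {(x, y). x \<in> D \<and> y \<in> D \<and> adjacent x y}\<^sup>*)"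

definition rim_hook :: "(nat \<Rightarrow> nat) \<Rightarrow> (nat \<Rightarrow> nat) \<Rightarrow> bool" where
  "rim_hook lam mu \<longleftrightarrow>
     is_partition lam \<and> is_partition mu \<and> young_diagram mu \<subseteq> young_diagram lam \<and>
     connected_diagram (skew_diagram lam mu) \<and>
     (\<nexists>i j. {(i, j), (Suc i, j), (i, Suc j), (Suc i, Suc j)} \<subseteq> skew_diagram lam mu)"

text \<open>Labels, and the tensor places they name, are counted from 0.\<close>

definition labeling :: "(nat \<times> nat) set \<Rightarrow> (nat \<times> nat \<Rightarrow> nat) \<Rightarrow> bool" where
  "labeling D l \<longleftrightarrow> bij_betw l D {..<card D}"

text \<open>Permutations of the places that preserve the blocks of places on which \<open>f\<close> (\<^const>\<open>fst\<close>
  for rows, \<^const>\<open>snd\<close> for columns) is constant.\<close>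

definition block_perms ::
  "(nat \<times> nat) set \<Rightarrow> (nat \<times> nat \<Rightarrow> nat) \<Rightarrow> (nat \<times> nat \<Rightarrow> nat) \<Rightarrow> (nat \<Rightarrow> nat) set" where
  "block_perms D l f = {\<sigma>. \<sigma> permutes {..<card D} \<and>
     (\<forall>b\<in>D. \<forall>c\<in>D. \<sigma> (l b) = l c \<longrightarrow> f b = f c)}"

definition place_perm ::
  "(nat \<Rightarrow> nat) \<Rightarrow> ('v list \<Rightarrow>\<^sub>0 'k) \<Rightarrow> ('v list \<Rightarrow>\<^sub>0 'k::comm_monoid_add)" where
  "place_perm \<sigma> = lsum (\<lambda>w c. Poly_Mapping.single (permute_list \<sigma> w) c)"

definition column_antisymmetric ::
  "'v set \<Rightarrow> (nat \<times> nat) set \<Rightarrow> (nat \<times> nat \<Rightarrow> nat) \<Rightarrow> ('v list \<Rightarrow>\<^sub>0 'k::field) set" where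
  "column_antisymmetric X D l = {t \<in> tensor_power X (card D).
     \<forall>\<sigma>\<in>block_perms D l snd. place_perm \<sigma> t = fscale (of_int (sign \<sigma>)) t}"

definition row_symmetrize ::
  "(nat \<times> nat) set \<Rightarrow> (nat \<times> nat \<Rightarrow> nat) \<Rightarrow> ('v list \<Rightarrow>\<^sub>0 'k) \<Rightarrow> ('v list \<Rightarrow>\<^sub>0 'k::field)" where
  "row_symmetrize D l t = (\<Sum>\<sigma>\<in>block_perms D l fst. place_perm \<sigma> t)"

text \<open>The product of the \<open>S\<^sup>aV\<close> over the rows (\<open>a\<close> the row length) is realised, as usual in
  characteristic zero, as the space of tensors that are symmetric in the places of each row.  The
  symmetrization is not divided by the order of the group, which does not affect the image.
  The result is a subspace of the tensor power, stable under \<^const>\<open>mat_coact\<close>.\<close>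

definition skew_schur ::
  "'v set \<Rightarrow> (nat \<times> nat) set \<Rightarrow> (nat \<times> nat \<Rightarrow> nat) \<Rightarrow> ('v list \<Rightarrow>\<^sub>0 'k::field) set" where
  "skew_schur X D l = row_symmetrize D l ` column_antisymmetric X D l"

end

theory Submission
  imports Defs "HOL-Library.List_Lexorder"
begin

text \<open>Inside \<open>V\<^sup>\<otimes>\<^sup>p\<close> let \<open>R\<^sub>i\<close> be the space of tensors that are antisymmetric in the adjacent places \<open>i\<close>
and \<open>i + 1\<close>.  The degree \<open>p\<close> part of end(SV) is dual to the algebra of all operators on
\<open>V\<^sup>\<otimes>\<^sup>p\<close> that preserve every \<open>R\<^sub>i\<close>: the generating relations pair the annihilator of \<open>\<wedge>\<^sup>2V\<close> with
\<open>\<wedge>\<^sup>2V\<close> in two adjacent places, so a functional vanishes on them exactly when the operator with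
these matrix entries maps each \<open>R\<^sub>i\<close> into itself.

Everything rests on a basis of \<open>V\<^sup>\<otimes>\<^sup>p\<close> that is adapted to all \<open>R\<^sub>i\<close> at once (the distributivity
behind the Koszulness of SV).  Order the basis \<open>X\<close> of \<open>V\<close>, let \<open>D(w)\<close> be the descent set of a word
\<open>w\<close>, and let \<open>b\<^sub>w\<close> be the antisymmetrization of \<open>w\<close> over the maximal runs of consecutive descents.
Then \<open>b\<^sub>w\<close> is \<open>w\<close> plus lexicographically smaller words, so the \<open>b\<^sub>w\<close> form a basis; \<open>b\<^sub>w\<close> lies in
\<open>R\<^sub>i\<close> for \<open>i \<in> D(w)\<close>; and the dual basis vector of \<open>w\<close> is symmetric in the places \<open>i\<close> and \<open>i + 1\<close>,
that is, it kills \<open>R\<^sub>i\<close>, for \<open>i \<notin> D(w)\<close> (\<open>dual_swap\<close>).  Let \<open>e\<^sub>u\<^sub>w\<close> be the matrix coefficients of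
\<open>V\<^sup>\<otimes>\<^sup>p\<close> in this basis.  They span the degree \<open>p\<close> part of end(SV), they vanish unless
\<open>D(u) \<subseteq> D(w)\<close> (\<open>mat_el_in_end_ideal\<close>), and for \<open>D(u) \<subseteq> D(w)\<close> the dual matrix units are well
defined functionals on end(SV) (\<open>pairing_mat_fun_end_ideal\<close>).  So end(SV) is a direct sum of block
triangular matrix coalgebras, the blocks being indexed by the sets \<open>S\<close> of descents.  Its simple
comodules are therefore the diagonal blocks: the space with basis \<open>x\<^sub>w\<close>, \<open>D(w) = S\<close>, and coaction
\<open>x\<^sub>w \<mapsto> \<Sum> e\<^sub>w\<^sub>v \<otimes> x\<^sub>v\<close> over the \<open>v\<close> with \<open>D(v) = S\<close>.  Both directions are elementary from here:
matrix units applied to one vector of a simple comodule produce such a basis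
(\<open>simple_has_ribbon_basis\<close>), and conversely a matrix unit isolates any basis vector from any
nonzero vector (\<open>simple_comodule_descent_space\<close>).

It remains to recognize the diagonal block of \<open>S\<close> as a skew Schur functor.  Walk through \<open>p\<close> boxes,
one row up at the places in \<open>S\<close> and one column to the right at the others.  The columns
of the resulting ribbon are the runs of \<open>S\<close> and its rows are the runs of the complement.
The column-antisymmetric tensors are spanned by the \<open>b\<^sub>w\<close> with \<open>S \<subseteq> D(w)\<close>.  The row symmetrizer kills
\<open>b\<^sub>w\<close> as soon as \<open>w\<close> has a descent outside \<open>S\<close>, and it is injective on the span of the \<open>b\<^sub>w\<close> with
\<open>D(w) = S\<close>, because for these \<open>w\<close> the dual basis vectors are invariant under the row group.
Hence the image has a basis indexed by the same words and with the same matrix coefficients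
(\<open>comodule_iso_skew_schur\<close>).  Finally, ribbons are the same as rim hooks: in a rim hook the content
(column minus row) is injective and takes an interval of values, so the boxes, taken in order of
content, form such a walk.\<close>

abbreviation "lookup \<equiv> Poly_Mapping.lookup"
abbreviation "single \<equiv> Poly_Mapping.single"
abbreviation "keys \<equiv> Poly_Mapping.keys"

section \<open>Finitely supported functions and contractions\<close>

lemma lsum_superset:
  assumes "finite A" "keys t \<subseteq> A" "\<And>w. w \<in> A \<Longrightarrow> g w 0 = 0"
  shows "lsum g t = (\<Sum>w\<in>A. g w (lookup t w))"
  unfolding lsum_def
  by (rule sum.mono_neutral_left) (use assms in \<open>auto simp: in_keys_iff\<close>)

lemma additive_zero:
  fixes f :: "'a::ab_group_add \<Rightarrow> 'b::ab_group_add"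
  assumes "\<And>x y. f (x + y) = f x + f y"
  shows "f 0 = 0"
  using assms[of 0 0] by simp

context
  fixes g :: "'w \<Rightarrow> 'm::ab_group_add \<Rightarrow> 'b::ab_group_add"
  assumes g_add: "\<And>w x y. g w (x + y) = g w x + g w y"
begin

lemma g_zero: "g w 0 = 0"
  by (rule additive_zero[of "g w", OF g_add])

lemma lsum_single: "lsum g (single w c) = g w c"
  by (subst lsum_superset[where A = "{w}"]) (auto simp: g_zero)

lemma lsum_add: "lsum g (t + t') = lsum g t + lsum g t'"
proof -
  have "lsum g u = (\<Sum>w\<in>keys t \<union> keys t'. g w (lookup u w))" if "u \<in> {t, t', t + t'}" for u
    by (rule lsum_superset)
      (use that Poly_Mapping.keys_add[of t t'] in \<open>auto simp: g_zero\<close>)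
  then show ?thesis
    by (simp add: lookup_add g_add sum.distrib)
qed

lemma lsum_zero: "lsum g 0 = 0"
  by (simp add: lsum_def)

lemma lsum_sum: "lsum g (\<Sum>i\<in>I. t i) = (\<Sum>i\<in>I. lsum g (t i))"
  by (induction I rule: infinite_finite_induct) (simp_all add: lsum_zero lsum_add)

lemma lsum_diff: "lsum g (t - t') = lsum g t - lsum g t'"
  using lsum_add[of "t - t'" t'] by simp

end

lemma poly_mapping_eq_sum_single: "t = (\<Sum>w\<in>keys t. single w (lookup t w))"
  by (rule poly_mapping_eqI) (auto simp: lookup_sum lookup_single when_def in_keys_iff)

lemma lookup_map_zero:
  assumes "f 0 = 0"
  shows "lookup (Poly_Mapping.map f t) w = f (lookup t w)"
  using assms by (simp add: Poly_Mapping.map.rep_eq when_def)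

lemma vector_space_mult: "vector_space ((*) :: 'k::field \<Rightarrow> 'k \<Rightarrow> 'k)"
  by unfold_locales (auto simp: algebra_simps)

context vector_space
begin

lemma lookup_pscale [simp]: "lookup (pscale scale c t) w = scale c (lookup t w)"
  by (simp add: pscale_def lookup_map_zero)

lemma lookup_pure_tensor [simp]: "lookup (pure_tensor scale f m) w = scale (lookup f w) m"
  by (simp add: pure_tensor_def lookup_map_zero)

lemma vector_space_pscale: "vector_space (pscale scale)"
  by unfold_locales
    (auto intro!: poly_mapping_eqI simp: lookup_add scale_right_distrib scale_left_distrib)

lemma pscale_single: "pscale scale c (single w m) = single w (scale c m)"
  by (rule poly_mapping_eqI) (auto simp: lookup_single when_def)

lemma subspace_subspace_tensor: "module.subspace (pscale scale) (subspace_tensor scale J W)"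
proof -
  interpret P: vector_space "pscale scale" by (rule vector_space_pscale)
  show ?thesis by (simp add: subspace_tensor_def)
qed

lemma pure_tensor_in_subspace_tensor:
  "f \<in> J \<Longrightarrow> m \<in> W \<Longrightarrow> pure_tensor scale f m \<in> subspace_tensor scale J W"
proof -
  interpret P: vector_space "pscale scale" by (rule vector_space_pscale)
  assume "f \<in> J" "m \<in> W"
  then show ?thesis by (auto simp: subspace_tensor_def intro!: P.span_base)
qed

lemma pure_tensor_add_right:
  "pure_tensor scale f (m + n) = pure_tensor scale f m + pure_tensor scale f n"
  by (rule poly_mapping_eqI) (simp add: lookup_add scale_right_distrib)

end

text \<open>Contraction of the first tensor factor with a linear functional, given by its values
  on monomials.\<close>

definition contract ::
  "('k \<Rightarrow> 'm \<Rightarrow> 'm) \<Rightarrow> ('w \<Rightarrow> 'k) \<Rightarrow> ('w \<Rightarrow>\<^sub>0 'm::ab_group_add) \<Rightarrow> 'm" where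
  "contract s T = lsum (\<lambda>z m. s (T z) m)"

abbreviation pairing :: "('w \<Rightarrow> 'k::field) \<Rightarrow> ('w \<Rightarrow>\<^sub>0 'k) \<Rightarrow> 'k" where
  "pairing \<equiv> contract (*)"

context vector_space
begin

lemma contract_single: "contract scale T (single z m) = scale (T z) m"
  by (simp add: contract_def lsum_single scale_right_distrib)

lemma contract_add: "contract scale T (t + t') = contract scale T t + contract scale T t'"
  by (simp add: contract_def lsum_add scale_right_distrib)

lemma contract_diff: "contract scale T (t - t') = contract scale T t - contract scale T t'"
  by (simp add: contract_def lsum_diff scale_right_distrib)

lemma contract_sum: "contract scale T (\<Sum>i\<in>I. t i) = (\<Sum>i\<in>I. contract scale T (t i))"
  by (simp add: contract_def lsum_sum scale_right_distrib)

lemma contract_superset: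
  assumes "finite A" "keys t \<subseteq> A"
  shows "contract scale T t = (\<Sum>z\<in>A. scale (T z) (lookup t z))"
  unfolding contract_def by (rule lsum_superset) (use assms in auto)

lemma contract_cong:
  assumes "\<And>z. z \<in> keys t \<Longrightarrow> T z = T' z"
  shows "contract scale T t = contract scale T' t"
  by (simp add: contract_def lsum_def assms)

lemma contract_sum_left:
  "contract scale (\<lambda>z. \<Sum>i\<in>I. c i * T i z) t = (\<Sum>i\<in>I. scale (c i) (contract scale (T i) t))"
  by (simp add: contract_def lsum_def scale_sum_left scale_sum_right sum.swap[of _ I])

lemma contract_pscale: "contract scale T (pscale scale c t) = scale c (contract scale T t)"
proof -
  have "keys (pscale scale c t) \<subseteq> keys t" by (auto simp: in_keys_iff)
  then show ?thesis
    by (subst (1 2) contract_superset[where A = "keys t"])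
      (auto simp: scale_sum_right mult.commute intro!: sum.cong)
qed

lemma contract_pure_tensor:
  "contract scale T (pure_tensor scale f m) = scale (pairing T f) m"
proof -
  have "keys (pure_tensor scale f m) \<subseteq> keys f" by (auto simp: in_keys_iff)
  then show ?thesis
    by (subst contract_superset[where A = "keys f"])
      (auto simp: contract_def lsum_def scale_sum_left intro!: sum.cong)
qed

lemma linear_contract: "Vector_Spaces.linear (pscale scale) scale (contract scale T)"
proof -
  interpret P: vector_space "pscale scale" by (rule vector_space_pscale)
  show ?thesis by unfold_locales (auto simp: contract_add contract_pscale)
qed

lemma contract_subspace_tensor:
  assumes "t \<in> subspace_tensor scale J W" "\<And>f. f \<in> J \<Longrightarrow> pairing T f = 0"
  shows "contract scale T t = 0"
proof -
  interpret P: vector_space "pscale scale" by (rule vector_space_pscale)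
  interpret T: Vector_Spaces.linear "pscale scale" scale "contract scale T"
    by (rule linear_contract)
  have "\<forall>t\<in>subspace_tensor scale J W. contract scale T t = 0"
    unfolding subspace_tensor_def
    by (rule ballI, erule T.eq_0_on_span[rotated]) (auto simp: contract_pure_tensor assms(2))
  then show ?thesis using assms(1) by blast
qed

lemma contract_tensors:
  assumes "subspace N" "t \<in> tensors G N"
  shows "contract scale T t \<in> N"
  unfolding contract_def lsum_def
  by (intro subspace_sum subspace_scale assms(1)) (use assms in \<open>auto simp: tensors_def subspace_0\<close>)

end

interpretation scalars: vector_space "(*) :: 'k::field \<Rightarrow> 'k \<Rightarrow> 'k"
  by (rule vector_space_mult)

interpretation tensors: vector_space "fscale :: 'k::field \<Rightarrow> ('w \<Rightarrow>\<^sub>0 'k) \<Rightarrow> ('w \<Rightarrow>\<^sub>0 'k)"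
  by (rule scalars.vector_space_pscale)


section \<open>Young subgroups\<close>

text \<open>The function \<open>block A\<close> is constant exactly on the sets of places joined by steps from \<open>A\<close>: the
step from \<open>t\<close> to \<open>Suc t\<close> stays in the block if and only if \<open>t \<in> A\<close>.  The group \<open>young p A\<close> is the
Young subgroup of this decomposition of \<open>{..<p}\<close>.\<close>

definition block :: "nat set \<Rightarrow> nat \<Rightarrow> nat" where
  "block A t = card ({..<t} - A)"

definition young :: "nat \<Rightarrow> nat set \<Rightarrow> (nat \<Rightarrow> nat) set" where
  "young p A = {\<sigma>. \<sigma> permutes {..<p} \<and> (\<forall>i. block A (\<sigma> i) = block A i)}"

abbreviation adj_swap :: "nat \<Rightarrow> 'a list \<Rightarrow> 'a list" where
  "adj_swap i w \<equiv> permute_list (Transposition.transpose i (Suc i)) w"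

lemma block_Suc: "block A (Suc t) = (if t \<in> A then block A t else Suc (block A t))"
  by (simp add: block_def lessThan_Suc insert_Diff_if)

lemma block_eq_iff:
  assumes "a \<le> b"
  shows "block A a = block A b \<longleftrightarrow> {a..<b} \<subseteq> A"
proof -
  have split: "{..<b} - A = ({..<a} - A) \<union> ({a..<b} - A)" using assms by auto
  have "block A b = block A a + card ({a..<b} - A)"
    unfolding block_def split by (rule card_Un_disjoint) auto
  then show ?thesis by auto
qed

lemma young_permutes: "\<sigma> \<in> young p A \<Longrightarrow> \<sigma> permutes {..<p}"
  by (simp add: young_def)

lemma finite_young: "finite (young p A)"
  by (rule finite_subset[OF _ finite_permutations[of "{..<p}"]]) (auto simp: young_def)

lemma id_in_young: "id \<in> young p A"
  by (simp add: young_def permutes_id)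

lemma young_comp: "\<sigma> \<in> young p A \<Longrightarrow> \<tau> \<in> young p A \<Longrightarrow> \<sigma> \<circ> \<tau> \<in> young p A"
  by (auto simp: young_def intro: permutes_compose)

lemma young_inv:
  assumes "\<sigma> \<in> young p A"
  shows "inv \<sigma> \<in> young p A"
proof -
  have "block A (inv \<sigma> i) = block A i" for i
  proof -
    have "block A (inv \<sigma> i) = block A (\<sigma> (inv \<sigma> i))" using assms by (simp add: young_def)
    then show ?thesis using permutes_inverses(1)[OF young_permutes[OF assms]] by simp
  qed
  then show ?thesis using assms by (auto simp: young_def intro: permutes_inv)
qed

lemma young_mono:
  assumes "A \<subseteq> B"
  shows "young p A \<subseteq> young p B"
proof -
  have le: "block B i = block B j" if "block A i = block A j" "i \<le> j" for i j
    using that assms by (auto simp: block_eq_iff)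
  have "block B i = block B j" if "block A i = block A j" for i j
  proof (cases "i \<le> j")
    case True
    then show ?thesis by (rule le[OF that])
  next
    case False
    then show ?thesis using le[OF that[symmetric]] by simp
  qed
  then show ?thesis unfolding young_def by blast
qed

lemma transpose_in_young:
  assumes "a \<le> b" "b < p" "{a..<b} \<subseteq> A"
  shows "Transposition.transpose a b \<in> young p A"
proof -
  have "block A a = block A b" using assms by (simp add: block_eq_iff)
  then show ?thesis
    using assms by (auto simp: young_def Transposition.transpose_def intro!: permutes_swap_id)
qed

lemma adj_transpose_in_young:
  "i \<in> A \<Longrightarrow> Suc i < p \<Longrightarrow> Transposition.transpose i (Suc i) \<in> young p A"
  by (rule transpose_in_young) auto

lemma adj_transpose_permutes:
  "Suc i < p \<Longrightarrow> Transposition.transpose i (Suc i) permutes {..<p}"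
  by (rule permutes_swap_id) auto

lemma bij_betw_young_right:
  assumes "\<tau> \<in> young p A"
  shows "bij_betw (\<lambda>\<sigma>. \<sigma> \<circ> \<tau>) (young p A) (young p A)"
proof (rule bij_betwI[where g = "\<lambda>\<sigma>. \<sigma> \<circ> inv \<tau>"])
  note \<tau> = young_permutes[OF assms]
  show "\<sigma> \<circ> \<tau> \<circ> inv \<tau> = \<sigma>" "\<sigma> \<circ> inv \<tau> \<circ> \<tau> = \<sigma>" for \<sigma>
    using permutes_inv_o[OF \<tau>] by (simp_all add: comp_assoc)
qed (auto intro: young_comp young_inv assms)

lemma bij_betw_young_left:
  assumes "\<tau> \<in> young p A"
  shows "bij_betw (\<lambda>\<sigma>. \<tau> \<circ> \<sigma>) (young p A) (young p A)"
proof (rule bij_betwI[where g = "\<lambda>\<sigma>. inv \<tau> \<circ> \<sigma>"])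
  note \<tau> = young_permutes[OF assms]
  show "inv \<tau> \<circ> (\<tau> \<circ> \<sigma>) = \<sigma>" "\<tau> \<circ> (inv \<tau> \<circ> \<sigma>) = \<sigma>" for \<sigma>
    using permutes_inv_o[OF \<tau>] by (simp_all add: comp_assoc[symmetric])
qed (auto intro: young_comp young_inv assms)

lemma permute_list_in_words:
  "\<sigma> permutes {..<p} \<Longrightarrow> w \<in> words X p \<Longrightarrow> permute_list \<sigma> w \<in> words X p"
  by (auto simp: words_def)

lemma permute_list_comp:
  "\<sigma> permutes {..<p} \<Longrightarrow> \<tau> permutes {..<p} \<Longrightarrow> length w = p \<Longrightarrow>
   permute_list (\<sigma> \<circ> \<tau>) w = permute_list \<tau> (permute_list \<sigma> w)"
  by (simp add: permute_list_compose)

lemma permute_list_inverse: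
  assumes "\<sigma> permutes {..<p}" "length w = p"
  shows "permute_list \<sigma> (permute_list (inv \<sigma>) w) = w" "permute_list (inv \<sigma>) (permute_list \<sigma> w) = w"
  using assms permute_list_comp[of "inv \<sigma>" p \<sigma> w] permute_list_comp[of \<sigma> p "inv \<sigma>" w]
  by (simp_all add: permutes_inv permutes_inv_o)

lemma adj_swap_adj_swap: "Suc i < length w \<Longrightarrow> adj_swap i (adj_swap i w) = w"
  by (subst permute_list_compose[symmetric]) (auto intro: adj_transpose_permutes)

lemma bij_betw_permute_list_words:
  assumes "\<sigma> permutes {..<p}"
  shows "bij_betw (permute_list \<sigma>) (words X p) (words X p)"
  by (rule bij_betwI[where g = "permute_list (inv \<sigma>)"])
    (use assms permutes_inv[OF assms] in
      \<open>auto simp: permute_list_in_words words_def permute_list_inverse\<close>)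

text \<open>A Young subgroup is generated by the adjacent transpositions that it contains.\<close>

lemma young_invariant_of_adj_swap_invariant:
  assumes F: "\<And>i c. i \<in> A \<Longrightarrow> Suc i < p \<Longrightarrow> c \<in> words X p \<Longrightarrow> F (adj_swap i c) = F c"
    and "\<sigma> \<in> young p A" "c \<in> words X p"
  shows "F (permute_list \<sigma> c) = F c"
proof -
  have transp: "F (permute_list (Transposition.transpose a b) c) = F c"
    if "a \<le> b" "b < p" "{a..<b} \<subseteq> A" "c \<in> words X p" for a b c
    using that
  proof (induction b arbitrary: c rule: dec_induct)
    case base
    then show ?case by simp
  next
    case (step b)
    let ?s = "Transposition.transpose b (Suc b)" and ?t = "Transposition.transpose a b"
    have s: "?s permutes {..<p}" and t: "?t permutes {..<p}"
      using step by (auto intro!: permutes_swap_id)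
    have len: "length c = p" using step by (simp add: words_def)
    have b: "b \<in> A" using step by auto
    show ?case
    proof (cases "a = b")
      case True
      then show ?thesis using F[OF b] step by simp
    next
      case False
      then have "Transposition.transpose a (Suc b) = ?s \<circ> (?t \<circ> ?s)"
        using step by (auto simp: fun_eq_iff Transposition.transpose_def)
      then have "permute_list (Transposition.transpose a (Suc b)) c
          = adj_swap b (permute_list ?t (adj_swap b c))"
        using s t len by (simp add: permute_list_comp permutes_compose)
      moreover have "F (adj_swap b (permute_list ?t (adj_swap b c))) = F c"
      proof -
        have "{a..<b} \<subseteq> A" using step by auto
        then show ?thesis using F[OF b] step s t by (simp add: permute_list_in_words)
      qed
      ultimately show ?thesis by simp
    qed
  qed
  show ?thesis
    using assms(2,3)
  proof (induction "card {x. \<sigma> x \<noteq> x}" arbitrary: \<sigma> c rule: less_induct)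
    case less
    note \<sigma> = young_permutes[OF less.prems(1)]
    show ?case
    proof (cases "\<sigma> = id")
      case True
      then show ?thesis by simp
    next
      case False
      then obtain a where a: "\<sigma> a \<noteq> a" by (auto simp: fun_eq_iff)
      define b where "b = \<sigma> a"
      have ab: "a < p" "b < p"
        using a \<sigma> permutes_in_image[OF \<sigma>, of a] unfolding b_def
        by (metis lessThan_iff permutes_not_in)+
      \<comment> \<open>Splitting off this transposition fixes \<open>a\<close> and every point that was fixed before.\<close>
      let ?t = "Transposition.transpose a b"
      define \<tau> where "\<tau> = ?t \<circ> \<sigma>"
      have bl: "block A a = block A b" using less.prems(1) by (simp add: young_def b_def)
      have T: "?t \<in> young p A"
        using ab bl block_eq_iff[of a b A] block_eq_iff[of b a A] transpose_in_young
        by (metis nat_le_linear transpose_commute)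
      have Ft: "F (permute_list ?t c) = F c" if "c \<in> words X p" for c
        using that ab bl block_eq_iff[of a b A] block_eq_iff[of b a A] transp
        by (metis nat_le_linear transpose_commute)
      have \<tau>: "\<tau> \<in> young p A" unfolding \<tau>_def by (rule young_comp[OF T less.prems(1)])
      have \<sigma>_eq: "\<sigma> = ?t \<circ> \<tau>" by (simp add: \<tau>_def fun_eq_iff)
      have "\<tau> x = x" if "\<sigma> x = x" for x
      proof -
        have "x \<noteq> a" using that a by auto
        moreover have "x \<noteq> b" using that a injD[OF permutes_inj[OF \<sigma>], of x a] by (auto simp: b_def)
        ultimately show ?thesis using that by (simp add: \<tau>_def)
      qed
      moreover have "\<tau> a = a" by (simp add: \<tau>_def b_def)
      ultimately have "{x. \<tau> x \<noteq> x} \<subset> {x. \<sigma> x \<noteq> x}" using a by auto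
      moreover have "finite {x. \<sigma> x \<noteq> x}"
        by (rule finite_subset[of _ "{..<p}"]) (use \<sigma> permutes_not_in in fastforce)+
      ultimately have "card {x. \<tau> x \<noteq> x} < card {x. \<sigma> x \<noteq> x}" by (rule psubset_card_mono[rotated])
      then have "F (permute_list \<tau> (permute_list ?t c)) = F (permute_list ?t c)"
        using \<tau> less permute_list_in_words[OF young_permutes[OF T]] by blast
      moreover have "permute_list \<sigma> c = permute_list \<tau> (permute_list ?t c)"
        unfolding \<sigma>_eq using less.prems(2)
        by (intro permute_list_comp[OF young_permutes[OF T] young_permutes[OF \<tau>]])
          (simp add: words_def)
      ultimately show ?thesis using Ft[OF less.prems(2)] by simp
    qed
  qed
qed


section \<open>Permutations of tensor places\<close>

lemma finite_words: "finite X \<Longrightarrow> finite (words X p)"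
  using finite_lists_length_eq[of X p] by (simp add: words_def conj_commute)

lemma place_perm_single: "place_perm \<sigma> (single w (c::'k::ab_group_add)) = single (permute_list \<sigma> w) c"
  by (simp add: place_perm_def lsum_single single_add)

lemma place_perm_sum:
  "place_perm \<sigma> (\<Sum>i\<in>I. (t i :: 'v list \<Rightarrow>\<^sub>0 'k::ab_group_add)) = (\<Sum>i\<in>I. place_perm \<sigma> (t i))"
  by (simp add: place_perm_def lsum_sum single_add)

lemma tensor_power_eq_sum:
  assumes "finite X" "t \<in> tensor_power X p"
  shows "t = (\<Sum>w\<in>words X p. single w (lookup t w))"
  by (rule poly_mapping_eqI)
    (use assms in \<open>auto simp: lookup_sum lookup_single when_def finite_words tensor_power_def in_keys_iff\<close>)

lemma place_perm_eq_sum: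
  assumes "finite X" "t \<in> tensor_power X p"
  shows "place_perm \<sigma> (t :: 'v list \<Rightarrow>\<^sub>0 'k::ab_group_add)
    = (\<Sum>w\<in>words X p. single (permute_list \<sigma> w) (lookup t w))"
  by (subst tensor_power_eq_sum[OF assms]) (simp add: place_perm_sum place_perm_single)

lemma linear_place_perm:
  "Vector_Spaces.linear fscale fscale (place_perm \<sigma> :: ('v list \<Rightarrow>\<^sub>0 'k::field) \<Rightarrow> _)"
proof unfold_locales
  fix c :: 'k and t u :: "'v list \<Rightarrow>\<^sub>0 'k"
  show "place_perm \<sigma> (t + u) = place_perm \<sigma> t + place_perm \<sigma> u"
    by (simp add: place_perm_def lsum_add single_add)
  have "place_perm \<sigma> (fscale c t)
      = place_perm \<sigma> (\<Sum>w\<in>keys t. single w (c * lookup t w))"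
    by (rule arg_cong[where f = "place_perm \<sigma>"], rule poly_mapping_eqI)
      (auto simp: lookup_sum lookup_single when_def in_keys_iff)
  also have "\<dots> = fscale c (\<Sum>w\<in>keys t. place_perm \<sigma> (single w (lookup t w)))"
    by (simp add: place_perm_sum place_perm_single tensors.scale_sum_right scalars.pscale_single)
  also have "(\<Sum>w\<in>keys t. place_perm \<sigma> (single w (lookup t w))) = place_perm \<sigma> t"
    by (subst (2) poly_mapping_eq_sum_single) (simp add: place_perm_sum)
  finally show "place_perm \<sigma> (fscale c t) = fscale c (place_perm \<sigma> t)" .
qed

interpretation place_perm: Vector_Spaces.linear fscale fscale
    "place_perm \<sigma> :: ('v list \<Rightarrow>\<^sub>0 'k::field) \<Rightarrow> _" for \<sigma>
  by (rule linear_place_perm)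

lemma lookup_place_perm:
  assumes "finite X" "t \<in> tensor_power X p" "\<sigma> permutes {..<p}" "w \<in> words X p"
  shows "lookup (place_perm \<sigma> (t :: 'v list \<Rightarrow>\<^sub>0 'k::ab_group_add)) (permute_list \<sigma> w) = lookup t w"
proof -
  have "inj_on (permute_list \<sigma>) (words X p)"
    using bij_betw_permute_list_words[OF assms(3)] by (rule bij_betw_imp_inj_on)
  then have "permute_list \<sigma> v = permute_list \<sigma> w \<longleftrightarrow> v = w" if "v \<in> words X p" for v
    using that assms(4) by (auto dest: inj_onD)
  then show ?thesis
    using assms by (simp add: place_perm_eq_sum lookup_sum lookup_single when_def finite_words)
qed

lemma tensor_power_single: "w \<in> words X p \<Longrightarrow> single w c \<in> tensor_power X p"
  by (simp add: tensor_power_def)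

lemma subspace_tensor_power: "tensors.subspace (tensor_power X p :: ('v list \<Rightarrow>\<^sub>0 'k::field) set)"
  unfolding tensors.subspace_def tensor_power_def subset_iff in_keys_iff
  by (auto simp: lookup_add) (metis add.right_neutral)

lemma place_perm_in_tensor_power:
  assumes "finite X" "t \<in> tensor_power X p" "\<sigma> permutes {..<p}"
  shows "place_perm \<sigma> (t :: 'v list \<Rightarrow>\<^sub>0 'k::field) \<in> tensor_power X p"
  by (subst place_perm_eq_sum[OF assms(1,2)])
    (intro tensors.subspace_sum subspace_tensor_power tensor_power_single permute_list_in_words assms)

lemma place_perm_comp:
  assumes "finite X" "t \<in> tensor_power X p" "\<sigma> permutes {..<p}" "\<tau> permutes {..<p}"
  shows "place_perm (\<sigma> \<circ> \<tau>) (t :: 'v list \<Rightarrow>\<^sub>0 'k::field) = place_perm \<tau> (place_perm \<sigma> t)"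
  using assms by (simp add: place_perm_eq_sum place_perm_sum place_perm_single permute_list_comp words_def)

lemma place_perm_id:
  assumes "finite X" "t \<in> tensor_power X p"
  shows "place_perm id (t :: 'v list \<Rightarrow>\<^sub>0 'k::field) = t"
  using tensor_power_eq_sum[OF assms] place_perm_eq_sum[OF assms, of id] by simp


section \<open>Unitriangular families\<close>

text \<open>The row of \<open>b\<close> with index \<open>v\<close> is \<open>v\<close> plus terms of smaller rank.  Such a family is a basis, and
\<open>top_term\<close> is the leading term of a linear combination.\<close>

locale unitriangular =
  fixes \<Omega> :: "'a set" and \<kappa> :: "'a \<Rightarrow> 'o::linorder" and b :: "'a \<Rightarrow> 'a \<Rightarrow> 'k::field"
  assumes finite_index: "finite \<Omega>" and inj_rank: "inj_on \<kappa> \<Omega>"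
    and diag: "v \<in> \<Omega> \<Longrightarrow> b v v = 1"
    and lower: "v \<in> \<Omega> \<Longrightarrow> a \<in> \<Omega> \<Longrightarrow> b v a \<noteq> 0 \<Longrightarrow> a = v \<or> \<kappa> a < \<kappa> v"
begin

lemma top_term:
  assumes "Q \<subseteq> \<Omega>" "\<exists>v\<in>Q. g v \<noteq> 0"
  obtains v where "v \<in> Q" "g v \<noteq> 0" "\<And>u. u \<in> Q \<Longrightarrow> g u \<noteq> 0 \<Longrightarrow> \<kappa> u \<le> \<kappa> v"
    "(\<Sum>u\<in>Q. g u * b u v) = g v"
proof -
  let ?Z = "{v \<in> Q. g v \<noteq> 0}"
  have fin: "finite Q" using assms(1) finite_index by (rule finite_subset)
  have "finite (\<kappa> ` ?Z)" "\<kappa> ` ?Z \<noteq> {}" using fin assms(2) by auto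
  then have "Max (\<kappa> ` ?Z) \<in> \<kappa> ` ?Z" by (rule Max_in)
  then obtain v where v: "v \<in> Q" "g v \<noteq> 0" "\<kappa> v = Max (\<kappa> ` ?Z)" by auto
  have max: "\<kappa> u \<le> \<kappa> v" if "u \<in> Q" "g u \<noteq> 0" for u
    using that fin by (auto simp: v(3) intro!: Max_ge)
  have "g u * b u v = 0" if "u \<in> Q - {v}" for u
  proof -
    have "u \<in> \<Omega>" "v \<in> \<Omega>" using that v(1) assms(1) by auto
    then show ?thesis using that lower[of u v] max[of u] by fastforce
  qed
  then have "(\<Sum>u\<in>Q - {v}. g u * b u v) = 0" by (rule sum.neutral[OF ballI])
  then have "(\<Sum>u\<in>Q. g u * b u v) = g v * b v v"
    using fin v(1) by (simp add: sum.remove)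
  also have "\<dots> = g v" using v(1) assms(1) diag by auto
  finally show ?thesis using that[OF v(1,2) max] by simp
qed

lemma independent:
  assumes "\<And>a. a \<in> \<Omega> \<Longrightarrow> (\<Sum>v\<in>\<Omega>. g v * b v a) = 0" "v \<in> \<Omega>"
  shows "g v = 0"
proof (rule ccontr)
  assume "g v \<noteq> 0"
  then obtain u where "u \<in> \<Omega>" "g u \<noteq> 0" "(\<Sum>v\<in>\<Omega>. g v * b v u) = g u"
    using top_term[of \<Omega> g] assms(2) by blast
  then show False using assms(1) by auto
qed

lemma spanning:
  assumes "c \<in> \<Omega>"
  shows "\<exists>g. \<forall>a\<in>\<Omega>. (\<Sum>v\<in>\<Omega>. g v * b v a) = of_bool (c = a)"
  using assms
proof (induction "card {u \<in> \<Omega>. \<kappa> u < \<kappa> c}" arbitrary: c rule: less_induct)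
  case less
  let ?L = "{u \<in> \<Omega>. \<kappa> u < \<kappa> c}"
  have "\<exists>g. \<forall>a\<in>\<Omega>. (\<Sum>v\<in>\<Omega>. g v * b v a) = of_bool (u = a)" if "u \<in> ?L" for u
  proof (rule less.hyps)
    show "card {w \<in> \<Omega>. \<kappa> w < \<kappa> u} < card ?L"
      by (rule psubset_card_mono) (use that finite_index in auto)
  qed (use that in auto)
  then obtain G where G: "(\<Sum>v\<in>\<Omega>. G u v * b v a) = of_bool (u = a)" if "u \<in> ?L" "a \<in> \<Omega>" for u a
    by metis
  let ?g = "\<lambda>v. of_bool (v = c) - (\<Sum>u\<in>?L. b c u * G u v)"
  have "(\<Sum>v\<in>\<Omega>. ?g v * b v a) = of_bool (c = a)" if a: "a \<in> \<Omega>" for a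
  proof -
    have "(\<Sum>v\<in>\<Omega>. ?g v * b v a)
        = (\<Sum>v\<in>\<Omega>. of_bool (v = c) * b v a) - (\<Sum>v\<in>\<Omega>. \<Sum>u\<in>?L. b c u * (G u v * b v a))"
      by (simp only: left_diff_distrib sum_subtractf sum_distrib_right mult.assoc)
    also have "(\<Sum>v\<in>\<Omega>. of_bool (v = c) * b v a) = b c a"
      using less.prems finite_index by simp
    also have "(\<Sum>v\<in>\<Omega>. \<Sum>u\<in>?L. b c u * (G u v * b v a)) = (\<Sum>u\<in>?L. b c u * of_bool (u = a))"
      by (subst sum.swap) (intro sum.cong refl, simp only: sum_distrib_left[symmetric] G a)
    also have "\<dots> = (if \<kappa> a < \<kappa> c then b c a else 0)"
      using finite_index a by (simp add: if_distrib cong: if_cong)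
    also have "b c a - \<dots> = of_bool (c = a)"
      using less.prems a diag[of c] lower[of c a] by auto
    finally show ?thesis .
  qed
  then show ?case by (intro exI[of _ ?g] ballI)
qed

lemma dual_family_exists:
  "\<exists>\<beta>. (\<forall>c\<in>\<Omega>. \<forall>a\<in>\<Omega>. (\<Sum>v\<in>\<Omega>. \<beta> v c * b v a) = of_bool (c = a)) \<and>
       (\<forall>u\<in>\<Omega>. \<forall>v\<in>\<Omega>. (\<Sum>c\<in>\<Omega>. b u c * \<beta> v c) = of_bool (u = v))"
proof -
  obtain G where G: "(\<Sum>v\<in>\<Omega>. G c v * b v a) = of_bool (c = a)" if "c \<in> \<Omega>" "a \<in> \<Omega>" for c a
    using spanning by metis
  have dual: "(\<Sum>c\<in>\<Omega>. b u c * G c v) = of_bool (u = v)" if "u \<in> \<Omega>" "v \<in> \<Omega>" for u v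
  proof -
    have "(\<Sum>c\<in>\<Omega>. b u c * G c v) - of_bool (u = v) = 0"
    proof (rule independent[OF _ that(2)])
      fix a assume a: "a \<in> \<Omega>"
      have "(\<Sum>v\<in>\<Omega>. ((\<Sum>c\<in>\<Omega>. b u c * G c v) - of_bool (u = v)) * b v a)
          = (\<Sum>v\<in>\<Omega>. \<Sum>c\<in>\<Omega>. b u c * (G c v * b v a)) - (\<Sum>v\<in>\<Omega>. of_bool (u = v) * b v a)"
        by (simp only: left_diff_distrib sum_subtractf sum_distrib_right mult.assoc)
      also have "(\<Sum>v\<in>\<Omega>. \<Sum>c\<in>\<Omega>. b u c * (G c v * b v a)) = (\<Sum>c\<in>\<Omega>. b u c * of_bool (c = a))"
        by (subst sum.swap) (intro sum.cong refl, simp only: sum_distrib_left[symmetric] G a)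
      finally show "(\<Sum>v\<in>\<Omega>. ((\<Sum>c\<in>\<Omega>. b u c * G c v) - of_bool (u = v)) * b v a) = 0"
        using that(1) a finite_index by simp
    qed
    then show ?thesis by simp
  qed
  show ?thesis
    by (intro exI[of _ "\<lambda>v c. G c v"] conjI ballI G dual)
qed

end


section \<open>The basis of antisymmetrized words\<close>

text \<open>An injection into the natural numbers serves as the total order on the basis of \<open>V\<close>; words are
compared lexicographically.\<close>

locale ordered_alphabet =
  fixes X :: "'v set" and r :: "'v \<Rightarrow> nat"
  assumes finite_X: "finite X" and inj_r: "inj_on r X"
begin

definition descents :: "'v list \<Rightarrow> nat set" where
  "descents w = {i. Suc i < length w \<and> r (w ! Suc i) < r (w ! i)}"

definition antisym_word :: "'v list \<Rightarrow> ('v list \<Rightarrow>\<^sub>0 'k::field_char_0)" where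
  "antisym_word w =
     (\<Sum>\<sigma>\<in>young (length w) (descents w). single (permute_list \<sigma> w) (of_int (sign \<sigma>)))"

lemma decreasing_on_block:
  "i < j \<Longrightarrow> j < length w \<Longrightarrow> {i..<j} \<subseteq> descents w \<Longrightarrow> r (w ! j) < r (w ! i)"
proof (induction j)
  case 0
  then show ?case by simp
next
  case (Suc j)
  have j: "r (w ! Suc j) < r (w ! j)" proof -
    have "j \<in> descents w" using Suc.prems by auto
    then show ?thesis by (simp add: descents_def)
  qed
  show ?case
  proof (cases "i = j")
    case True
    then show ?thesis using j by simp
  next
    case False
    then have "r (w ! j) < r (w ! i)" using Suc by (intro Suc.IH) auto
    then show ?thesis using j by simp
  qed
qed

text \<open>A word decreases strictly along each block of its descent set, so at the first place that a
permutation of the blocks moves, a smaller letter arrives.\<close>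

lemma rank_permute_less:
  assumes "\<sigma> \<in> young (length w) (descents w)" "\<sigma> \<noteq> id"
  shows "map r (permute_list \<sigma> w) < map r w"
proof -
  note \<sigma> = young_permutes[OF assms(1)]
  define i where "i = (LEAST i. \<sigma> i \<noteq> i)"
  have "\<exists>i. \<sigma> i \<noteq> i" using assms(2) by (auto simp: fun_eq_iff)
  have less: "\<sigma> j = j" if "j < i" for j
    using not_less_Least[of j "\<lambda>i. \<sigma> i \<noteq> i"] that by (auto simp: i_def)
  have i: "\<sigma> i \<noteq> i" using \<open>\<exists>i. \<sigma> i \<noteq> i\<close> unfolding i_def by (rule LeastI_ex)
  have ip: "i < length w" using i permutes_not_in[OF \<sigma>] by force
  have sp: "\<sigma> i < length w" using permutes_in_image[OF \<sigma>, of i] ip by simp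
  have "\<not> \<sigma> i < i" using less[of "\<sigma> i"] i injD[OF permutes_inj[OF \<sigma>], of "\<sigma> i" i] by auto
  then have lt: "i < \<sigma> i" using i by simp
  have "block (descents w) i = block (descents w) (\<sigma> i)" using assms(1) by (simp add: young_def)
  then have "{i..<\<sigma> i} \<subseteq> descents w" using lt by (simp add: block_eq_iff)
  then have "r (w ! \<sigma> i) < r (w ! i)" using decreasing_on_block[OF lt sp] by simp
  moreover have "take i (map r (permute_list \<sigma> w)) = take i (map r w)"
    by (rule nth_equalityI) (use ip less in \<open>auto simp: permute_list_nth[OF \<sigma>]\<close>)
  ultimately show ?thesis
    using ip by (auto simp: list_less_def lexord_take_index_conv permute_list_nth[OF \<sigma>] intro!: exI[of _ i])
qed

lemma inj_rank: "inj_on (map r) (words X p)"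
proof (rule inj_onI)
  fix v w assume "v \<in> words X p" "w \<in> words X p" "map r v = map r w"
  then show "v = w"
    by (intro map_inj_on[of r v w] inj_on_subset[OF inj_r]) (auto simp: words_def)
qed

lemma antisym_word_in_tensor_power:
  assumes "w \<in> words X p"
  shows "antisym_word w \<in> tensor_power X p"
  unfolding antisym_word_def
  using assms by (intro tensors.subspace_sum subspace_tensor_power tensor_power_single
      permute_list_in_words[where p = p]) (auto simp: words_def young_permutes)

lemma lookup_antisym_word:
  "lookup (antisym_word w) a
    = (\<Sum>\<sigma>\<in>young (length w) (descents w). of_int (sign \<sigma>) when permute_list \<sigma> w = a)"
  by (simp add: antisym_word_def lookup_sum lookup_single)

lemma lookup_antisym_word_self: "lookup (antisym_word w) w = 1"
proof -
  have "(of_int (sign \<sigma>) when permute_list \<sigma> w = w) = (0 :: 'k::field_char_0)"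
    if "\<sigma> \<in> young (length w) (descents w) - {id}" for \<sigma>
    using rank_permute_less[of \<sigma> w] that by (auto simp: when_def)
  then have "(\<Sum>\<sigma>\<in>young (length w) (descents w) - {id}.
      of_int (sign \<sigma>) when permute_list \<sigma> w = w) = (0 :: 'k::field_char_0)"
    by (rule sum.neutral[OF ballI])
  then show ?thesis
    unfolding lookup_antisym_word
    by (subst sum.remove[OF finite_young id_in_young]) (simp add: sign_id)
qed

lemma lookup_antisym_word_lower:
  assumes "lookup (antisym_word w) a \<noteq> 0"
  shows "a = w \<or> map r a < map r w"
proof -
  obtain \<sigma> where "\<sigma> \<in> young (length w) (descents w)" "permute_list \<sigma> w = a"
    using assms unfolding lookup_antisym_word by (auto simp: when_def elim!: sum.not_neutral_contains_not_neutral split: if_splits)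
  then show ?thesis using rank_permute_less[of \<sigma> w] by (cases "\<sigma> = id") auto
qed

text \<open>A smaller set of places gives a smaller Young subgroup, hence the sign rule holds for every set
of descents and not only for the full descent set.\<close>

lemma place_perm_antisym_word:
  assumes "w \<in> words X p" "A \<subseteq> descents w" "\<tau> \<in> young p A"
  shows "place_perm \<tau> (antisym_word w) = fscale (of_int (sign \<tau>)) (antisym_word w)"
proof -
  let ?Y = "young p (descents w)"
  have len: "length w = p" using assms by (simp add: words_def)
  have \<tau>: "\<tau> \<in> ?Y" using young_mono[OF assms(2)] assms(3) by auto
  note perm = young_permutes[OF \<tau>]
  have sgn: "sign \<sigma> = sign \<tau> * sign (\<sigma> \<circ> \<tau>)" if "\<sigma> \<in> ?Y" for \<sigma>
  proof -
    have "sign (\<sigma> \<circ> \<tau>) = sign \<sigma> * sign \<tau>"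
      using that perm by (intro sign_compose permutation_permutes[THEN iffD2])
        (auto intro: young_permutes finite_lessThan)
    then show ?thesis by (simp add: mult.assoc mult.commute sign_idempotent)
  qed
  have "place_perm \<tau> (antisym_word w)
      = (\<Sum>\<sigma>\<in>?Y. single (permute_list (\<sigma> \<circ> \<tau>) w) (of_int (sign \<sigma>)))"
    unfolding antisym_word_def len place_perm_sum place_perm_single
    by (intro sum.cong refl) (simp add: permute_list_comp[OF young_permutes perm len])
  also have "\<dots> = (\<Sum>\<sigma>\<in>?Y. fscale (of_int (sign \<tau>))
        (single (permute_list (\<sigma> \<circ> \<tau>) w) (of_int (sign (\<sigma> \<circ> \<tau>)))))"
    by (intro sum.cong refl, subst sgn) (simp_all add: scalars.pscale_single)
  also have "\<dots> = fscale (of_int (sign \<tau>))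
      (\<Sum>\<sigma>\<in>?Y. single (permute_list (\<sigma> \<circ> \<tau>) w) (of_int (sign (\<sigma> \<circ> \<tau>))))"
    by (simp add: tensors.scale_sum_right)
  also have "(\<Sum>\<sigma>\<in>?Y. single (permute_list (\<sigma> \<circ> \<tau>) w) (of_int (sign (\<sigma> \<circ> \<tau>)))) = antisym_word w"
    unfolding antisym_word_def len by (rule sum.reindex_bij_betw[OF bij_betw_young_right[OF \<tau>]])
  finally show ?thesis .
qed

lemma place_perm_adj_antisym_word:
  assumes "w \<in> words X p" "i \<in> descents w"
  shows "place_perm (Transposition.transpose i (Suc i)) (antisym_word w :: 'v list \<Rightarrow>\<^sub>0 'k::field_char_0)
    = - antisym_word w"
proof -
  have "Suc i < p" using assms by (auto simp: descents_def words_def)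
  then have "Transposition.transpose i (Suc i) \<in> young p (descents w)"
    using assms by (intro adj_transpose_in_young)
  from place_perm_antisym_word[OF assms(1) subset_refl this]
  have "place_perm (Transposition.transpose i (Suc i)) (antisym_word w :: 'v list \<Rightarrow>\<^sub>0 'k)
    = fscale (- 1) (antisym_word w)"
    by (simp add: sign_swap_id)
  then show ?thesis by simp
qed

lemma lookup_antisym_word_swap:
  assumes "w \<in> words X p" "i \<in> descents w" "c \<in> words X p"
  shows "lookup (antisym_word w) (adj_swap i c) = - (lookup (antisym_word w) c :: 'k::field_char_0)"
proof -
  have "Suc i < p" using assms by (auto simp: descents_def words_def)
  note perm = adj_transpose_permutes[OF this]
  have "lookup (place_perm (Transposition.transpose i (Suc i)) (antisym_word w :: 'v list \<Rightarrow>\<^sub>0 'k))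
      (adj_swap i c) = lookup (antisym_word w) c"
    by (rule lookup_place_perm[OF finite_X antisym_word_in_tensor_power[OF assms(1)] perm assms(3)])
  then have "- lookup (antisym_word w) (adj_swap i c) = (lookup (antisym_word w) c :: 'k)"
    unfolding place_perm_adj_antisym_word[OF assms(1,2)] by simp
  then show ?thesis by (metis add.inverse_inverse)
qed

lemma unitriangular_antisym_word:
  "unitriangular (words X p) (map r) (\<lambda>w a. lookup (antisym_word w) a :: 'k::field_char_0)"
  by unfold_locales
    (use lookup_antisym_word_lower in \<open>auto simp: finite_words finite_X inj_rank lookup_antisym_word_self\<close>)

text \<open>The first identity expands words in antisymmetrized words, the second says that the functionals
are dual to these.  Extension by zero to words of other lengths lets one functional act on tensors
of all degrees.\<close>

definition dual_basis :: "('v list \<Rightarrow> 'v list \<Rightarrow> 'k::field_char_0) \<Rightarrow> bool" where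
  "dual_basis \<beta> \<longleftrightarrow> (\<forall>p.
     (\<forall>c\<in>words X p. \<forall>a\<in>words X p.
        (\<Sum>v\<in>words X p. \<beta> v c * lookup (antisym_word v) a) = of_bool (c = a)) \<and>
     (\<forall>u\<in>words X p. \<forall>v\<in>words X p.
        (\<Sum>c\<in>words X p. lookup (antisym_word u) c * \<beta> v c) = of_bool (u = v)))
   \<and> (\<forall>v c. length c \<noteq> length v \<longrightarrow> \<beta> v c = 0)"

lemma dual_basis_exists: "\<exists>\<beta> :: 'v list \<Rightarrow> 'v list \<Rightarrow> 'k::field_char_0. dual_basis \<beta>"
proof -
  have "\<forall>p. \<exists>B. (\<forall>c\<in>words X p. \<forall>a\<in>words X p.
          (\<Sum>v\<in>words X p. B v c * lookup (antisym_word v) a) = (of_bool (c = a) :: 'k)) \<and>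
      (\<forall>u\<in>words X p. \<forall>v\<in>words X p.
          (\<Sum>c\<in>words X p. lookup (antisym_word u) c * B v c) = of_bool (u = v))"
    by (rule allI, rule unitriangular.dual_family_exists[OF unitriangular_antisym_word])
  from choice[OF this] obtain B :: "nat \<Rightarrow> 'v list \<Rightarrow> 'v list \<Rightarrow> 'k"
    where B: "\<forall>p. (\<forall>c\<in>words X p. \<forall>a\<in>words X p.
          (\<Sum>v\<in>words X p. B p v c * lookup (antisym_word v) a) = of_bool (c = a)) \<and>
      (\<forall>u\<in>words X p. \<forall>v\<in>words X p.
          (\<Sum>c\<in>words X p. lookup (antisym_word u) c * B p v c) = of_bool (u = v))" ..
  have len: "length v = p" if "v \<in> words X p" for v p using that by (simp add: words_def)
  define \<beta> where "\<beta> v c = (if length c = length v then B (length v) v c else 0)" for v c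
  have "\<beta> v c = B p v c" if "v \<in> words X p" "c \<in> words X p" for p v c
    using that by (simp add: \<beta>_def len)
  then have "dual_basis \<beta>"
    unfolding dual_basis_def by (simp add: B cong: sum.cong) (simp add: \<beta>_def)
  then show ?thesis by (intro exI[of _ \<beta>])
qed

end

locale ordered_alphabet_dual = ordered_alphabet X r
  for X :: "'v set" and r :: "'v \<Rightarrow> nat" +
  fixes \<beta> :: "'v list \<Rightarrow> 'v list \<Rightarrow> 'k::field_char_0"
  assumes dual_basis: "dual_basis \<beta>"
begin

abbreviation antisym :: "'v list \<Rightarrow> 'v list \<Rightarrow> 'k" where
  "antisym w \<equiv> lookup (antisym_word w)"

lemma dual_expand:
  "c \<in> words X p \<Longrightarrow> a \<in> words X p \<Longrightarrow> (\<Sum>v\<in>words X p. \<beta> v c * antisym v a) = of_bool (c = a)"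
  using dual_basis by (simp add: dual_basis_def)

lemma dual_orthogonal:
  "u \<in> words X p \<Longrightarrow> v \<in> words X p \<Longrightarrow> (\<Sum>c\<in>words X p. antisym u c * \<beta> v c) = of_bool (u = v)"
  using dual_basis by (simp add: dual_basis_def)

lemma dual_length: "length c \<noteq> length v \<Longrightarrow> \<beta> v c = 0"
  using dual_basis by (simp add: dual_basis_def)

lemma antisym_support: "w \<in> words X p \<Longrightarrow> a \<notin> words X p \<Longrightarrow> antisym w a = 0"
  using antisym_word_in_tensor_power[of w p] by (auto simp: tensor_power_def in_keys_iff)

lemma antisym_swap:
  "w \<in> words X p \<Longrightarrow> i \<in> descents w \<Longrightarrow> c \<in> words X p \<Longrightarrow> antisym w (adj_swap i c) = - antisym w c"
  by (rule lookup_antisym_word_swap)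

text \<open>The tensor \<open>c - adj_swap i c\<close> is antisymmetric in the places \<open>i\<close> and \<open>i + 1\<close>.  In its expansion
in the basis, delete the basis vectors that have this antisymmetry, which are those with \<open>i\<close> among
their descents.  The rest is still antisymmetric, so together with its leading word it contains the
swapped leading word.  But without a descent at \<open>i\<close> the swap makes a word larger, or fixes it.  So
the rest is zero.\<close>

lemma dual_swap:
  assumes v: "v \<in> words X p" and i: "i \<notin> descents v" "Suc i < p" and c: "c \<in> words X p"
  shows "\<beta> v (adj_swap i c) = \<beta> v c"
proof (rule ccontr)
  assume neq: "\<beta> v (adj_swap i c) \<noteq> \<beta> v c"
  let ?s = "adj_swap i"
  interpret T: unitriangular "words X p" "map r" antisym by (rule unitriangular_antisym_word)
  have s_words: "?s a \<in> words X p" and s_s: "?s (?s a) = a" if "a \<in> words X p" for a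
    using that adj_transpose_permutes[OF i(2)] adj_swap_adj_swap[of i a] i(2)
    by (auto simp: permute_list_in_words) (simp add: words_def)
  define g where "g u = \<beta> u c - \<beta> u (?s c)" for u
  define Q where "Q = {u \<in> words X p. i \<notin> descents u}"
  define h where "h a = (\<Sum>u\<in>Q. g u * antisym u a)" for a
  have all: "(\<Sum>u\<in>words X p. g u * antisym u a) = of_bool (c = a) - of_bool (?s c = a)"
    if "a \<in> words X p" for a
    using that c s_words by (simp add: g_def left_diff_distrib sum_subtractf dual_expand)
  have split: "h a = of_bool (c = a) - of_bool (?s c = a)
      - (\<Sum>u\<in>words X p - Q. g u * antisym u a)" if "a \<in> words X p" for a
    unfolding all[OF that, symmetric] h_def
    by (subst sum.subset_diff[of Q "words X p"]) (simp_all add: Q_def finite_words finite_X)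
  have h_swap: "h (?s a) = - h a" if a: "a \<in> words X p" for a
  proof -
    have "(\<Sum>u\<in>words X p - Q. g u * antisym u (?s a)) = - (\<Sum>u\<in>words X p - Q. g u * antisym u a)"
      unfolding sum_negf[symmetric] using a by (intro sum.cong) (auto simp: Q_def antisym_swap)
    moreover have "(c = ?s a) = (?s c = a)" "(?s c = ?s a) = (c = a)" using a c s_s by auto metis+
    ultimately show ?thesis using a by (simp add: split s_words)
  qed
  have "\<exists>u\<in>Q. g u \<noteq> 0" using neq v i(1) by (auto simp: Q_def g_def intro!: bexI[of _ v])
  then obtain u where u: "u \<in> Q" "g u \<noteq> 0" "\<And>w. w \<in> Q \<Longrightarrow> g w \<noteq> 0 \<Longrightarrow> map r w \<le> map r u"
    "h u = g u"
    using T.top_term[of Q g] unfolding h_def Q_def by blast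
  have uw: "u \<in> words X p" "length u = p" "set u \<subseteq> X" using u(1) by (auto simp: Q_def words_def)
  have "h (?s u) \<noteq> 0" using h_swap[OF uw(1)] u by simp
  then obtain w where w: "w \<in> Q" "g w \<noteq> 0" "antisym w (?s u) \<noteq> 0"
    unfolding h_def by (metis (no_types, lifting) mult_zero_left mult_zero_right sum.neutral)
  have "map r (?s u) \<le> map r u"
    using lookup_antisym_word_lower[OF w(3)] u(3)[OF w(1,2)] by auto
  moreover have "r (u ! i) \<le> r (u ! Suc i)" using u(1) i(2) uw(2) by (auto simp: Q_def descents_def)
  moreover have perm: "Transposition.transpose i (Suc i) permutes {..<length u}"
    using adj_transpose_permutes[OF i(2)] uw(2) by simp
  ultimately consider "r (u ! i) = r (u ! Suc i)" | "r (u ! i) < r (u ! Suc i)" "map r (?s u) \<le> map r u"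
    by linarith
  then show False
  proof cases
    case 1
    then have eq: "u ! i = u ! Suc i" using inj_r uw i(2) by (auto dest!: inj_onD simp: subset_iff)
    have "?s u = u"
      by (rule nth_equalityI)
        (use eq in \<open>auto simp: permute_list_nth[OF perm] Transposition.transpose_def\<close>)
    then have "g u = - g u" using h_swap[OF uw(1)] u(4) by simp
    then show False using u(2) by simp
  next
    case 2
    have "map r u < map r (?s u)"
      unfolding list_less_def lexord_take_index_conv
      by (auto simp: permute_list_nth[OF perm] Transposition.transpose_def 2(1) uw(2) i(2)
          intro!: disjI2 exI[of _ i] nth_equalityI) (use i(2) uw(2) 2(1) in \<open>simp_all add: permute_list_nth[OF perm]\<close>)
    then show False using 2(2) by simp
  qed
qed

lemma dual_young_invariant:
  assumes "v \<in> words X p" "\<sigma> \<in> young p (- descents v)" "c \<in> words X p"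
  shows "\<beta> v (permute_list \<sigma> c) = \<beta> v c"
  by (rule young_invariant_of_adj_swap_invariant[OF _ assms(2,3)]) (use dual_swap assms(1) in auto)

end


section \<open>The ideal of end(SV)\<close>

lemma words2_iff: "w \<in> words X 2 \<longleftrightarrow> (\<exists>i\<in>X. \<exists>j\<in>X. w = [i, j])"
  by (auto simp: words_def numeral_2_eq_2 length_Suc_conv)

lemma bij_betw_rev_words: "bij_betw rev (words X p) (words X p)"
  by (rule bij_betwI[where g = rev]) (auto simp: words_def)

lemma sum_words_rev: "(\<Sum>c\<in>words X p. f (rev c)) = (\<Sum>c\<in>words X p. f c)"
  by (rule sum.reindex_bij_betw[OF bij_betw_rev_words])

lemma sum_words_rev_antisym:
  fixes f :: "'v list \<Rightarrow> 'k::field_char_0"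
  assumes "\<And>c. c \<in> words X p \<Longrightarrow> f (rev c) = - f c"
  shows "(\<Sum>c\<in>words X p. f c) = 0"
proof -
  have "(\<Sum>c\<in>words X p. f c) = - (\<Sum>c\<in>words X p. f c)"
    by (subst sum_words_rev[symmetric]) (simp add: assms sum_negf)
  then show ?thesis by simp
qed

lemma wedge2_antisymmetric:
  assumes "(t :: 'v list \<Rightarrow>\<^sub>0 'k::field) \<in> wedge2 X"
  shows "t \<in> tensor_power X 2 \<and> (\<forall>c\<in>words X 2. lookup t (rev c) = - lookup t c)"
  using assms unfolding wedge2_def
proof (induction rule: tensors.span_induct_alt)
  case base
  then show ?case by (simp add: tensor_power_def)
next
  case (step a x y)
  then obtain i j where x: "x = single [i, j] 1 - single [j, i] 1" "i \<in> X" "j \<in> X" by auto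
  have "x \<in> tensor_power X 2"
    unfolding x(1) using x(2,3)
    by (intro tensors.subspace_diff[OF subspace_tensor_power] tensor_power_single)
      (auto simp: words2_iff)
  moreover have anti: "lookup x (rev c) = - lookup x c" if "c \<in> words X 2" for c
  proof -
    obtain k l where c: "c = [k, l]" using \<open>c \<in> words X 2\<close> by (auto simp: words2_iff)
    show ?thesis unfolding x(1) c lookup_minus lookup_single by (simp add: when_def conj_commute)
  qed
  ultimately have "fscale a x + y \<in> tensor_power X 2"
    using step.IH
    by (intro tensors.subspace_add[OF subspace_tensor_power]
        tensors.subspace_scale[OF subspace_tensor_power]) auto
  moreover have "lookup (fscale a x + y) (rev c) = - lookup (fscale a x + y) c"
    if "c \<in> words X 2" for c
    using step.IH that anti by (simp add: lookup_add)
  ultimately show ?case by blast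
qed

lemma wedge2_generator: "i \<in> X \<Longrightarrow> j \<in> X \<Longrightarrow> single [i, j] 1 - single [j, i] 1 \<in> wedge2 X"
  unfolding wedge2_def by (intro tensors.span_base) auto

lemma wedge2_perp_symmetric:
  assumes "finite X" "(\<phi> :: 'v list \<Rightarrow>\<^sub>0 'k::field) \<in> wedge2_perp X" "c \<in> words X 2"
  shows "lookup \<phi> (rev c) = lookup \<phi> c"
proof -
  obtain i j where c: "c = [i, j]" "i \<in> X" "j \<in> X" using assms(3) by (auto simp: words2_iff)
  have "0 = (\<Sum>w\<in>words X 2. lookup \<phi> w * lookup (single [i, j] 1 - single [j, i] 1) w)"
    using assms(2) wedge2_generator[OF c(2,3), where 'b = 'k] by (auto simp: wedge2_perp_def)
  also have "\<dots> = (\<Sum>w\<in>words X 2. if [i, j] = w then lookup \<phi> w else 0)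
      - (\<Sum>w\<in>words X 2. if [j, i] = w then lookup \<phi> w else 0)"
    unfolding sum_subtractf[symmetric]
    by (intro sum.cong) (auto simp: lookup_minus lookup_single when_def)
  also have "\<dots> = lookup \<phi> [i, j] - lookup \<phi> [j, i]"
    using c assms(1) by (simp add: finite_words words2_iff)
  finally show ?thesis by (simp add: c)
qed

lemma wedge2_perp_generator:
  assumes "finite X" "i \<in> X" "j \<in> X"
  shows "single [i, j] 1 + single [j, i] (1::'k::field) \<in> wedge2_perp X"
proof -
  have "(\<Sum>w\<in>words X 2. lookup (single [i, j] 1 + single [j, i] 1) w * lookup t w) = 0"
    if "t \<in> wedge2 X" for t :: "'a list \<Rightarrow>\<^sub>0 'k"
  proof -
    have "(\<Sum>w\<in>words X 2. lookup (single [i, j] 1 + single [j, i] 1) w * lookup t w)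
        = (\<Sum>w\<in>words X 2. if [i, j] = w then lookup t w else 0)
        + (\<Sum>w\<in>words X 2. if [j, i] = w then lookup t w else 0)"
      unfolding sum.distrib[symmetric]
      by (intro sum.cong) (auto simp: lookup_add lookup_single when_def)
    also have "\<dots> = lookup t [i, j] + lookup t (rev [i, j])"
      using assms by (simp add: finite_words words2_iff)
    also have "\<dots> = 0"
      using wedge2_antisymmetric[OF that] assms by (simp add: words2_iff del: rev.simps)
    finally show ?thesis .
  qed
  moreover have "single [i, j] 1 + single [j, i] (1::'k) \<in> tensor_power X 2"
    using assms by (intro tensors.subspace_add[OF subspace_tensor_power] tensor_power_single)
      (auto simp: words2_iff)
  ultimately show ?thesis by (simp add: wedge2_perp_def)
qed

lemma shuffle_tensor_eq_sum:
  assumes "finite X" "\<phi> \<in> tensor_power X 2" "t \<in> tensor_power X 2"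
  shows "shuffle_tensor \<phi> t
    = (\<Sum>a\<in>words X 2. \<Sum>c\<in>words X 2. single (zip c a) (lookup \<phi> a * lookup t c))"
proof -
  have "lsum (\<lambda>c y. single (zip c a) (x * y)) t = (\<Sum>c\<in>words X 2. single (zip c a) (x * lookup t c))"
    for a :: "'a list" and x
    by (rule lsum_superset) (use assms in \<open>auto simp: finite_words tensor_power_def\<close>)
  then show ?thesis
    unfolding shuffle_tensor_def
    by (simp only:) (rule lsum_superset, use assms in \<open>auto simp: finite_words tensor_power_def\<close>)
qed

lemma shuffle_tensor_single: "shuffle_tensor (single a x) (single c y) = single (zip c a) (x * y)"
  by (simp add: shuffle_tensor_def lsum_def)

lemma shuffle_tensor_add_left: "shuffle_tensor (\<phi> + \<psi>) t = shuffle_tensor \<phi> t + shuffle_tensor \<psi> t"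
  unfolding shuffle_tensor_def
  by (rule lsum_add) (simp add: lsum_def distrib_right single_add sum.distrib)

lemma shuffle_tensor_diff_right: "shuffle_tensor \<phi> (t - u) = shuffle_tensor \<phi> t - shuffle_tensor \<phi> u"
proof -
  have "lsum (\<lambda>c y. single (zip c a) (x * y)) (t - u)
      = lsum (\<lambda>c y. single (zip c a) (x * y)) t - lsum (\<lambda>c y. single (zip c a) (x * y)) u" for a :: "'a list" and x
    by (rule lsum_diff) (simp add: distrib_left single_add)
  then show ?thesis unfolding shuffle_tensor_def by (simp add: lsum_def sum_subtractf)
qed

text \<open>The ideal is spanned by products of words with the generating relations, so a functional kills
the ideal as soon as it kills the relations placed between two words.\<close>

lemma pairing_end_ideal:
  fixes T :: "('v \<times> 'v) list \<Rightarrow> 'k::field"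
  assumes X: "finite X"
    and T: "\<And>z1 z2 \<phi> t. z1 \<in> end_words X \<Longrightarrow> z2 \<in> end_words X \<Longrightarrow> \<phi> \<in> wedge2_perp X \<Longrightarrow>
      t \<in> wedge2 X \<Longrightarrow>
      (\<Sum>a\<in>words X 2. \<Sum>c\<in>words X 2. lookup \<phi> a * lookup t c * T (z1 @ zip c a @ z2)) = 0"
    and "f \<in> end_ideal X"
  shows "pairing T f = 0"
proof -
  interpret T: Vector_Spaces.linear fscale "(*)" "pairing T" by (rule scalars.linear_contract)
  show ?thesis
  proof (rule T.eq_0_on_span[OF _ assms(3)[unfolded end_ideal_def]])
    fix h :: "('v \<times> 'v) list \<Rightarrow>\<^sub>0 'k"
    assume "h \<in> {f * shuffle_tensor \<phi> t * g | f \<phi> t g.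
        keys f \<subseteq> end_words X \<and> keys g \<subseteq> end_words X \<and> \<phi> \<in> wedge2_perp X \<and> t \<in> wedge2 X}"
    then obtain f g \<phi> t where h: "h = f * shuffle_tensor \<phi> t * g"
      and fg: "keys f \<subseteq> end_words X" "keys g \<subseteq> end_words X"
      and \<phi>t: "\<phi> \<in> wedge2_perp X" "t \<in> wedge2 X" by blast
    have S: "shuffle_tensor \<phi> t
        = (\<Sum>a\<in>words X 2. \<Sum>c\<in>words X 2. single (zip c a) (lookup \<phi> a * lookup t c))"
      using \<phi>t wedge2_antisymmetric[OF \<phi>t(2)]
      by (intro shuffle_tensor_eq_sum X) (auto simp: wedge2_perp_def)
    have "h = (\<Sum>x\<in>keys f. single x (lookup f x)) * shuffle_tensor \<phi> t
        * (\<Sum>y\<in>keys g. single y (lookup g y))"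
      unfolding h using poly_mapping_eq_sum_single[of f] poly_mapping_eq_sum_single[of g] by simp
    also have "\<dots> = (\<Sum>x\<in>keys f. \<Sum>y\<in>keys g. \<Sum>a\<in>words X 2. \<Sum>c\<in>words X 2.
        single (x @ zip c a @ y) (lookup f x * (lookup \<phi> a * lookup t c) * lookup g y))"
      unfolding S sum_distrib_right[of _ "keys f"] sum_product
      by (intro sum.cong refl)
        (simp add: sum_distrib_left sum_distrib_right mult_single plus_list_def)
    finally have h_eq: "h = \<dots>" .
    have "pairing T h = (\<Sum>x\<in>keys f. \<Sum>y\<in>keys g. (lookup f x * lookup g y) *
        (\<Sum>a\<in>words X 2. \<Sum>c\<in>words X 2. lookup \<phi> a * lookup t c * T (x @ zip c a @ y)))"
      unfolding h_eq scalars.contract_sum scalars.contract_single sum_distrib_left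
      by (intro sum.cong refl) (simp only: mult_ac)
    also have "\<dots> = 0" using fg \<phi>t by (intro sum.neutral ballI) (simp add: T subset_iff)
    finally show "pairing T h = 0" .
  qed
qed

lemma monomial_of_word_cong: "mset u = mset v \<Longrightarrow> monomial_of_word u = monomial_of_word v"
  unfolding monomial_of_word_def by (metis mset_map sum_mset_sum_list)

text \<open>Commutative monomials do not see a simultaneous exchange of both pairs of letters, which
changes the sign of a symmetric tensor times an antisymmetric one.  This is the map from end(SV) to
the coordinate ring being well defined, stated for one coefficient at a time.\<close>

lemma pairing_monomial_end_ideal:
  assumes "finite X" "f \<in> end_ideal X"
  shows "pairing (\<lambda>z. of_bool (monomial_of_word z = e)) f = (0::'k::field_char_0)"
proof (rule pairing_end_ideal[OF assms(1) _ assms(2)])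
  fix z1 z2 and \<phi> t :: "'a list \<Rightarrow>\<^sub>0 'k"
  assume "\<phi> \<in> wedge2_perp X" and t: "t \<in> wedge2 X"
  note \<phi> = wedge2_perp_symmetric[OF assms(1) this(1)]
  let ?F = "\<lambda>a c. lookup \<phi> a * lookup t c * of_bool (monomial_of_word (z1 @ zip c a @ z2) = e)"
  have anti: "?F (rev a) (rev c) = - ?F a c" if "a \<in> words X 2" "c \<in> words X 2" for a c
  proof -
    have "mset (z1 @ zip (rev c) (rev a) @ z2) = mset (z1 @ zip c a @ z2)"
      using that by (simp add: zip_rev words_def)
    from monomial_of_word_cong[OF this] show ?thesis
      using \<phi>[OF that(1)] wedge2_antisymmetric[OF t] that(2) by simp
  qed
  have "(\<Sum>a\<in>words X 2. \<Sum>c\<in>words X 2. ?F a c) = (\<Sum>a\<in>words X 2. \<Sum>c\<in>words X 2. ?F (rev a) (rev c))"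
    by (subst sum_words_rev, subst sum_words_rev) (rule refl)
  also have "\<dots> = - (\<Sum>a\<in>words X 2. \<Sum>c\<in>words X 2. ?F a c)"
    unfolding sum_negf[symmetric] by (intro sum.cong refl anti)
  finally show "(\<Sum>a\<in>words X 2. \<Sum>c\<in>words X 2. ?F a c) = 0" by simp
qed

lemma adj_swap_append:
  assumes "length c = 2"
  shows "adj_swap (length x) (x @ c @ y) = x @ rev c @ y"
proof -
  obtain a b where c: "c = [a, b]" using assms by (auto simp: numeral_2_eq_2 length_Suc_conv)
  have perm: "Transposition.transpose (length x) (Suc (length x)) permutes {..<length (x @ a # b # y)}"
    by (rule permutes_swap_id) auto
  show ?thesis
    unfolding c append.simps
    by (rule nth_equalityI)
      (auto simp: permute_list_nth[OF perm] c nth_append nth_Cons' Transposition.transpose_def)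
qed

text \<open>This is the generating relation for a commutator in \<open>V \<otimes> V\<close> and a symmetrized tensor in
\<open>V\<^sup>* \<otimes> V\<^sup>*\<close>, placed between two words.\<close>

lemma word_exchange_in_end_ideal:
  assumes X: "finite X" and i: "Suc i < p" and c: "c \<in> words X p" and a: "a \<in> words X p"
  shows "single (zip c a) 1 - single (zip (adj_swap i c) a) 1
    + (single (zip c (adj_swap i a)) 1 - single (zip (adj_swap i c) (adj_swap i a)) 1)
    \<in> (end_ideal X :: (('v \<times> 'v) list \<Rightarrow>\<^sub>0 'k::field) set)"
proof -
  have split: "\<exists>x w1 w2 y. w = x @ [w1, w2] @ y \<and> length x = i \<and> set (x @ y) \<subseteq> X \<and> w1 \<in> X \<and> w2 \<in> X"
    if "w \<in> words X p" for w
  proof -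
    have w: "Suc i < length w" "set w \<subseteq> X" using that i by (auto simp: words_def)
    have "w = take i w @ [w ! i, w ! Suc i] @ drop (Suc (Suc i)) w"
      using w(1) by (simp add: Cons_nth_drop_Suc)
    moreover have "set (take i w) \<subseteq> X" "set (drop (Suc (Suc i)) w) \<subseteq> X" "w ! i \<in> X" "w ! Suc i \<in> X"
      using w set_take_subset[of i w] set_drop_subset[of "Suc (Suc i)" w]
        nth_mem[of i w] nth_mem[of "Suc i" w] by auto
    ultimately show ?thesis
      using w(1) by (intro exI[of _ "take i w"] exI[of _ "w ! i"] exI[of _ "w ! Suc i"]
        exI[of _ "drop (Suc (Suc i)) w"]) auto
  qed
  obtain x c1 c2 y where c_eq: "c = x @ [c1, c2] @ y" "length x = i"
    and cX: "set (x @ y) \<subseteq> X" "c1 \<in> X" "c2 \<in> X" using split[OF c] by blast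
  obtain x' a1 a2 y' where a_eq: "a = x' @ [a1, a2] @ y'" "length x' = i"
    and aX: "set (x' @ y') \<subseteq> X" "a1 \<in> X" "a2 \<in> X" using split[OF a] by blast
  have len: "length y = length y'" using c a c_eq a_eq by (simp add: words_def)
  have swap: "adj_swap i c = x @ [c2, c1] @ y" "adj_swap i a = x' @ [a2, a1] @ y'"
    using adj_swap_append[of "[c1, c2]" x y] adj_swap_append[of "[a1, a2]" x' y'] c_eq a_eq
    by simp_all
  define f where "f = (single (zip x x') 1 :: ('v \<times> 'v) list \<Rightarrow>\<^sub>0 'k)"
  define g where "g = (single (zip y y') 1 :: ('v \<times> 'v) list \<Rightarrow>\<^sub>0 'k)"
  have Z: "single (zip (x @ u @ y) (x' @ v @ y')) 1 = f * single (zip u v) 1 * g"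
    if "length u = 2" "length v = 2" for u v
    using that c_eq a_eq len by (simp add: f_def g_def mult_single plus_list_def)
  let ?t = "single [c1, c2] 1 - single [c2, c1] 1 :: 'v list \<Rightarrow>\<^sub>0 'k"
  let ?\<phi> = "single [a1, a2] 1 + single [a2, a1] 1 :: 'v list \<Rightarrow>\<^sub>0 'k"
  have "single (zip c a) 1 - single (zip (adj_swap i c) a) 1
      + (single (zip c (adj_swap i a)) 1 - single (zip (adj_swap i c) (adj_swap i a)) 1)
      = f * (single (zip [c1, c2] [a1, a2]) 1 - single (zip [c2, c1] [a1, a2]) 1
        + (single (zip [c1, c2] [a2, a1]) 1 - single (zip [c2, c1] [a2, a1]) 1)) * g"
    unfolding swap unfolding c_eq(1) a_eq(1)
    by (subst (1 2 3 4) Z) (simp_all add: distrib_left distrib_right right_diff_distrib left_diff_distrib)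
  also have "\<dots> = f * shuffle_tensor ?\<phi> ?t * g"
    by (simp add: shuffle_tensor_add_left shuffle_tensor_diff_right shuffle_tensor_single add_diff_add)
  also have "\<dots> \<in> end_ideal X"
    unfolding end_ideal_def
  proof (rule tensors.span_base, intro CollectI exI conjI)
    show "keys f \<subseteq> end_words X" "keys g \<subseteq> end_words X"
      using cX aX by (auto simp: f_def g_def end_words_def dest: set_zip_leftD set_zip_rightD)
  qed (use wedge2_perp_generator[OF X aX(2,3)] wedge2_generator[OF cX(2,3)] in auto)
  finally show ?thesis .
qed


section \<open>Matrix units\<close>

lemma sum_words_Suc:
  "(\<Sum>w\<in>words X (Suc p). f w) = (\<Sum>x\<in>X. \<Sum>w\<in>words X p. f (x # w))"
proof -
  have "bij_betw (\<lambda>(x, w). x # w) (X \<times> words X p) (words X (Suc p))"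
    by (rule bij_betwI[where g = "\<lambda>w. (hd w, tl w)"]) (auto simp: words_def length_Suc_conv)
  from sum.reindex_bij_betw[OF this, of f, symmetric] show ?thesis
    by (simp add: sum.cartesian_product case_prod_unfold)
qed

lemma end_words_zip:
  assumes "z \<in> end_words X"
  shows "map fst z \<in> words X (length z)" "map snd z \<in> words X (length z)"
  using assms by (auto simp: end_words_def words_def)

lemma end_comul_eq:
  "end_comul X z = (\<Sum>l\<in>words X (length z).
    single (zip (map fst z) l, zip l (map snd z)) (1::'k::field))"
proof (induction z)
  case Nil
  have "words X 0 = {[]}" by (auto simp: words_def)
  moreover have "1 = single ([], []) (1::'k)"
    by (metis single_one zero_list_def zero_prod_def)
  ultimately show ?case by (simp add: end_comul_def)
next
  case (Cons ij z)
  obtain i j where ij: "ij = (i, j)" by force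
  have "(end_comul X (ij # z) :: _ \<Rightarrow>\<^sub>0 'k) = (\<Sum>x\<in>X. single ([(i, x)], [(x, j)]) 1) * end_comul X z"
    by (simp add: end_comul_def ij)
  also have "\<dots> = (\<Sum>x\<in>X. \<Sum>l\<in>words X (length z).
      single ((i, x) # zip (map fst z) l, (x, j) # zip l (map snd z)) 1)"
    unfolding Cons.IH by (simp add: sum_product mult_single plus_list_def)
  finally show ?case by (simp add: sum_words_Suc ij)
qed

lemma end_counit_eq: "end_counit z = (of_bool (map fst z = map snd z) :: 'k::field)"
  by (induction z) (auto simp: end_counit_def)

lemma pairing_free_tensor:
  "pairing (\<lambda>(z1, z2). S z1 * T z2) (free_tensor f g) = pairing S f * pairing T g"
proof -
  have "free_tensor f g = (\<Sum>u\<in>keys f. \<Sum>v\<in>keys g. single (u, v) (lookup f u * lookup g v))"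
    by (simp add: free_tensor_def lsum_def)
  then have "pairing (\<lambda>(z1, z2). S z1 * T z2) (free_tensor f g)
      = (\<Sum>u\<in>keys f. \<Sum>v\<in>keys g. (S u * T v) * (lookup f u * lookup g v))"
    by (simp only: scalars.contract_sum scalars.contract_single prod.case)
  also have "\<dots> = (\<Sum>u\<in>keys f. S u * lookup f u) * (\<Sum>v\<in>keys g. T v * lookup g v)"
    unfolding sum_product by (intro sum.cong refl) (simp only: mult_ac)
  finally show ?thesis by (simp only: contract_def lsum_def)
qed

context ordered_alphabet_dual
begin

text \<open>A word \<open>zip c a\<close> is the matrix coefficient of \<open>V\<^sup>\<otimes>\<^sup>p\<close> in row \<open>c\<close> and column \<open>a\<close>.  After the change
of basis from words to antisymmetrized words, \<open>mat_el u w\<close> is the matrix coefficient in row \<open>u\<close> and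
column \<open>w\<close>, and \<open>mat_fun u w\<close> is the functional dual to it.\<close>

definition mat_fun :: "'v list \<Rightarrow> 'v list \<Rightarrow> ('v \<times> 'v) list \<Rightarrow> 'k" where
  "mat_fun u w z = \<beta> u (map fst z) * antisym w (map snd z)"

definition mat_el :: "'v list \<Rightarrow> 'v list \<Rightarrow> (('v \<times> 'v) list \<Rightarrow>\<^sub>0 'k)" where
  "mat_el u w = (\<Sum>c\<in>words X (length u). \<Sum>a\<in>words X (length w).
     single (zip c a) (antisym u c * \<beta> w a))"

text \<open>The functional is the matrix unit that sends the basis vector of \<open>u\<close> to the one of \<open>w\<close>.
At a given place, either \<open>u\<close> has no descent, and then the dual vector of \<open>u\<close> annihilates the
antisymmetric factor of the relation, or \<open>w\<close> has a descent too, and then its basis vector is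
annihilated by the symmetric factor.\<close>

lemma pairing_mat_fun_end_ideal:
  assumes u: "u \<in> words X p" and w: "w \<in> words X p" and desc: "descents u \<subseteq> descents w"
    and f: "f \<in> end_ideal X"
  shows "pairing (mat_fun u w) f = 0"
proof (rule pairing_end_ideal[OF finite_X _ f])
  fix z1 z2 and \<phi> t :: "'v list \<Rightarrow>\<^sub>0 'k"
  assume z: "z1 \<in> end_words X" "z2 \<in> end_words X" and \<phi>: "\<phi> \<in> wedge2_perp X" and t: "t \<in> wedge2 X"
  let ?i = "length z1"
  define B where "B c = \<beta> u (map fst z1 @ c @ map fst z2)" for c
  define A where "A a = antisym w (map snd z1 @ a @ map snd z2)" for a
  have T: "mat_fun u w (z1 @ zip c a @ z2) = B c * A a" if "c \<in> words X 2" "a \<in> words X 2" for c a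
    using that by (simp add: mat_fun_def A_def B_def words_def)
  have "(\<Sum>a\<in>words X 2. \<Sum>c\<in>words X 2. lookup \<phi> a * lookup t c * mat_fun u w (z1 @ zip c a @ z2))
      = (\<Sum>a\<in>words X 2. lookup \<phi> a * A a) * (\<Sum>c\<in>words X 2. lookup t c * B c)"
    unfolding sum_product by (intro sum.cong refl) (simp add: T)
  also have "\<dots> = 0"
  proof (cases "p = ?i + 2 + length z2")
    case False
    then have "B c = 0" if "c \<in> words X 2" for c
      unfolding B_def using u that by (intro dual_length) (auto simp: words_def)
    then show ?thesis by simp
  next
    case True
    have wd: "map g z1 @ c @ map g z2 \<in> words X p" if "c \<in> words X 2" "g = fst \<or> g = snd" for c g
      using that z True by (auto simp: words_def end_words_def)
    have swap: "adj_swap ?i (map g z1 @ c @ map g z2) = map g z1 @ rev c @ map g z2"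
      if "c \<in> words X 2" for c and g :: "'v \<times> 'v \<Rightarrow> 'v"
      using that adj_swap_append[of c "map g z1" "map g z2"] by (simp add: words_def)
    show ?thesis
    proof (cases "?i \<in> descents u")
      case False
      have "lookup t (rev c) * B (rev c) = - (lookup t c * B c)" if "c \<in> words X 2" for c
        using wedge2_antisymmetric[OF t] that dual_swap[OF u False _ wd[OF that]] True
        by (simp add: B_def swap)
      then show ?thesis by (simp add: sum_words_rev_antisym)
    next
      case i: True
      have "lookup \<phi> (rev a) * A (rev a) = - (lookup \<phi> a * A a)" if "a \<in> words X 2" for a
        using wedge2_perp_symmetric[OF finite_X \<phi> that] antisym_swap[OF w _ wd[OF that]] i desc that
        by (auto simp add: A_def swap[symmetric])
      then show ?thesis by (simp add: sum_words_rev_antisym)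
    qed
  qed
  finally show "(\<Sum>a\<in>words X 2. \<Sum>c\<in>words X 2.
    lookup \<phi> a * lookup t c * mat_fun u w (z1 @ zip c a @ z2)) = 0" .
qed

lemma lookup_mat_el:
  assumes "u \<in> words X p" "w \<in> words X p"
  shows "lookup (mat_el u w) z = (if z \<in> end_words X \<and> length z = p
    then antisym u (map fst z) * \<beta> w (map snd z) else 0)"
proof -
  have len: "length u = p" "length w = p" using assms by (auto simp: words_def)
  have "lookup (mat_el u w) z = (\<Sum>c\<in>words X p. \<Sum>a\<in>words X p.
      if c = map fst z \<and> a = map snd z then antisym u c * \<beta> w a else 0)"
    unfolding mat_el_def len lookup_sum lookup_single
    by (intro sum.cong refl) (auto simp: when_def words_def zip_map_fst_snd)
  also have "\<dots> = (\<Sum>c\<in>words X p. if c = map fst z then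
      (\<Sum>a\<in>words X p. if a = map snd z then antisym u c * \<beta> w a else 0) else 0)"
    by (intro sum.cong refl) auto
  also have "\<dots> = (if map fst z \<in> words X p \<and> map snd z \<in> words X p
      then antisym u (map fst z) * \<beta> w (map snd z) else 0)"
    by (simp add: finite_words finite_X)
  also have "map fst z \<in> words X p \<and> map snd z \<in> words X p \<longleftrightarrow> z \<in> end_words X \<and> length z = p"
    by (auto simp: words_def end_words_def)
  finally show ?thesis .
qed

lemma keys_mat_el: "u \<in> words X p \<Longrightarrow> w \<in> words X p \<Longrightarrow> keys (mat_el u w) \<subseteq> end_words X"
  by (auto simp: in_keys_iff lookup_mat_el split: if_splits)

lemma pairing_mat_el:
  "pairing T (mat_el u w) = (\<Sum>c\<in>words X (length u). \<Sum>a\<in>words X (length w).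
     T (zip c a) * (antisym u c * \<beta> w a))"
  by (simp add: mat_el_def scalars.contract_sum scalars.contract_single)

lemma pairing_mat_fun_mat_el:
  assumes "u \<in> words X p" "w \<in> words X p" "u' \<in> words X p" "w' \<in> words X p"
  shows "pairing (mat_fun u' w') (mat_el u w) = of_bool (u = u' \<and> w = w')"
proof -
  have len: "length u = p" "length w = p" using assms by (auto simp: words_def)
  have "pairing (mat_fun u' w') (mat_el u w)
      = (\<Sum>c\<in>words X p. antisym u c * \<beta> u' c) * (\<Sum>a\<in>words X p. antisym w' a * \<beta> w a)"
    unfolding pairing_mat_el len sum_product
    by (intro sum.cong refl) (simp add: mat_fun_def words_def)
  then show ?thesis using assms by (auto simp add: dual_orthogonal)
qed

text \<open>At a descent of \<open>u\<close> that is not one of \<open>w\<close>, the coefficients are antisymmetric in the upper letters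
and symmetric in the lower ones.  Averaging over the two swaps writes the element as a combination
of the relations of \<open>word_exchange_in_end_ideal\<close>.\<close>

lemma mat_el_in_end_ideal:
  assumes u: "u \<in> words X p" and w: "w \<in> words X p" and "\<not> descents u \<subseteq> descents w"
  shows "mat_el u w \<in> end_ideal X"
proof -
  obtain i where iu: "i \<in> descents u" and iw: "i \<notin> descents w" using assms(3) by auto
  have len: "length u = p" "length w = p" using u w by (auto simp: words_def)
  have i: "Suc i < p" using iu len by (simp add: descents_def)
  let ?s = "adj_swap i" and ?W = "words X p"
  define Z where "Z c a = (single (zip c a) 1 :: ('v \<times> 'v) list \<Rightarrow>\<^sub>0 'k)" for c a
  define k where "k c a = antisym u c * \<beta> w a" for c a
  note bij = bij_betw_permute_list_words[OF adj_transpose_permutes[OF i], of X]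
  have sw: "?s c \<in> ?W" if "c \<in> ?W" for c
    using that adj_transpose_permutes[OF i] by (rule permute_list_in_words[rotated])
  have ss: "?s (?s c) = c" if "c \<in> ?W" for c
    using that i by (intro adj_swap_adj_swap) (simp add: words_def)
  have k1: "k (?s c) a = - k c a" and k2: "k c (?s a) = k c a" if "c \<in> ?W" "a \<in> ?W" for c a
    using that antisym_swap[OF u iu] dual_swap[OF w iw i] by (simp_all add: k_def)
  have el: "mat_el u w = (\<Sum>c\<in>?W. \<Sum>a\<in>?W. fscale (k c a) (Z c a))"
    by (simp add: mat_el_def len k_def Z_def scalars.pscale_single)
  \<comment> \<open>The swap of the upper letters contributes a sign, that of the lower letters does not, so the
    sum of the four terms is four times the element.\<close>
  have e1: "(\<Sum>c\<in>?W. \<Sum>a\<in>?W. fscale (k c a) (Z (?s c) a)) = - mat_el u w"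
  proof -
    have "- mat_el u w = (\<Sum>c\<in>?W. \<Sum>a\<in>?W. - fscale (k (?s c) a) (Z (?s c) a))"
      unfolding el sum_negf
      by (subst sum.reindex_bij_betw[OF bij, where g = "\<lambda>c. \<Sum>a\<in>?W. fscale (k c a) (Z c a)"]) (rule refl)
    also have "\<dots> = (\<Sum>c\<in>?W. \<Sum>a\<in>?W. fscale (k c a) (Z (?s c) a))"
      by (intro sum.cong refl) (simp add: k1)
    finally show ?thesis by simp
  qed
  have e2: "(\<Sum>c\<in>?W. \<Sum>a\<in>?W. fscale (k c a) (G c (?s a))) = (\<Sum>c\<in>?W. \<Sum>a\<in>?W. fscale (k c a) (G c a))"
    for G :: "'v list \<Rightarrow> 'v list \<Rightarrow> (('v \<times> 'v) list \<Rightarrow>\<^sub>0 'k)"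
  proof (rule sum.cong[OF refl])
    fix c assume c: "c \<in> ?W"
    have "(\<Sum>a\<in>?W. fscale (k c a) (G c a)) = (\<Sum>a\<in>?W. fscale (k c (?s a)) (G c (?s a)))"
      by (rule sum.reindex_bij_betw[OF bij, symmetric])
    also have "\<dots> = (\<Sum>a\<in>?W. fscale (k c a) (G c (?s a)))"
      by (intro sum.cong refl) (simp add: k2 c)
    finally show "(\<Sum>a\<in>?W. fscale (k c a) (G c (?s a))) = (\<Sum>a\<in>?W. fscale (k c a) (G c a))" ..
  qed
  let ?G = "\<Sum>c\<in>?W. \<Sum>a\<in>?W. fscale (k c a)
      (Z c a - Z (?s c) a + (Z c (?s a) - Z (?s c) (?s a)))"
  have "?G = (mat_el u w + mat_el u w) + (mat_el u w + mat_el u w)"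
    using e1 e2[of Z] e2[of "\<lambda>c a. Z (?s c) a"]
    by (simp add: tensors.scale_right_distrib tensors.scale_right_diff_distrib sum.distrib
        sum_subtractf el[symmetric])
  also have "\<dots> = fscale 4 (mat_el u w)"
    by (rule poly_mapping_eqI) (simp add: lookup_add)
  finally have "mat_el u w = fscale (1 / 4) ?G" by simp
  moreover have "?G \<in> end_ideal X"
    unfolding end_ideal_def
    by (intro tensors.span_sum tensors.span_scale,
        fold end_ideal_def, unfold Z_def, rule word_exchange_in_end_ideal[OF finite_X i])
  ultimately show ?thesis by (simp add: end_ideal_def tensors.span_scale)
qed

text \<open>The change of basis back from antisymmetrized words to words.\<close>

lemma single_eq_sum_mat_el:
  assumes "z \<in> end_words X"
  shows "single z 1 = (\<Sum>u\<in>words X (length z). \<Sum>w\<in>words X (length z).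
    fscale (mat_fun u w z) (mat_el u w))"
proof (rule poly_mapping_eqI)
  fix z'
  let ?W = "words X (length z)"
  note z = end_words_zip[OF assms]
  show "lookup (single z 1) z' = lookup (\<Sum>u\<in>?W. \<Sum>w\<in>?W. fscale (mat_fun u w z) (mat_el u w)) z'"
  proof (cases "z' \<in> end_words X \<and> length z' = length z")
    case False
    then have "z' \<noteq> z" using assms by auto
    with False show ?thesis by (auto simp: lookup_sum lookup_single lookup_mat_el)
  next
    case True
    have z': "map fst z' \<in> ?W" "map snd z' \<in> ?W" using end_words_zip[of z' X] True by auto
    have "lookup (\<Sum>u\<in>?W. \<Sum>w\<in>?W. fscale (mat_fun u w z) (mat_el u w)) z'
        = (\<Sum>u\<in>?W. \<Sum>w\<in>?W. (\<beta> u (map fst z) * antisym u (map fst z')) *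
             (\<beta> w (map snd z') * antisym w (map snd z)))"
      unfolding lookup_sum
      by (intro sum.cong refl) (use True in \<open>simp add: lookup_mat_el mat_fun_def; simp only: mult_ac\<close>)
    also have "\<dots> = of_bool (map fst z = map fst z') * of_bool (map snd z' = map snd z)"
      unfolding sum_product[symmetric] using z z' by (simp add: dual_expand)
    also have "\<dots> = of_bool (z = z')"
      using True by (auto simp: list_eq_iff_nth_eq prod_eq_iff)
    finally show ?thesis by (simp add: lookup_single when_def)
  qed
qed

text \<open>The convolution product of the dual functionals is the product of matrix units.\<close>

lemma pairing_mat_fun_end_comul:
  assumes u: "u \<in> words X p" "w \<in> words X p" and u': "u' \<in> words X p'" "w' \<in> words X p'"
  shows "pairing (\<lambda>(z1, z2). mat_fun u w z1 * mat_fun u' w' z2) (end_comul X z)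
    = of_bool (w = u') * mat_fun u w' z"
proof -
  let ?c = "map fst z" and ?a = "map snd z"
  have "pairing (\<lambda>(z1, z2). mat_fun u w z1 * mat_fun u' w' z2) (end_comul X z)
      = (\<Sum>l\<in>words X (length z). mat_fun u w (zip ?c l) * mat_fun u' w' (zip l ?a))"
    by (simp add: end_comul_eq scalars.contract_sum scalars.contract_single)
  also have "\<dots> = (\<beta> u ?c * antisym w' ?a) * (\<Sum>l\<in>words X (length z). antisym w l * \<beta> u' l)"
    unfolding sum_distrib_left
    by (intro sum.cong refl) (simp add: mat_fun_def words_def; simp only: mult_ac)
  also have "\<dots> = of_bool (w = u') * mat_fun u w' z"
  proof (cases "length z = p")
    case False
    then have "\<beta> u ?c = 0" using u by (intro dual_length) (auto simp: words_def)
    then show ?thesis by (simp add: mat_fun_def)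
  next
    case True
    show ?thesis
    proof (cases "p = p'")
      case True
      then show ?thesis using u u' \<open>length z = p\<close> by (simp add: dual_orthogonal mat_fun_def)
    next
      case False
      then have "\<beta> u' l = 0" if "l \<in> words X (length z)" for l
        using u' that \<open>length z = p\<close> by (intro dual_length) (auto simp: words_def)
      moreover have "w \<noteq> u'" using False u u' by (auto simp: words_def)
      ultimately show ?thesis by simp
    qed
  qed
  finally show ?thesis .
qed

lemma end_counit_eq_sum_mat_fun:
  assumes "z \<in> end_words X"
  shows "end_counit z = (\<Sum>u\<in>words X (length z). mat_fun u u z)"
  using end_words_zip[OF assms] by (simp add: mat_fun_def dual_expand end_counit_eq)

end


context vector_space
begin

lemma contract_sum_fun:
  "contract scale (\<lambda>z. \<Sum>i\<in>I. T i z) t = (\<Sum>i\<in>I. contract scale (T i) t)"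
  using contract_sum_left[of "\<lambda>_. 1" T I t] by simp

lemma contract_scale_left: "contract scale (\<lambda>z. c * T z) t = scale c (contract scale T t)"
  using contract_sum_left[of "\<lambda>_. c" "\<lambda>_. T" "{()}" t] by simp

lemma tensors_subspace_iff:
  "subspace N \<Longrightarrow> t \<in> tensors G N \<longleftrightarrow> keys t \<subseteq> G \<and> (\<forall>z. lookup t z \<in> N)"
  using insert_absorb[OF subspace_0] by (simp add: tensors_def)

lemma subspace_tensors:
  assumes "subspace N"
  shows "module.subspace (pscale scale) (tensors G N)"
proof -
  interpret P: vector_space "pscale scale" by (rule vector_space_pscale)
  show ?thesis
  proof (rule P.subspaceI)
    show "0 \<in> tensors G N" by (simp add: tensors_def)
  next
    fix t u assume "t \<in> tensors G N" "u \<in> tensors G N"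
    then show "t + u \<in> tensors G N"
      using Poly_Mapping.keys_add[of t u]
      by (auto simp: tensors_subspace_iff[OF assms] lookup_add subspace_add[OF assms])
  next
    fix c t assume "t \<in> tensors G N"
    then show "pscale scale c t \<in> tensors G N"
      by (auto simp: tensors_subspace_iff[OF assms] subspace_scale[OF assms] in_keys_iff subset_iff)
  qed
qed

lemma pure_tensor_in_tensors:
  assumes "subspace N" "keys f \<subseteq> G" "m \<in> N"
  shows "pure_tensor scale f m \<in> tensors G N"
  using assms by (auto simp: tensors_subspace_iff subspace_scale in_keys_iff subset_iff)

lemma lookup_as_mat_rep:
  "lookup (as_mat_rep \<rho> m) e = contract scale (\<lambda>z. of_bool (monomial_of_word z = e)) (\<rho> m)"
  unfolding as_mat_rep_def lsum_def contract_def lookup_sum lookup_single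
  by (intro sum.cong refl) (simp add: when_def)

end

lemma lookup_free_tensor: "lookup (free_tensor f g) (z1, z2) = lookup f z1 * lookup g z2"
proof -
  have "lookup (free_tensor f g) (z1, z2)
      = (\<Sum>u\<in>keys f. \<Sum>v\<in>keys g. (lookup f u when u = z1) * (lookup g v when v = z2))"
    unfolding free_tensor_def lsum_def lookup_sum lookup_single
    by (intro sum.cong refl) (simp add: when_def)
  also have "\<dots> = (\<Sum>u\<in>keys f. lookup f u when u = z1) * (\<Sum>v\<in>keys g. lookup g v when v = z2)"
    by (rule sum_product[symmetric])
  also have "\<dots> = lookup f z1 * lookup g z2" by (auto simp: when_def in_keys_iff)
  finally show ?thesis .
qed

lemma lookup_id_tensor_coact:
  assumes "\<rho> 0 = 0"
  shows "lookup (id_tensor_coact \<rho> t) (z1, z2) = lookup (\<rho> (lookup t z1)) z2"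
proof -
  have "lookup (id_tensor_coact \<rho> t) (z1, z2)
      = (\<Sum>z\<in>keys t. if z = z1 then \<Sum>z'\<in>keys (\<rho> (lookup t z1)).
           lookup (\<rho> (lookup t z1)) z' when z' = z2 else 0)"
    unfolding id_tensor_coact_def lsum_def lookup_sum lookup_single
    by (intro sum.cong refl) (auto simp: when_def)
  also have "\<dots> = lookup (\<rho> (lookup t z1)) z2"
    using assms by (auto simp: when_def in_keys_iff)
  finally show ?thesis .
qed

context ordered_alphabet_dual
begin

lemma mat_fun_length: "length z \<noteq> length u \<Longrightarrow> mat_fun u w z = 0"
  by (simp add: mat_fun_def dual_length)

text \<open>Multiplying out the change of basis in each degree; any finite set \<open>L\<close> that contains the degrees
of \<open>t\<close> serves as index set.\<close>

lemma tensor_expand: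
  fixes s :: "'k \<Rightarrow> 'm::ab_group_add \<Rightarrow> 'm"
  assumes "vector_space s" "keys t \<subseteq> end_words X" "finite L" "length ` keys t \<subseteq> L"
  shows "t = (\<Sum>p\<in>L. \<Sum>u\<in>words X p. \<Sum>w\<in>words X p.
    pure_tensor s (mat_el u w) (contract s (mat_fun u w) t))"
proof (rule poly_mapping_eqI)
  interpret vector_space s by fact
  fix x
  have one: "(\<Sum>p\<in>L. \<Sum>u\<in>words X p. \<Sum>w\<in>words X p. lookup (mat_el u w) x * mat_fun u w z)
      = lookup (single z 1) x" if "z \<in> keys t" for z
  proof -
    have z: "z \<in> end_words X" "length z \<in> L" using that assms by auto
    have "(\<Sum>p\<in>L. \<Sum>u\<in>words X p. \<Sum>w\<in>words X p. lookup (mat_el u w) x * mat_fun u w z)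
        = (\<Sum>p\<in>L. if p = length z then
            (\<Sum>u\<in>words X (length z). \<Sum>w\<in>words X (length z). lookup (mat_el u w) x * mat_fun u w z) else 0)"
      by (intro sum.cong refl) (auto simp: words_def mat_fun_length intro!: sum.neutral)
    also have "\<dots> = lookup (\<Sum>u\<in>words X (length z). \<Sum>w\<in>words X (length z).
        fscale (mat_fun u w z) (mat_el u w)) x"
      using assms(3) z(2) by (simp add: lookup_sum mult.commute)
    finally show ?thesis by (simp only: single_eq_sum_mat_el[OF z(1), symmetric])
  qed
  have "lookup (\<Sum>p\<in>L. \<Sum>u\<in>words X p. \<Sum>w\<in>words X p.
      pure_tensor s (mat_el u w) (contract s (mat_fun u w) t)) x
      = contract s (\<lambda>z. \<Sum>p\<in>L. \<Sum>u\<in>words X p. \<Sum>w\<in>words X p. lookup (mat_el u w) x * mat_fun u w z) t"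
    by (simp add: lookup_sum contract_sum_fun contract_scale_left)
  also have "\<dots> = contract s (\<lambda>z. lookup (single z 1) x) t"
    by (rule contract_cong) (rule one)
  also have "\<dots> = (\<Sum>z\<in>keys t. if z = x then lookup t x else 0)"
    unfolding contract_def lsum_def by (intro sum.cong refl) (simp add: lookup_single when_def)
  also have "\<dots> = lookup t x" by (simp add: in_keys_iff)
  finally show "lookup t x = lookup (\<Sum>p\<in>L. \<Sum>u\<in>words X p. \<Sum>w\<in>words X p.
      pure_tensor s (mat_el u w) (contract s (mat_fun u w) t)) x" ..
qed

definition mat_coeff :: "'v monomial \<Rightarrow> 'v list \<Rightarrow> 'v list \<Rightarrow> 'k" where
  "mat_coeff e u w = pairing (\<lambda>z. of_bool (monomial_of_word z = e)) (mat_el u w)"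

lemma mat_coeff_eq_0:
  "u \<in> words X p \<Longrightarrow> w \<in> words X p \<Longrightarrow> \<not> descents u \<subseteq> descents w \<Longrightarrow> mat_coeff e u w = 0"
  unfolding mat_coeff_def by (intro pairing_monomial_end_ideal[OF finite_X] mat_el_in_end_ideal)

definition descent_words :: "nat \<Rightarrow> nat set \<Rightarrow> 'v list set" where
  "descent_words p S = {w \<in> words X p. descents w = S}"

text \<open>The family \<open>y\<close> is a basis of \<open>W\<close> in which the coaction of the coordinate ring has
the same matrix coefficients as the diagonal block of the descent set \<open>S\<close>.  It is the common
description through which simple comodules and skew Schur functors are compared.\<close>

definition ribbon_basis ::
  "nat \<Rightarrow> nat set \<Rightarrow> ('k \<Rightarrow> 'm \<Rightarrow> 'm::ab_group_add) \<Rightarrow> 'm set \<Rightarrow> ('m \<Rightarrow> (('v \<times> 'v) list \<Rightarrow>\<^sub>0 'm)) \<Rightarrow> ('v list \<Rightarrow> 'm) \<Rightarrow> bool"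
where
  "ribbon_basis p S s W \<rho> y \<longleftrightarrow>
     W = module.span s (y ` descent_words p S) \<and>
     (\<forall>c. (\<Sum>w\<in>descent_words p S. s (c w) (y w)) = 0 \<longrightarrow>
        (\<forall>w\<in>descent_words p S. c w = 0)) \<and>
     (\<forall>w\<in>descent_words p S. \<forall>e. lookup (as_mat_rep \<rho> (y w)) e
        = (\<Sum>w'\<in>descent_words p S. s (mat_coeff e w w') (y w')))"

end


section \<open>Simple comodules\<close>

locale end_comodule = ordered_alphabet_dual X r \<beta>
  for X :: "'v set" and r :: "'v \<Rightarrow> nat" and \<beta> :: "'v list \<Rightarrow> 'v list \<Rightarrow> 'k::field_char_0" +
  fixes s :: "'k \<Rightarrow> 'm::ab_group_add \<Rightarrow> 'm" and W :: "'m set"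
    and \<rho> :: "'m \<Rightarrow> (('v \<times> 'v) list \<Rightarrow>\<^sub>0 'm)"
  assumes comodule: "comodule (end_SV X) s W \<rho>"
begin

sublocale vector_space s
  using comodule by (simp add: comodule_def)

sublocale coact: Vector_Spaces.linear s "pscale s" \<rho>
  using comodule by (simp add: comodule_def)

lemma subspace_W: "subspace W"
  using comodule by (simp add: comodule_def)

lemma coact_tensors: "m \<in> W \<Longrightarrow> \<rho> m \<in> tensors (end_words X) W"
  using comodule by (simp add: comodule_def end_SV_def)

definition unit_op :: "'v list \<Rightarrow> 'v list \<Rightarrow> 'm \<Rightarrow> 'm" where
  "unit_op u w m = contract s (mat_fun u w) (\<rho> m)"

lemma unit_op_in_W: "m \<in> W \<Longrightarrow> unit_op u w m \<in> W"
  unfolding unit_op_def by (rule contract_tensors[OF subspace_W coact_tensors])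

lemma linear_unit_op: "Vector_Spaces.linear s s (unit_op u w)"
  by unfold_locales (auto simp: unit_op_def coact.add coact.scale contract_add contract_pscale)

text \<open>Contract the coassociativity law with two functionals.  The error terms in \<open>I \<otimes> F + F \<otimes> I\<close>
disappear since both functionals vanish on the ideal; this is where the two inclusions of
descent sets enter.  The order of the operators is reversed because comodules are left comodules.\<close>

lemma unit_op_unit_op:
  assumes u: "u \<in> words X p" "w \<in> words X p" "descents u \<subseteq> descents w"
    and u': "u' \<in> words X p'" "w' \<in> words X p'" "descents u' \<subseteq> descents w'"
    and m: "m \<in> W"
  shows "unit_op u' w' (unit_op u w m) = (if w = u' then unit_op u w' m else 0)"
proof -
  let ?C = "end_SV X :: (('v \<times> 'v) list, 'k) coalg"
  define \<Phi> where "\<Phi> = (\<lambda>(z1, z2). mat_fun u w z1 * mat_fun u' w' z2)"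
  interpret E: Vector_Spaces.linear s s "unit_op u' w'" by (rule linear_unit_op)
  have "comul_tensor_id ?C s (\<rho> m) - id_tensor_coact \<rho> (\<rho> m) \<in> subspace_tensor s (rels2 ?C) W"
    using comodule m by (simp add: comodule_def)
  then have "contract s \<Phi> (comul_tensor_id ?C s (\<rho> m) - id_tensor_coact \<rho> (\<rho> m)) = 0"
  proof (rule contract_subspace_tensor)
    fix f assume "f \<in> rels2 ?C"
    then show "pairing \<Phi> f = 0"
      unfolding rels2_def \<Phi>_def
      using pairing_mat_fun_end_ideal[OF u] pairing_mat_fun_end_ideal[OF u']
      by (auto simp: pairing_free_tensor end_SV_def)
  qed
  then have "contract s \<Phi> (comul_tensor_id ?C s (\<rho> m)) = contract s \<Phi> (id_tensor_coact \<rho> (\<rho> m))"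
    by (simp add: contract_diff)
  also have "contract s \<Phi> (id_tensor_coact \<rho> (\<rho> m))
      = (\<Sum>z\<in>keys (\<rho> m). \<Sum>z'\<in>keys (\<rho> (lookup (\<rho> m) z)).
          s (mat_fun u w z) (s (mat_fun u' w' z') (lookup (\<rho> (lookup (\<rho> m) z)) z')))"
    unfolding id_tensor_coact_def lsum_def contract_sum contract_single by (simp add: \<Phi>_def)
  also have "\<dots> = (\<Sum>z\<in>keys (\<rho> m). s (mat_fun u w z) (unit_op u' w' (lookup (\<rho> m) z)))"
    unfolding unit_op_def contract_def lsum_def scale_sum_right ..
  also have "\<dots> = unit_op u' w' (unit_op u w m)"
    unfolding unit_op_def[of u w] contract_def lsum_def E.sum by (simp add: E.scale)
  finally have "unit_op u' w' (unit_op u w m) = contract s \<Phi> (comul_tensor_id ?C s (\<rho> m))" ..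
  also have "\<dots> = (\<Sum>z\<in>keys (\<rho> m). s (pairing \<Phi> (end_comul X z)) (lookup (\<rho> m) z))"
    unfolding comul_tensor_id_def lsum_def contract_sum contract_pure_tensor
    by (simp add: end_SV_def)
  also have "\<dots> = (\<Sum>z\<in>keys (\<rho> m). s (of_bool (w = u') * mat_fun u w' z) (lookup (\<rho> m) z))"
    unfolding \<Phi>_def by (simp add: pairing_mat_fun_end_comul[OF u(1,2) u'(1,2)])
  also have "\<dots> = (if w = u' then unit_op u w' m else 0)"
    by (simp add: unit_op_def contract_def lsum_def)
  finally show ?thesis .
qed

lemma coact_expand:
  assumes "m \<in> W" "finite L" "length ` keys (\<rho> m) \<subseteq> L"
  shows "\<rho> m = (\<Sum>p\<in>L. \<Sum>u\<in>words X p. \<Sum>w\<in>words X p. pure_tensor s (mat_el u w) (unit_op u w m))"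
  unfolding unit_op_def
  by (rule tensor_expand[OF vector_space_axioms _ assms(2,3)])
    (use coact_tensors[OF assms(1)] in \<open>simp add: tensors_def\<close>)

lemma sum_unit_op:
  assumes "m \<in> W"
  shows "m = (\<Sum>p\<in>length ` keys (\<rho> m). \<Sum>u\<in>words X p. unit_op u u m)"
proof -
  let ?L = "length ` keys (\<rho> m)"
  have "m = contract s end_counit (\<rho> m)"
    using comodule assms by (simp add: comodule_def end_SV_def contract_def)
  also have "\<dots> = contract s (\<lambda>z. \<Sum>p\<in>?L. \<Sum>u\<in>words X p. mat_fun u u z) (\<rho> m)"
  proof (rule contract_cong)
    fix z assume z: "z \<in> keys (\<rho> m)"
    then have "z \<in> end_words X" using coact_tensors[OF assms] by (auto simp: tensors_def)
    then have "end_counit z = (\<Sum>p\<in>?L. if p = length z then \<Sum>u\<in>words X p. mat_fun u u z else 0)"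
      using z by (simp add: end_counit_eq_sum_mat_fun)
    also have "\<dots> = (\<Sum>p\<in>?L. \<Sum>u\<in>words X p. mat_fun u u z)"
      by (intro sum.cong refl) (auto simp: words_def mat_fun_length intro!: sum.neutral[symmetric])
    finally show "end_counit z = (\<Sum>p\<in>?L. \<Sum>u\<in>words X p. mat_fun u u z)" .
  qed
  finally show ?thesis by (simp add: contract_sum_fun unit_op_def)
qed

text \<open>Expand \<open>\<rho> m\<close> in the elements \<open>mat_el u w\<close>.  The terms without \<open>D(u) \<subseteq> D(w)\<close> lie in the ideal, and
the coefficients of all others are matrix units applied to \<open>m\<close>.\<close>

lemma subcomodule_of_invariant:
  assumes N: "subspace N" "N \<subseteq> W"
    and inv: "\<And>p u w m. u \<in> words X p \<Longrightarrow> w \<in> words X p \<Longrightarrow> descents u \<subseteq> descents w \<Longrightarrow> m \<in> N \<Longrightarrow>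
      unit_op u w m \<in> N"
  shows "subcomodule (end_SV X) s W \<rho> N"
proof -
  interpret P: vector_space "pscale s" by (rule vector_space_pscale)
  have "\<exists>t\<in>tensors (end_words X) N. \<rho> m - t \<in> subspace_tensor s (end_ideal X) W" if m: "m \<in> N" for m
  proof -
    let ?L = "length ` keys (\<rho> m)"
    let ?g = "\<lambda>u w. pure_tensor s (mat_el u w) (unit_op u w m)"
    let ?t = "\<Sum>p\<in>?L. \<Sum>u\<in>words X p. \<Sum>w\<in>words X p. if descents u \<subseteq> descents w then ?g u w else 0"
    have mW: "m \<in> W" using m N by auto
    have t: "?t \<in> tensors (end_words X) N"
      using inv m
      by (intro P.subspace_sum subspace_tensors N(1))
        (auto intro!: pure_tensor_in_tensors[OF N(1) keys_mat_el] P.subspace_0[OF subspace_tensors[OF N(1)]])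
    have "\<rho> m - ?t = (\<Sum>p\<in>?L. \<Sum>u\<in>words X p. \<Sum>w\<in>words X p.
        if descents u \<subseteq> descents w then 0 else ?g u w)"
      by (subst coact_expand[OF mW _ subset_refl], simp)
        (unfold sum_subtractf[symmetric], intro sum.cong refl, simp)
    also have "\<dots> \<in> subspace_tensor s (end_ideal X) W"
      using mW
      by (intro P.subspace_sum subspace_subspace_tensor)
        (auto intro!: pure_tensor_in_subspace_tensor mat_el_in_end_ideal unit_op_in_W
          P.subspace_0[OF subspace_subspace_tensor])
    finally show ?thesis by (rule bexI[OF _ t])
  qed
  then show ?thesis using N by (simp add: subcomodule_def end_SV_def)
qed

lemma lookup_as_mat_rep_expand:
  assumes "m \<in> W" "finite L" "length ` keys (\<rho> m) \<subseteq> L"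
  shows "lookup (as_mat_rep \<rho> m) e
    = (\<Sum>p\<in>L. \<Sum>u\<in>words X p. \<Sum>w\<in>words X p. s (mat_coeff e u w) (unit_op u w m))"
  unfolding lookup_as_mat_rep
  by (subst coact_expand[OF assms]) (simp add: contract_sum contract_pure_tensor mat_coeff_def)

text \<open>The diagonal matrix units sum to the identity, so one of them, for a word \<open>u\<^sub>0\<close>, does not kill some
\<open>m\<close>.  Let \<open>y w\<close> be the image of \<open>m\<close> under the matrix unit from \<open>u\<^sub>0\<close> to \<open>w\<close>, for \<open>D(u\<^sub>0) \<subseteq> D(w)\<close>.  All
\<open>y w\<close> span a nonzero subcomodule, hence \<open>W\<close>.  Those with strictly more descents also span a
subcomodule, but the diagonal matrix unit of \<open>u\<^sub>0\<close> kills it, so it is zero.  The \<open>y w\<close> with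
\<open>D(w) = D(u\<^sub>0)\<close> remain, and matrix units back to \<open>u\<^sub>0\<close> show that they are independent.\<close>

theorem simple_has_ribbon_basis:
  assumes "simple_comodule (end_SV X) s W \<rho>"
  shows "\<exists>p S y. descent_words p S \<noteq> {} \<and> ribbon_basis p S s W \<rho> y"
proof -
  have nz: "W \<noteq> {0}" and simple: "\<And>N. subcomodule (end_SV X) s W \<rho> N \<Longrightarrow> N = {0} \<or> N = W"
    using assms by (auto simp: simple_comodule_def)
  obtain m where m: "m \<in> W" "m \<noteq> 0" using nz subspace_0[OF subspace_W] by auto
  have "\<exists>p. \<exists>u\<in>words X p. unit_op u u m \<noteq> 0"
    using sum_unit_op[OF m(1)] m(2) by (metis (no_types, lifting) sum.neutral)
  then obtain p u0 where u0: "u0 \<in> words X p" "unit_op u0 u0 m \<noteq> 0" by blast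
  define S where "S = descents u0"
  define y where "y w = unit_op u0 w m" for w
  define Up where "Up = {w \<in> words X p. S \<subseteq> descents w}"
  let ?\<Omega> = "descent_words p S"
  have \<Omega>_Up: "?\<Omega> \<subseteq> Up" by (auto simp: Up_def descent_words_def)
  have fin: "finite Up" "finite ?\<Omega>"
    using finite_words[OF finite_X] by (auto simp: Up_def descent_words_def)
  have u0_\<Omega>: "u0 \<in> ?\<Omega>" using u0 by (simp add: S_def descent_words_def)
  have y_W: "y w \<in> W" for w by (simp add: y_def unit_op_in_W m)
  have op_y: "unit_op u w' (y w) = (if w = u then y w' else 0)"
    if "w \<in> Up" "u \<in> words X q" "w' \<in> words X q" "descents u \<subseteq> descents w'" for u w w' q
    unfolding y_def using that u0 m by (intro unit_op_unit_op) (auto simp: Up_def S_def)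
  \<comment> \<open>Matrix units only add descents, so up-closed sets of words span subcomodules.\<close>
  have sub: "subcomodule (end_SV X) s W \<rho> (span (y ` Q))"
    if Q: "Q \<subseteq> Up" "\<And>w w'. w \<in> Q \<Longrightarrow> w' \<in> Up \<Longrightarrow> descents w \<subseteq> descents w' \<Longrightarrow> w' \<in> Q" for Q
  proof (rule subcomodule_of_invariant)
    show "span (y ` Q) \<subseteq> W" using y_W by (intro span_minimal subspace_W) auto
    fix q u w' x
    assume u: "u \<in> words X q" "w' \<in> words X q" "descents u \<subseteq> descents w'" and x: "x \<in> span (y ` Q)"
    interpret E: Vector_Spaces.linear s s "unit_op u w'" by (rule linear_unit_op)
    have "unit_op u w' (y w) \<in> span (y ` Q)" if w: "w \<in> Q" for w
    proof (cases "w = u")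
      case True
      have "w' \<in> Up" using u w Q(1) True by (auto simp: Up_def words_def)
      then have "w' \<in> Q" using Q(2)[OF w] u(3) True by simp
      then show ?thesis using op_y[OF _ u, of w] w Q(1) True by (auto intro: span_base)
    next
      case False
      then show ?thesis using op_y[OF subsetD[OF Q(1) w] u] by (simp add: span_zero)
    qed
    then have "unit_op u w' ` span (y ` Q) \<subseteq> span (y ` Q)"
      unfolding E.span_image[symmetric] by (intro span_minimal) auto
    then show "unit_op u w' x \<in> span (y ` Q)" using x by auto
  qed simp
  have y_u0: "y u0 \<noteq> 0" using u0 by (simp add: y_def)
  have "span (y ` Up) \<noteq> {0}"
    using y_u0 u0_\<Omega> \<Omega>_Up span_base[of "y u0" "y ` Up"] by auto
  then have W_Up: "W = span (y ` Up)" using simple[OF sub[of Up]] by blast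
  have zero: "y w = 0" if w: "w \<in> Up - ?\<Omega>" for w
  proof -
    interpret E: Vector_Spaces.linear s s "unit_op u0 u0" by (rule linear_unit_op)
    let ?Q = "Up - ?\<Omega>"
    have "unit_op u0 u0 x = 0" if "x \<in> span (y ` ?Q)" for x
      using that
    proof (rule E.eq_0_on_span[rotated])
      fix x assume "x \<in> y ` ?Q"
      then show "unit_op u0 u0 x = 0" using op_y[OF _ u0(1) u0(1)] u0_\<Omega> by auto
    qed
    moreover have "unit_op u0 u0 (y u0) = y u0" using op_y[OF _ u0(1) u0(1), of u0] u0_\<Omega> \<Omega>_Up by auto
    ultimately have "span (y ` ?Q) \<noteq> W" using y_W[of u0] y_u0 by auto
    moreover have "subcomodule (end_SV X) s W \<rho> (span (y ` ?Q))"
      by (rule sub) (auto simp: Up_def descent_words_def)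
    ultimately have "span (y ` ?Q) = {0}" using simple by blast
    then show ?thesis using w span_base[of "y w" "y ` ?Q"] by auto
  qed
  have "y ` Up \<subseteq> insert 0 (y ` ?\<Omega>)" using zero by auto
  then have "span (y ` Up) \<subseteq> span (y ` ?\<Omega>)" using span_mono[of _ "insert 0 (y ` ?\<Omega>)"] by (simp add: span_insert_0)
  then have W_\<Omega>: "W = span (y ` ?\<Omega>)"
    using W_Up span_mono[OF image_mono[OF \<Omega>_Up], of y] by auto
  have indep: "c w = 0" if c: "(\<Sum>w\<in>?\<Omega>. s (c w) (y w)) = 0" and w: "w \<in> ?\<Omega>" for c w
  proof -
    interpret E: Vector_Spaces.linear s s "unit_op w u0" by (rule linear_unit_op)
    have w': "w \<in> words X p" "descents w \<subseteq> descents u0"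
      using w by (auto simp: descent_words_def S_def)
    have "0 = unit_op w u0 (\<Sum>w\<in>?\<Omega>. s (c w) (y w))" by (simp add: c E.zero)
    also have "\<dots> = (\<Sum>v\<in>?\<Omega>. if v = w then s (c w) (y u0) else 0)"
      unfolding E.sum E.scale
      using \<Omega>_Up by (intro sum.cong refl) (auto simp: op_y[OF _ w'(1) u0(1) w'(2)] subset_iff)
    also have "\<dots> = s (c w) (y u0)" using w fin by simp
    finally show ?thesis using y_u0 by simp
  qed
  have rep: "lookup (as_mat_rep \<rho> (y w)) e = (\<Sum>w'\<in>?\<Omega>. s (mat_coeff e w w') (y w'))"
    if w: "w \<in> ?\<Omega>" for w e
  proof -
    \<comment> \<open>Lifts are not homogeneous: \<open>\<rho> (y w)\<close> may contain words of any length, and only its class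
      modulo the ideal is known to have degree \<open>p\<close>.\<close>
    let ?L = "insert p (length ` keys (\<rho> (y w)))"
    have w_Up: "w \<in> Up" and wp: "w \<in> words X p" and wS: "descents w = S"
      using w \<Omega>_Up by (auto simp: descent_words_def)
    have unit_term: "s (mat_coeff e u w') (unit_op u w' (y w))
        = (if u = w \<and> w' \<in> ?\<Omega> then s (mat_coeff e w w') (y w') else 0)"
      if "u \<in> words X q" "w' \<in> words X q" for q u w'
    proof (cases "descents u \<subseteq> descents w'")
      case True
      have "w' \<in> Up" if "u = w"
        using that True \<open>w' \<in> words X q\<close> \<open>u \<in> words X q\<close> wp wS by (auto simp: Up_def words_def)
      then show ?thesis using op_y[OF w_Up that True] zero[of w'] by auto
    next
      case False
      then show ?thesis using mat_coeff_eq_0[OF that False] wS by (auto simp: descent_words_def)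
    qed
    have "lookup (as_mat_rep \<rho> (y w)) e
        = (\<Sum>q\<in>?L. \<Sum>u\<in>words X q. \<Sum>w'\<in>words X q. s (mat_coeff e u w') (unit_op u w' (y w)))"
      by (rule lookup_as_mat_rep_expand[OF y_W]) auto
    also have "\<dots> = (\<Sum>q\<in>?L. \<Sum>u\<in>words X q. \<Sum>w'\<in>words X q.
        if u = w \<and> w' \<in> ?\<Omega> then s (mat_coeff e w w') (y w') else 0)"
      by (intro sum.cong refl unit_term)
    also have "\<dots> = (\<Sum>q\<in>?L. if q = p then \<Sum>w'\<in>?\<Omega>. s (mat_coeff e w w') (y w') else 0)"
    proof (intro sum.cong refl)
      fix q
      have "(\<Sum>u\<in>words X q. \<Sum>w'\<in>words X q. if u = w \<and> w' \<in> ?\<Omega> then s (mat_coeff e w w') (y w') else 0)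
          = (\<Sum>u\<in>words X q. if u = w then
              \<Sum>w'\<in>words X q. if w' \<in> ?\<Omega> then s (mat_coeff e w w') (y w') else 0 else 0)"
        by (intro sum.cong refl) auto
      also have "\<dots> = (if w \<in> words X q then
          \<Sum>w'\<in>words X q. if w' \<in> ?\<Omega> then s (mat_coeff e w w') (y w') else 0 else 0)"
        by (simp add: finite_words finite_X)
      also have "w \<in> words X q \<longleftrightarrow> q = p" using wp by (auto simp: words_def)
      also have "(if q = p then
            \<Sum>w'\<in>words X q. if w' \<in> ?\<Omega> then s (mat_coeff e w w') (y w') else 0 else 0)
          = (if q = p then \<Sum>w'\<in>?\<Omega>. s (mat_coeff e w w') (y w') else 0)"
        by (auto simp: descent_words_def sum.inter_filter[symmetric] finite_words finite_X)
      finally show "(\<Sum>u\<in>words X q. \<Sum>w'\<in>words X q.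
          if u = w \<and> w' \<in> ?\<Omega> then s (mat_coeff e w w') (y w') else 0)
        = (if q = p then \<Sum>w'\<in>?\<Omega>. s (mat_coeff e w w') (y w') else 0)" .
    qed
    also have "\<dots> = (\<Sum>w'\<in>?\<Omega>. s (mat_coeff e w w') (y w'))"
      by (subst sum.delta) auto
    finally show ?thesis .
  qed
  have "ribbon_basis p S s W \<rho> y"
    unfolding ribbon_basis_def using W_\<Omega> indep rep by blast
  then show ?thesis using u0_\<Omega> by blast
qed

end


section \<open>Construction of the simple comodules\<close>

lemma (in vector_space) pure_tensor_zero_right: "pure_tensor scale f 0 = 0"
  by (rule poly_mapping_eqI) simp

context ordered_alphabet_dual
begin

definition descent_space :: "nat \<Rightarrow> nat set \<Rightarrow> ('v list \<Rightarrow>\<^sub>0 'k) set" where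
  "descent_space p S = {t. keys t \<subseteq> descent_words p S}"

definition descent_coact ::
  "nat \<Rightarrow> nat set \<Rightarrow> ('v list \<Rightarrow>\<^sub>0 'k) \<Rightarrow> (('v \<times> 'v) list \<Rightarrow>\<^sub>0 ('v list \<Rightarrow>\<^sub>0 'k))" where
  "descent_coact p S t = (\<Sum>w\<in>descent_words p S. \<Sum>w'\<in>descent_words p S.
     pure_tensor fscale (mat_el w w') (single w' (lookup t w)))"

lemma finite_descent_words: "finite (descent_words p S)"
  using finite_words[OF finite_X] by (simp add: descent_words_def)

lemma descent_words_in_words: "w \<in> descent_words p S \<Longrightarrow> w \<in> words X p"
  by (simp add: descent_words_def)

lemma subspace_descent_space: "tensors.subspace (descent_space p S)"
proof (rule tensors.subspaceI)
  fix t u assume "t \<in> descent_space p S" "u \<in> descent_space p S"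
  then show "t + u \<in> descent_space p S"
    using Poly_Mapping.keys_add[of t u] by (auto simp: descent_space_def)
next
  fix c t assume "t \<in> descent_space p S"
  then show "fscale c t \<in> descent_space p S"
    by (auto simp: descent_space_def in_keys_iff subset_iff)
qed (simp add: descent_space_def)

lemma descent_space_eq_sum:
  assumes "t \<in> descent_space p S"
  shows "t = (\<Sum>w\<in>descent_words p S. single w (lookup t w))"
  by (rule poly_mapping_eqI)
    (use assms in \<open>auto simp: lookup_sum lookup_single when_def finite_descent_words
      descent_space_def in_keys_iff\<close>)

lemma single_in_descent_space: "w \<in> descent_words p S \<Longrightarrow> single w c \<in> descent_space p S"
  by (simp add: descent_space_def)

lemma linear_descent_coact:
  "Vector_Spaces.linear fscale (pscale fscale) (descent_coact p S)"
proof -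
  interpret P: vector_space "pscale fscale :: 'k \<Rightarrow> (('v \<times> 'v) list \<Rightarrow>\<^sub>0 ('v list \<Rightarrow>\<^sub>0 'k)) \<Rightarrow> _"
    by (rule tensors.vector_space_pscale)
  show ?thesis
  proof unfold_locales
    fix t u :: "'v list \<Rightarrow>\<^sub>0 'k" and c :: 'k
    show "descent_coact p S (t + u) = descent_coact p S t + descent_coact p S u"
      by (simp add: descent_coact_def lookup_add single_add tensors.pure_tensor_add_right sum.distrib)
    have "pure_tensor fscale (mat_el w w') (single w' (c * d))
        = pscale fscale c (pure_tensor fscale (mat_el w w') (single w' d))" for w w' d
      by (rule poly_mapping_eqI) (simp add: scalars.pscale_single; simp only: mult_ac)
    then show "descent_coact p S (fscale c t) = pscale fscale c (descent_coact p S t)"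
      by (simp add: descent_coact_def P.scale_sum_right)
  qed
qed

lemma contract_descent_coact:
  "contract fscale T (descent_coact p S t) = (\<Sum>w\<in>descent_words p S.
     \<Sum>w'\<in>descent_words p S. single w' (pairing T (mat_el w w') * lookup t w))"
  by (simp add: descent_coact_def tensors.contract_sum tensors.contract_pure_tensor
      scalars.pscale_single)

lemma pairing_end_counit_mat_el:
  assumes "u \<in> words X p" "w \<in> words X p"
  shows "pairing end_counit (mat_el u w) = of_bool (u = w)"
proof -
  have len: "length u = p" "length w = p" using assms by (auto simp: words_def)
  have "pairing end_counit (mat_el u w)
      = (\<Sum>c\<in>words X p. \<Sum>a\<in>words X p. if a = c then antisym u c * \<beta> w a else 0)"
    unfolding pairing_mat_el len
    by (intro sum.cong refl) (simp add: end_counit_eq words_def)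
  also have "\<dots> = (\<Sum>c\<in>words X p. antisym u c * \<beta> w c)"
    by (intro sum.cong refl) (simp add: finite_words finite_X)
  finally show ?thesis using assms by (simp add: dual_orthogonal)
qed

text \<open>The coproduct of matrix coefficients keeps its form under the change of basis, and it does so in
\<open>F \<otimes> F\<close>, before passing to the quotient by the ideal.\<close>

lemma comul_mat_el:
  assumes u: "u \<in> words X p" and w: "w \<in> words X p"
  shows "(\<Sum>z\<in>keys (mat_el u w). lookup (end_comul X z) (z1, z2) * lookup (mat_el u w) z)
    = (\<Sum>v\<in>words X p. lookup (mat_el u v) z1 * lookup (mat_el v w) z2)"
proof -
  let ?W = "words X p"
  have len: "length u = p" "length w = p" using u w by (auto simp: words_def)
  have "(\<Sum>z\<in>keys (mat_el u w). lookup (end_comul X z) (z1, z2) * lookup (mat_el u w) z)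
      = pairing (\<lambda>z. lookup (end_comul X z) (z1, z2)) (mat_el u w)"
    by (simp add: contract_def lsum_def)
  also have "\<dots> = (\<Sum>c\<in>?W. \<Sum>a\<in>?W. \<Sum>l\<in>?W.
      if zip c l = z1 \<and> zip l a = z2 then antisym u c * \<beta> w a else 0)"
    unfolding pairing_mat_el len
    by (intro sum.cong refl)
      (auto simp: end_comul_eq words_def lookup_sum lookup_single when_def sum_distrib_right intro!: sum.cong)
  also have "\<dots> = (\<Sum>v\<in>?W. lookup (mat_el u v) z1 * lookup (mat_el v w) z2)"
  proof (cases "z1 \<in> end_words X \<and> length z1 = p \<and> z2 \<in> end_words X \<and> length z2 = p")
    case False
    have "\<not> (zip c l = z1 \<and> zip l a = z2)" if "c \<in> ?W" "a \<in> ?W" "l \<in> ?W" for c a l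
      using that False by (auto simp: words_def end_words_def dest: set_zip_leftD set_zip_rightD)
    then have "(\<Sum>c\<in>?W. \<Sum>a\<in>?W. \<Sum>l\<in>?W.
        if zip c l = z1 \<and> zip l a = z2 then antisym u c * \<beta> w a else 0) = 0"
      by (intro sum.neutral ballI) auto
    moreover have "(\<Sum>v\<in>?W. lookup (mat_el u v) z1 * lookup (mat_el v w) z2) = 0"
      using False u w by (intro sum.neutral ballI) (auto simp: lookup_mat_el)
    ultimately show ?thesis by simp
  next
    case True
    have z: "map fst z1 \<in> ?W" "map snd z1 \<in> ?W" "map fst z2 \<in> ?W" "map snd z2 \<in> ?W"
      using True end_words_zip[of z1 X] end_words_zip[of z2 X] by auto
    have iff: "zip c l = z1 \<and> zip l a = z2 \<longleftrightarrow>
        c = map fst z1 \<and> l = map snd z1 \<and> a = map snd z2 \<and> map snd z1 = map fst z2"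
      if "c \<in> ?W" "a \<in> ?W" "l \<in> ?W" for c a l
      using that by (auto simp: words_def zip_map_fst_snd) (metis zip_map_fst_snd)
    let ?k = "of_bool (map snd z1 = map fst z2) * (antisym u (map fst z1) * \<beta> w (map snd z2))"
    have "(\<Sum>c\<in>?W. \<Sum>a\<in>?W. \<Sum>l\<in>?W.
        if zip c l = z1 \<and> zip l a = z2 then antisym u c * \<beta> w a else 0)
      = (\<Sum>c\<in>?W. if c = map fst z1 then \<Sum>a\<in>?W. if a = map snd z2 then
          \<Sum>l\<in>?W. if l = map snd z1 then ?k else 0 else 0 else 0)"
      by (intro sum.cong refl) (auto simp: iff intro!: sum.cong sum.neutral)
    also have "\<dots> = ?k" using z by (simp add: finite_words finite_X)
    also have "\<dots> = (\<Sum>v\<in>?W. \<beta> v (map snd z1) * antisym v (map fst z2)) *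
        (antisym u (map fst z1) * \<beta> w (map snd z2))"
      using z by (simp add: dual_expand)
    also have "\<dots> = (\<Sum>v\<in>?W. lookup (mat_el u v) z1 * lookup (mat_el v w) z2)"
      unfolding sum_distrib_right
      by (intro sum.cong refl) (use True u w in \<open>simp add: lookup_mat_el; simp only: mult_ac\<close>)
    finally show ?thesis .
  qed
  finally show ?thesis .
qed

text \<open>The coproduct of \<open>mat_el w w'\<close> is a sum over all words \<open>v\<close>, whereas applying the coaction twice gives
the sum over the \<open>v\<close> with descent set \<open>S\<close>.  If \<open>v\<close> has another descent set, then either the descents
of \<open>w\<close> are not contained in those of \<open>v\<close>, or those of \<open>v\<close> are not contained in those of \<open>w'\<close>, so one of
the two factors lies in the ideal.\<close>

lemma comodule_descent_space:
  "comodule (end_SV X) fscale (descent_space p S) (descent_coact p S)"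
proof -
  let ?\<Omega> = "descent_words p S" and ?\<rho> = "descent_coact p S" and ?V = "descent_space p S"
  let ?C = "end_SV X :: (('v \<times> 'v) list, 'k) coalg"
  interpret P: vector_space "pscale fscale :: 'k \<Rightarrow> (('v \<times> 'v) list \<Rightarrow>\<^sub>0 ('v list \<Rightarrow>\<^sub>0 'k)) \<Rightarrow> _"
    by (rule tensors.vector_space_pscale)
  interpret P2: vector_space "pscale fscale :: 'k \<Rightarrow>
      (('v \<times> 'v) list \<times> ('v \<times> 'v) list \<Rightarrow>\<^sub>0 ('v list \<Rightarrow>\<^sub>0 'k)) \<Rightarrow> _"
    by (rule tensors.vector_space_pscale)
  interpret R: Vector_Spaces.linear fscale "pscale fscale" ?\<rho> by (rule linear_descent_coact)
  note in_words = descent_words_in_words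
  have tens: "?\<rho> t \<in> tensors (end_words X) ?V" for t
    unfolding descent_coact_def
    by (intro P.subspace_sum tensors.subspace_tensors tensors.pure_tensor_in_tensors
        subspace_descent_space keys_mat_el[of _ p] single_in_descent_space in_words)
  have counit: "lsum (\<lambda>z. fscale (end_counit z)) (?\<rho> t) = t" if t: "t \<in> ?V" for t
  proof -
    have "lsum (\<lambda>z. fscale (end_counit z)) (?\<rho> t) = contract fscale end_counit (?\<rho> t)"
      by (simp add: contract_def)
    also have "\<dots> = (\<Sum>w\<in>?\<Omega>. \<Sum>w'\<in>?\<Omega>. if w' = w then single w' (lookup t w) else 0)"
      unfolding contract_descent_coact
      by (intro sum.cong refl) (simp add: pairing_end_counit_mat_el[OF in_words in_words])
    also have "\<dots> = (\<Sum>w\<in>?\<Omega>. single w (lookup t w))"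
      by (intro sum.cong refl) (simp add: finite_descent_words)
    finally show ?thesis by (simp only: descent_space_eq_sum[OF t, symmetric])
  qed
  have coassoc: "comul_tensor_id ?C fscale (?\<rho> t) - id_tensor_coact ?\<rho> (?\<rho> t)
      \<in> subspace_tensor fscale (rels2 ?C) ?V" for t
  proof -
    let ?x = "\<lambda>w w'. single w' (lookup t w)"
    let ?F = "\<lambda>w v w'. pure_tensor fscale (free_tensor (mat_el w v) (mat_el v w')) (?x w w')"
    have 1: "comul_tensor_id ?C fscale (?\<rho> t) = (\<Sum>w\<in>?\<Omega>. \<Sum>w'\<in>?\<Omega>. \<Sum>v\<in>words X p. ?F w v w')"
    proof (rule poly_mapping_eqI, clarify)
      fix z1 z2 :: "('v \<times> 'v) list"
      have add: "lsum (\<lambda>z m. pure_tensor fscale (end_comul X z) m) (\<Sum>i\<in>I. u i)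
          = (\<Sum>i\<in>I. lsum (\<lambda>z m. pure_tensor fscale (end_comul X z) m) (u i))"
        for I :: "'v list set" and u :: "'v list \<Rightarrow> (('v \<times> 'v) list \<Rightarrow>\<^sub>0 ('v list \<Rightarrow>\<^sub>0 'k))"
        by (rule lsum_sum) (rule tensors.pure_tensor_add_right)
      have pure: "lookup (lsum (\<lambda>z m. pure_tensor fscale (end_comul X z) m) (pure_tensor fscale f x)) (z1, z2)
          = fscale (\<Sum>z\<in>keys f. lookup (end_comul X z) (z1, z2) * lookup f z) x"
        for f :: "('v \<times> 'v) list \<Rightarrow>\<^sub>0 'k" and x :: "'v list \<Rightarrow>\<^sub>0 'k"
      proof -
        have "keys (pure_tensor fscale f x) \<subseteq> keys f" by (auto simp: in_keys_iff)
        then have "lsum (\<lambda>z m. pure_tensor fscale (end_comul X z) m) (pure_tensor fscale f x)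
            = (\<Sum>z\<in>keys f. pure_tensor fscale (end_comul X z) (fscale (lookup f z) x))"
          by (subst lsum_superset[where A = "keys f"]) (auto intro!: poly_mapping_eqI)
        then show ?thesis by (simp add: lookup_sum tensors.scale_sum_left)
      qed
      show "lookup (comul_tensor_id ?C fscale (?\<rho> t)) (z1, z2)
          = lookup (\<Sum>w\<in>?\<Omega>. \<Sum>w'\<in>?\<Omega>. \<Sum>v\<in>words X p. ?F w v w') (z1, z2)"
        unfolding comul_tensor_id_def descent_coact_def
        by (simp add: end_SV_def add lookup_sum pure lookup_free_tensor comul_mat_el[OF in_words in_words]
            tensors.scale_sum_left)
    qed
    have 2: "id_tensor_coact ?\<rho> (?\<rho> t) = (\<Sum>w\<in>?\<Omega>. \<Sum>w'\<in>?\<Omega>. \<Sum>v\<in>?\<Omega>. ?F w v w')"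
    proof (rule poly_mapping_eqI, clarify)
      fix z1 z2 :: "('v \<times> 'v) list"
      have single: "lookup (?\<rho> (single v c)) z2 = (\<Sum>w'\<in>?\<Omega>. single w' (lookup (mat_el v w') z2 * c))"
        if "v \<in> ?\<Omega>" for v c
      proof -
        have "?\<rho> (single v c) = (\<Sum>w\<in>?\<Omega>. if w = v then
            \<Sum>w'\<in>?\<Omega>. pure_tensor fscale (mat_el v w') (single w' c) else 0)"
          unfolding descent_coact_def
          by (intro sum.cong refl) (auto simp: lookup_single when_def tensors.pure_tensor_zero_right)
        then show ?thesis
          using that by (simp add: finite_descent_words lookup_sum scalars.pscale_single)
      qed
      have "lookup (id_tensor_coact ?\<rho> (?\<rho> t)) (z1, z2) = lookup (?\<rho> (lookup (?\<rho> t) z1)) z2"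
        by (rule lookup_id_tensor_coact) (rule R.zero)
      also have "lookup (?\<rho> t) z1 = (\<Sum>w\<in>?\<Omega>. \<Sum>v\<in>?\<Omega>. single v (lookup (mat_el w v) z1 * lookup t w))"
        unfolding descent_coact_def by (simp add: lookup_sum scalars.pscale_single)
      also have "lookup (?\<rho> \<dots>) z2 = (\<Sum>w\<in>?\<Omega>. \<Sum>v\<in>?\<Omega>. \<Sum>w'\<in>?\<Omega>.
          single w' (lookup (mat_el v w') z2 * (lookup (mat_el w v) z1 * lookup t w)))"
        unfolding R.sum lookup_sum by (intro sum.cong refl single)
      also have "\<dots> = (\<Sum>w\<in>?\<Omega>. \<Sum>w'\<in>?\<Omega>. \<Sum>v\<in>?\<Omega>. lookup (?F w v w') (z1, z2))"
        by (subst (2) sum.swap, intro sum.cong refl)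
          (simp add: lookup_free_tensor scalars.pscale_single; simp only: mult_ac)
      finally show "lookup (id_tensor_coact ?\<rho> (?\<rho> t)) (z1, z2)
          = lookup (\<Sum>w\<in>?\<Omega>. \<Sum>w'\<in>?\<Omega>. \<Sum>v\<in>?\<Omega>. ?F w v w') (z1, z2)"
        by (simp only: lookup_sum)
    qed
    have "?\<Omega> \<subseteq> words X p" using in_words by blast
    then have "comul_tensor_id ?C fscale (?\<rho> t) - id_tensor_coact ?\<rho> (?\<rho> t)
        = (\<Sum>w\<in>?\<Omega>. \<Sum>w'\<in>?\<Omega>. \<Sum>v\<in>words X p - ?\<Omega>. ?F w v w')"
      unfolding 1 2 sum_subtractf[symmetric]
      by (intro sum.cong refl) (simp add: sum_diff finite_words finite_X)
    also have "\<dots> \<in> subspace_tensor fscale (rels2 ?C) ?V"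
    proof (intro P2.subspace_sum tensors.subspace_subspace_tensor)
      fix w w' v assume w: "w \<in> ?\<Omega>" "w' \<in> ?\<Omega>" and v: "v \<in> words X p - ?\<Omega>"
      have el: "mat_el a b \<in> carrier_coalg ?C" if "a \<in> words X p" "b \<in> words X p" for a b
        using keys_mat_el[OF that] by (simp add: carrier_coalg_def end_SV_def)
      have "\<not> descents w \<subseteq> descents v \<or> \<not> descents v \<subseteq> descents w'"
        using w v by (auto simp: descent_words_def)
      then have "mat_el w v \<in> rels ?C \<or> mat_el v w' \<in> rels ?C"
        using mat_el_in_end_ideal[OF in_words[OF w(1)], of v]
          mat_el_in_end_ideal[OF _ in_words[OF w(2)], of v] v
        by (simp add: end_SV_def) blast
      then have "free_tensor (mat_el w v) (mat_el v w') \<in> rels2 ?C"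
        using el[of w v] el[of v w'] w v in_words unfolding rels2_def by blast
      then show "?F w v w' \<in> subspace_tensor fscale (rels2 ?C) ?V"
        by (intro tensors.pure_tensor_in_subspace_tensor single_in_descent_space w(2))
    qed
    finally show ?thesis .
  qed
  show ?thesis
    unfolding comodule_def
    using tens counit coassoc tensors.vector_space_axioms subspace_descent_space linear_descent_coact
    by (simp add: end_SV_def)
qed

text \<open>Every matrix unit within the block is a functional on end(SV), so a subcomodule that contains a
vector with a nonzero coordinate contains every basis vector.\<close>

theorem simple_comodule_descent_space:
  assumes "descent_words p S \<noteq> {}"
  shows "simple_comodule (end_SV X) fscale (descent_space p S) (descent_coact p S)"
proof -
  let ?\<Omega> = "descent_words p S" and ?\<rho> = "descent_coact p S" and ?V = "descent_space p S"
  note in_words = descent_words_in_words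
  have sub_cases: "N = {0} \<or> N = ?V" if sub: "subcomodule (end_SV X) fscale ?V ?\<rho> N" for N
  proof (cases "N = {0}")
    case False
    have N: "tensors.subspace N" "N \<subseteq> ?V" using sub by (auto simp: subcomodule_def)
    then obtain m where m: "m \<in> N" "m \<noteq> 0" using False tensors.subspace_0[OF N(1)] by auto
    obtain w where w: "lookup m w \<noteq> 0" using m(2) by (metis lookup_zero poly_mapping_eqI)
    moreover have "keys m \<subseteq> ?\<Omega>" using m(1) N(2) by (auto simp: descent_space_def)
    ultimately have w\<Omega>: "w \<in> ?\<Omega>" by (auto simp: in_keys_iff)
    obtain t where t: "t \<in> tensors (end_words X) N" "?\<rho> m - t \<in> subspace_tensor fscale (end_ideal X) ?V"
      using sub m(1) by (auto simp: subcomodule_def end_SV_def)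
    have "single w' 1 \<in> N" if w': "w' \<in> ?\<Omega>" for w'
    proof -
      have "contract fscale (mat_fun w w') (?\<rho> m - t) = 0"
        by (rule tensors.contract_subspace_tensor[OF t(2)], rule pairing_mat_fun_end_ideal)
          (use w\<Omega> w' in \<open>auto simp: descent_words_def\<close>)
      then have "contract fscale (mat_fun w w') (?\<rho> m) = contract fscale (mat_fun w w') t"
        by (simp add: tensors.contract_diff)
      also have "\<dots> \<in> N" by (rule tensors.contract_tensors[OF N(1) t(1)])
      also have "contract fscale (mat_fun w w') (?\<rho> m)
          = (\<Sum>u\<in>?\<Omega>. if u = w then \<Sum>v\<in>?\<Omega>. if v = w' then single v (lookup m u) else 0 else 0)"
        unfolding contract_descent_coact
        using w\<Omega> w' by (intro sum.cong refl)
          (auto simp: pairing_mat_fun_mat_el[OF in_words in_words in_words in_words] intro!: sum.cong sum.neutral)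
      also have "\<dots> = single w' (lookup m w)"
        using w\<Omega> w' by (simp add: finite_descent_words)
      finally have "fscale (inverse (lookup m w)) (single w' (lookup m w)) \<in> N"
        by (rule tensors.subspace_scale[OF N(1)])
      then show ?thesis using w by (simp add: scalars.pscale_single)
    qed
    then have "fscale c (single w' 1) \<in> N" if "w' \<in> ?\<Omega>" for w' c
      using that by (intro tensors.subspace_scale[OF N(1)])
    then have single: "single w' c \<in> N" if "w' \<in> ?\<Omega>" for w' c
      using that by (simp add: scalars.pscale_single)
    have "t \<in> N" if "t \<in> ?V" for t
      by (subst descent_space_eq_sum[OF that]) (intro tensors.subspace_sum[OF N(1)] single)
    then show ?thesis using N by auto
  qed simp
  obtain w where "w \<in> ?\<Omega>" using assms by blast
  moreover have "single w (1::'k) \<noteq> 0"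
    by (metis lookup_single_eq lookup_zero one_neq_zero)
  ultimately have "?V \<noteq> {0}" using single_in_descent_space[of w p S 1] by auto
  with sub_cases show ?thesis using comodule_descent_space by (simp add: simple_comodule_def)
qed

theorem ribbon_basis_descent_space:
  "ribbon_basis p S fscale (descent_space p S) (descent_coact p S) (\<lambda>w. single w 1)"
proof -
  let ?\<Omega> = "descent_words p S" and ?V = "descent_space p S"
  have "t \<in> tensors.span ((\<lambda>w. single w 1) ` ?\<Omega>)" if "t \<in> ?V" for t
  proof -
    have "t = (\<Sum>w\<in>?\<Omega>. fscale (lookup t w) (single w 1))"
      using descent_space_eq_sum[OF that] by (simp add: scalars.pscale_single)
    also have "\<dots> \<in> tensors.span ((\<lambda>w. single w 1) ` ?\<Omega>)"
      by (intro tensors.span_sum tensors.span_scale tensors.span_base) auto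
    finally show ?thesis .
  qed
  moreover have "tensors.span ((\<lambda>w. single w 1) ` ?\<Omega>) \<subseteq> ?V"
    by (intro tensors.span_minimal subspace_descent_space) (auto intro: single_in_descent_space)
  ultimately have span: "?V = tensors.span ((\<lambda>w. single w 1) ` ?\<Omega>)" by auto
  have indep: "c w = 0" if "(\<Sum>w\<in>?\<Omega>. fscale (c w) (single w 1)) = 0" "w \<in> ?\<Omega>"
    for c :: "'v list \<Rightarrow> 'k" and w
  proof -
    have "0 = lookup (\<Sum>w\<in>?\<Omega>. fscale (c w) (single w 1)) w" by (simp add: that(1))
    also have "\<dots> = c w"
      using that(2) by (simp add: lookup_sum lookup_single scalars.pscale_single when_def finite_descent_words)
    finally show ?thesis by simp
  qed
  have rep: "lookup (as_mat_rep (descent_coact p S) (single w 1)) e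
      = (\<Sum>w'\<in>?\<Omega>. fscale (mat_coeff e w w') (single w' 1))" if "w \<in> ?\<Omega>" for w e
  proof -
    have "lookup (as_mat_rep (descent_coact p S) (single w 1)) e
        = (\<Sum>u\<in>?\<Omega>. if u = w then \<Sum>w'\<in>?\<Omega>. single w' (mat_coeff e w w') else 0)"
      unfolding tensors.lookup_as_mat_rep contract_descent_coact mat_coeff_def[symmetric]
      by (intro sum.cong refl) (auto simp: lookup_single when_def)
    then show ?thesis using that by (simp add: finite_descent_words scalars.pscale_single)
  qed
  show ?thesis unfolding ribbon_basis_def using span indep rep by blast
qed

end


section \<open>Skew Schur functors of ribbons\<close>

definition ribbon_step :: "bool \<Rightarrow> nat \<times> nat \<Rightarrow> nat \<times> nat \<Rightarrow> bool" where
  "ribbon_step up x y \<longleftrightarrow> (if up then fst x = Suc (fst y) \<and> snd y = snd x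
     else fst y = fst x \<and> snd y = Suc (snd x))"

text \<open>The boxes of \<open>D\<close> in the order from the lower left to the upper right end: the step from box \<open>t\<close> goes
up if \<open>t \<in> S\<close> and to the right otherwise.\<close>

definition ribbon_path :: "(nat \<times> nat) set \<Rightarrow> nat \<Rightarrow> nat set \<Rightarrow> (nat \<Rightarrow> nat \<times> nat) \<Rightarrow> bool" where
  "ribbon_path D p S b \<longleftrightarrow> bij_betw b {..<p} D \<and> S \<subseteq> {t. Suc t < p} \<and>
     (\<forall>t. Suc t < p \<longrightarrow> ribbon_step (t \<in> S) (b t) (b (Suc t)))"

lemma ribbon_path_col:
  "ribbon_path D p S b \<Longrightarrow> t < p \<Longrightarrow> snd (b t) = snd (b 0) + block S t"
proof (induction t)
  case 0
  then show ?case by (simp add: block_def)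
next
  case (Suc t)
  then show ?case by (auto simp: ribbon_path_def ribbon_step_def block_Suc split: if_splits)
qed

lemma ribbon_path_row:
  "ribbon_path D p S b \<Longrightarrow> t < p \<Longrightarrow> fst (b t) + block (- S) t = fst (b 0)"
proof (induction t)
  case 0
  then show ?case by (simp add: block_def)
next
  case (Suc t)
  then have "fst (b t) + block (- S) t = fst (b 0)" by simp
  moreover have "ribbon_step (t \<in> S) (b t) (b (Suc t))"
    using Suc.prems by (auto simp: ribbon_path_def)
  ultimately show ?case by (auto simp: ribbon_step_def block_Suc split: if_splits)
qed

locale labeled_ribbon = ordered_alphabet_dual X r \<beta>
  for X :: "'v set" and r :: "'v \<Rightarrow> nat" and \<beta> :: "'v list \<Rightarrow> 'v list \<Rightarrow> 'k::field_char_0" +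
  fixes D :: "(nat \<times> nat) set" and p :: nat and S :: "nat set" and b :: "nat \<Rightarrow> nat \<times> nat"
    and l :: "nat \<times> nat \<Rightarrow> nat"
  assumes path: "ribbon_path D p S b" and labeling: "labeling D l"
begin

lemma bij_b: "bij_betw b {..<p} D"
  using path by (simp add: ribbon_path_def)

lemma card_D: "card D = p"
  using bij_betw_same_card[OF bij_b] by simp

lemma S_less: "i \<in> S \<Longrightarrow> Suc i < p"
  using path by (auto simp: ribbon_path_def)

text \<open>The permutation that compares the given labels with the order along the ribbon.\<close>

definition \<tau> :: "nat \<Rightarrow> nat" where
  "\<tau> t = (if t < p then l (b t) else t)"

lemma \<tau>_permutes: "\<tau> permutes {..<p}"
proof -
  have "bij_betw (l \<circ> b) {..<p} {..<p}"
    using bij_betw_trans[OF bij_b] labeling by (simp add: labeling_def card_D)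
  then have "bij_betw \<tau> {..<p} {..<p}"
    by (rule bij_betw_cong[THEN iffD1, rotated]) (simp add: \<tau>_def)
  then show ?thesis by (rule bij_imp_permutes) (simp add: \<tau>_def)
qed

lemma inv_\<tau>_permutes: "inv \<tau> permutes {..<p}"
  by (rule permutes_inv[OF \<tau>_permutes])

text \<open>Passing to the labels of the ribbon path turns the row and column groups of an arbitrary labeling
into Young subgroups.\<close>

lemma block_perms_conjugate:
  assumes f: "\<And>s t. s < p \<Longrightarrow> t < p \<Longrightarrow> f (b s) = f (b t) \<longleftrightarrow> block A s = block A t"
  shows "bij_betw (\<lambda>\<sigma>. \<tau> \<circ> (\<sigma> \<circ> inv \<tau>)) (young p A) (block_perms D l f)"
proof (rule bij_betwI[where g = "\<lambda>\<sigma>. inv \<tau> \<circ> (\<sigma> \<circ> \<tau>)"])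
  note inv1 = permutes_inverses[OF \<tau>_permutes]
  have mem: "\<sigma> \<in> block_perms D l f \<longleftrightarrow> \<sigma> permutes {..<p} \<and> (\<forall>s<p. \<forall>t<p. \<sigma> (\<tau> s) = \<tau> t \<longrightarrow> f (b s) = f (b t))"
    for \<sigma>
  proof -
    have "D = b ` {..<p}" using bij_b by (simp add: bij_betw_def)
    then show ?thesis unfolding block_perms_def card_D by (auto simp: \<tau>_def)
  qed
  show "(\<lambda>\<sigma>. \<tau> \<circ> (\<sigma> \<circ> inv \<tau>)) \<in> young p A \<rightarrow> block_perms D l f"
  proof
    fix \<sigma> assume \<sigma>: "\<sigma> \<in> young p A"
    have "f (b s) = f (b t)" if st: "s < p" "t < p" and eq: "\<tau> (\<sigma> (inv \<tau> (\<tau> s))) = \<tau> t" for s t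
    proof -
      have "\<sigma> s = t" using eq injD[OF permutes_inj[OF \<tau>_permutes]] by (simp add: inv1)
      then show ?thesis using \<sigma> st f[of s t] by (auto simp: young_def)
    qed
    then show "\<tau> \<circ> (\<sigma> \<circ> inv \<tau>) \<in> block_perms D l f"
      using \<tau>_permutes inv_\<tau>_permutes young_permutes[OF \<sigma>]
      by (auto simp: mem intro!: permutes_compose)
  qed
  show "(\<lambda>\<sigma>. inv \<tau> \<circ> (\<sigma> \<circ> \<tau>)) \<in> block_perms D l f \<rightarrow> young p A"
  proof
    fix \<sigma> assume "\<sigma> \<in> block_perms D l f"
    then have \<sigma>: "\<sigma> permutes {..<p}" and pres: "\<And>s t. s < p \<Longrightarrow> t < p \<Longrightarrow> \<sigma> (\<tau> s) = \<tau> t \<Longrightarrow> f (b s) = f (b t)"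
      by (auto simp: mem)
    have perm: "inv \<tau> \<circ> (\<sigma> \<circ> \<tau>) permutes {..<p}"
      using \<tau>_permutes inv_\<tau>_permutes \<sigma> by (auto intro!: permutes_compose)
    have "block A ((inv \<tau> \<circ> (\<sigma> \<circ> \<tau>)) s) = block A s" for s
    proof (cases "s < p")
      case True
      let ?t = "(inv \<tau> \<circ> (\<sigma> \<circ> \<tau>)) s"
      have t: "?t < p" using permutes_in_image[OF perm, of s] True by simp
      have "f (b s) = f (b ?t)" by (rule pres[OF True t]) (simp add: inv1)
      then show ?thesis using f[OF True t] by simp
    next
      case False
      then show ?thesis using permutes_not_in[OF perm, of s] by simp
    qed
    then show "inv \<tau> \<circ> (\<sigma> \<circ> \<tau>) \<in> young p A" using perm by (simp add: young_def)
  qed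
qed (simp_all add: fun_eq_iff permutes_inverses[OF \<tau>_permutes])

lemma column_perms: "bij_betw (\<lambda>\<sigma>. \<tau> \<circ> (\<sigma> \<circ> inv \<tau>)) (young p S) (block_perms D l snd)"
proof (rule block_perms_conjugate)
  fix s t assume "s < p" "t < p"
  then show "snd (b s) = snd (b t) \<longleftrightarrow> block S s = block S t"
    using ribbon_path_col[OF path, of s] ribbon_path_col[OF path, of t] by simp
qed

lemma row_perms: "bij_betw (\<lambda>\<sigma>. \<tau> \<circ> (\<sigma> \<circ> inv \<tau>)) (young p (- S)) (block_perms D l fst)"
proof (rule block_perms_conjugate)
  fix s t assume "s < p" "t < p"
  then show "fst (b s) = fst (b t) \<longleftrightarrow> block (- S) s = block (- S) t"
    using ribbon_path_row[OF path, of s] ribbon_path_row[OF path, of t] by auto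
qed

abbreviation relabel :: "('v list \<Rightarrow>\<^sub>0 'k) \<Rightarrow> ('v list \<Rightarrow>\<^sub>0 'k)" where
  "relabel \<equiv> place_perm (inv \<tau>)"

definition row_sym :: "('v list \<Rightarrow>\<^sub>0 'k) \<Rightarrow> ('v list \<Rightarrow>\<^sub>0 'k)" where
  "row_sym t = (\<Sum>\<sigma>\<in>young p (- S). place_perm \<sigma> t)"

definition col_antisym :: "('v list \<Rightarrow>\<^sub>0 'k) set" where
  "col_antisym = {t \<in> tensor_power X p. \<forall>\<sigma>\<in>young p S. place_perm \<sigma> t = fscale (of_int (sign \<sigma>)) t}"

text \<open>The basis of the skew Schur functor: basis vectors of the tensor power, symmetrized along the rows
and carried to the places given by the labeling.\<close>

definition ribbon_vector :: "'v list \<Rightarrow> ('v list \<Rightarrow>\<^sub>0 'k)" where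
  "ribbon_vector w = relabel (row_sym (antisym_word w))"

lemma linear_row_sym: "Vector_Spaces.linear fscale fscale row_sym"
proof unfold_locales
  fix t u :: "'v list \<Rightarrow>\<^sub>0 'k" and c
  show "row_sym (t + u) = row_sym t + row_sym u" by (simp add: row_sym_def place_perm.add sum.distrib)
  show "row_sym (fscale c t) = fscale c (row_sym t)"
    by (simp add: row_sym_def place_perm.scale tensors.scale_sum_right)
qed

sublocale row_sym: Vector_Spaces.linear fscale fscale row_sym
  by (rule linear_row_sym)

lemma row_sym_in_tensor_power: "t \<in> tensor_power X p \<Longrightarrow> row_sym t \<in> tensor_power X p"
  unfolding row_sym_def
  by (intro tensors.subspace_sum subspace_tensor_power place_perm_in_tensor_power finite_X young_permutes)

lemma place_perm_conjugate:
  assumes "t \<in> tensor_power X p" "\<sigma> permutes {..<p}"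
  shows "place_perm (\<tau> \<circ> (\<sigma> \<circ> inv \<tau>)) t = relabel (place_perm \<sigma> (place_perm \<tau> t))"
  using assms \<tau>_permutes inv_\<tau>_permutes
  by (simp add: place_perm_comp[OF finite_X, where p = p]
      place_perm_in_tensor_power[OF finite_X, where p = p] permutes_compose)

lemma place_perm_relabel:
  assumes "t \<in> tensor_power X p"
  shows "place_perm \<tau> (relabel t) = t" "relabel (place_perm \<tau> t) = t"
  using place_perm_comp[OF finite_X assms inv_\<tau>_permutes \<tau>_permutes]
    place_perm_comp[OF finite_X assms \<tau>_permutes inv_\<tau>_permutes]
    permutes_inv_o[OF \<tau>_permutes] place_perm_id[OF finite_X assms]
  by simp_all

lemma skew_schur_eq: "skew_schur X D l = relabel ` row_sym ` col_antisym"
proof -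
  have sgn: "sign (\<tau> \<circ> (\<sigma> \<circ> inv \<tau>)) = sign \<sigma>" if "\<sigma> permutes {..<p}" for \<sigma>
  proof -
    have fp: "permutation \<pi>" if "\<pi> permutes {..<p}" for \<pi> :: "nat \<Rightarrow> nat"
      using that permutation_permutes by blast
    have "sign (\<tau> \<circ> (\<sigma> \<circ> inv \<tau>)) = sign \<tau> * (sign \<sigma> * sign (inv \<tau>))"
      using that \<tau>_permutes inv_\<tau>_permutes by (simp add: sign_compose fp permutation_compose)
    then show ?thesis using fp[OF \<tau>_permutes] by (simp add: sign_inverse sign_idempotent mult.left_commute)
  qed
  have col: "t \<in> column_antisymmetric X D l \<longleftrightarrow> t \<in> tensor_power X p \<and> place_perm \<tau> t \<in> col_antisym" for t :: "'v list \<Rightarrow>\<^sub>0 'k"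
  proof (cases "t \<in> tensor_power X p")
    case True
    have \<tau>t: "place_perm \<tau> t \<in> tensor_power X p"
      by (rule place_perm_in_tensor_power[OF finite_X True \<tau>_permutes])
    have inj: "relabel x = relabel y \<longleftrightarrow> x = y" if "x \<in> tensor_power X p" "y \<in> tensor_power X p" for x y
      using place_perm_relabel(1) that by metis
    have "(\<forall>\<sigma>\<in>block_perms D l snd. place_perm \<sigma> t = fscale (of_int (sign \<sigma>)) t)
        \<longleftrightarrow> (\<forall>\<sigma>\<in>young p S. place_perm (\<tau> \<circ> (\<sigma> \<circ> inv \<tau>)) t
              = fscale (of_int (sign (\<tau> \<circ> (\<sigma> \<circ> inv \<tau>)))) t)"
      unfolding bij_betw_imp_surj_on[OF column_perms, symmetric] by simp
    also have "\<dots> \<longleftrightarrow> (\<forall>\<sigma>\<in>young p S. relabel (place_perm \<sigma> (place_perm \<tau> t))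
              = relabel (fscale (of_int (sign \<sigma>)) (place_perm \<tau> t)))"
      by (intro ball_cong refl)
        (simp add: place_perm_conjugate[OF True young_permutes] sgn[OF young_permutes] place_perm.scale
          place_perm_relabel[OF True])
    also have "\<dots> \<longleftrightarrow> (\<forall>\<sigma>\<in>young p S. place_perm \<sigma> (place_perm \<tau> t)
              = fscale (of_int (sign \<sigma>)) (place_perm \<tau> t))"
      by (intro ball_cong refl inj place_perm_in_tensor_power[OF finite_X \<tau>t] young_permutes
          tensors.subspace_scale[OF subspace_tensor_power] \<tau>t)
    finally show ?thesis
      using True \<tau>t by (simp add: column_antisymmetric_def col_antisym_def card_D)
  qed (simp add: column_antisymmetric_def card_D)
  have row: "row_symmetrize D l t = relabel (row_sym (place_perm \<tau> t))" if "t \<in> tensor_power X p" for t :: "'v list \<Rightarrow>\<^sub>0 'k"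
  proof -
    have "row_symmetrize D l t = (\<Sum>\<sigma>\<in>young p (- S). place_perm (\<tau> \<circ> (\<sigma> \<circ> inv \<tau>)) t)"
      unfolding row_symmetrize_def
      by (rule sum.reindex_bij_betw[OF row_perms, symmetric])
    then show ?thesis
      by (simp add: place_perm_conjugate[OF that young_permutes] row_sym_def place_perm.sum)
  qed
  show ?thesis
  proof (intro equalityI subsetI)
    fix x :: "'v list \<Rightarrow>\<^sub>0 'k" assume "x \<in> skew_schur X D l"
    then show "x \<in> relabel ` row_sym ` col_antisym"
      by (auto simp: skew_schur_def col row)
  next
    fix x :: "'v list \<Rightarrow>\<^sub>0 'k" assume "x \<in> relabel ` row_sym ` col_antisym"
    then obtain t where t: "t \<in> col_antisym" and x: "x = relabel (row_sym t)" by auto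
    have tp: "t \<in> tensor_power X p" using t by (simp add: col_antisym_def)
    then have "relabel t \<in> tensor_power X p"
      by (intro place_perm_in_tensor_power[OF finite_X _ inv_\<tau>_permutes])
    then show "x \<in> skew_schur X D l"
      unfolding skew_schur_def x using t tp
      by (intro image_eqI[of _ _ "relabel t"]) (simp_all add: row col place_perm_relabel)
  qed
qed

definition dual_value :: "'v list \<Rightarrow> ('v list \<Rightarrow>\<^sub>0 'k) \<Rightarrow> 'k" where
  "dual_value w t = (\<Sum>c\<in>words X p. lookup t c * \<beta> w c)"

lemma linear_dual_value: "Vector_Spaces.linear fscale (*) (dual_value w)"
proof unfold_locales
  fix t u :: "'v list \<Rightarrow>\<^sub>0 'k" and c :: 'k
  show "dual_value w (t + u) = dual_value w t + dual_value w u"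
    by (simp only: dual_value_def lookup_add distrib_right sum.distrib)
  show "dual_value w (fscale c t) = c * dual_value w t"
    by (simp only: dual_value_def scalars.lookup_pscale sum_distrib_left mult.assoc)
qed

sublocale dual_value: Vector_Spaces.linear fscale "(*)" "dual_value w" for w
  by (rule linear_dual_value)

lemma dual_value_antisym_word:
  "v \<in> words X p \<Longrightarrow> w \<in> words X p \<Longrightarrow> dual_value v (antisym_word w) = of_bool (w = v)"
  unfolding dual_value_def by (rule dual_orthogonal)

lemma sum_antisym_word:
  assumes "t \<in> tensor_power X p"
  shows "t = (\<Sum>w\<in>words X p. fscale (dual_value w t) (antisym_word w))"
proof (rule poly_mapping_eqI)
  fix a
  show "lookup t a = lookup (\<Sum>w\<in>words X p. fscale (dual_value w t) (antisym_word w)) a"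
  proof (cases "a \<in> words X p")
    case True
    have "lookup (\<Sum>w\<in>words X p. fscale (dual_value w t) (antisym_word w)) a
        = (\<Sum>w\<in>words X p. \<Sum>c\<in>words X p. lookup t c * (\<beta> w c * antisym w a))"
      by (simp only: lookup_sum scalars.lookup_pscale dual_value_def sum_distrib_right mult.assoc)
    also have "\<dots> = (\<Sum>c\<in>words X p. lookup t c * (\<Sum>w\<in>words X p. \<beta> w c * antisym w a))"
      by (subst sum.swap) (simp only: sum_distrib_left)
    also have "\<dots> = lookup t a"
      using True by (simp add: dual_expand finite_words finite_X)
    finally show ?thesis ..
  next
    case False
    then show ?thesis using assms
      by (auto simp: lookup_sum antisym_support tensor_power_def in_keys_iff)
  qed
qed

lemma dual_value_place_perm:
  assumes "t \<in> tensor_power X p" "\<sigma> permutes {..<p}"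
  shows "dual_value w (place_perm \<sigma> t) = (\<Sum>c\<in>words X p. lookup t c * \<beta> w (permute_list \<sigma> c))"
  unfolding dual_value_def
  by (subst sum.reindex_bij_betw[OF bij_betw_permute_list_words[OF assms(2)], symmetric])
    (simp add: lookup_place_perm[OF finite_X assms] cong: sum.cong)

text \<open>The rows are the blocks of \<open>- S\<close>, and for \<open>D(w) = S\<close> the dual basis vector of \<open>w\<close> is invariant under
the group of these blocks.\<close>

lemma dual_value_row_sym:
  assumes "t \<in> tensor_power X p" "w \<in> descent_words p S"
  shows "dual_value w (row_sym t) = of_nat (card (young p (- S))) * dual_value w t"
proof -
  have "dual_value w (place_perm \<sigma> t) = dual_value w t" if "\<sigma> \<in> young p (- S)" for \<sigma>
    unfolding dual_value_place_perm[OF assms(1) young_permutes[OF that]]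
    using that assms(2) dual_young_invariant[of w p \<sigma>]
    by (simp add: dual_value_def descent_words_def)
  then show ?thesis by (simp add: row_sym_def dual_value.sum)
qed

lemma antisym_word_in_col_antisym:
  "w \<in> words X p \<Longrightarrow> S \<subseteq> descents w \<Longrightarrow> antisym_word w \<in> col_antisym"
  by (simp add: col_antisym_def antisym_word_in_tensor_power place_perm_antisym_word)

lemma dual_value_col_antisym:
  assumes "t \<in> col_antisym" "w \<in> words X p" "\<not> S \<subseteq> descents w"
  shows "dual_value w t = 0"
proof -
  obtain i where i: "i \<in> S" "i \<notin> descents w" using assms(3) by auto
  let ?s = "Transposition.transpose i (Suc i)"
  have t: "t \<in> tensor_power X p" using assms(1) by (simp add: col_antisym_def)
  have "place_perm ?s t = fscale (of_int (sign ?s)) t"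
    using assms(1) adj_transpose_in_young[OF i(1) S_less[OF i(1)]] by (simp add: col_antisym_def)
  then have "- dual_value w t = dual_value w (place_perm ?s t)"
    by (simp add: sign_swap_id dual_value.neg)
  also have "\<dots> = dual_value w t"
    unfolding dual_value_place_perm[OF t adj_transpose_permutes[OF S_less[OF i(1)]]]
    by (simp add: dual_value_def dual_swap[OF assms(2) i(2) S_less[OF i(1)]])
  finally show ?thesis by (simp add: neg_eq_iff_add_eq_0)
qed

text \<open>A descent outside \<open>S\<close> joins two places of one row, in which the word is antisymmetric.\<close>

lemma row_sym_antisym_word_eq_0:
  assumes "w \<in> words X p" "\<not> descents w \<subseteq> S"
  shows "row_sym (antisym_word w) = 0"
proof -
  obtain i where i: "i \<in> descents w" "i \<notin> S" using assms(2) by auto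
  let ?s = "Transposition.transpose i (Suc i)" and ?t = "antisym_word w :: 'v list \<Rightarrow>\<^sub>0 'k"
  have ip: "Suc i < p" using i(1) assms(1) by (simp add: descents_def words_def)
  have s: "?s \<in> young p (- S)" using i(2) ip by (intro adj_transpose_in_young) auto
  have t: "?t \<in> tensor_power X p" by (rule antisym_word_in_tensor_power[OF assms(1)])
  have "row_sym ?t = (\<Sum>\<sigma>\<in>young p (- S). place_perm (?s \<circ> \<sigma>) ?t)"
    unfolding row_sym_def by (rule sum.reindex_bij_betw[OF bij_betw_young_left[OF s], symmetric])
  also have "\<dots> = row_sym (place_perm ?s ?t)"
    unfolding row_sym_def
    by (intro sum.cong refl place_perm_comp[OF finite_X t young_permutes[OF s]] young_permutes)
  also have "\<dots> = - row_sym ?t"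
    by (simp add: place_perm_adj_antisym_word[OF assms(1) i(1)] row_sym.neg)
  finally have "row_sym ?t = - row_sym ?t" .
  then have "lookup (row_sym ?t) a = - lookup (row_sym ?t) a" for a
    by (metis lookup_uminus)
  then show ?thesis by (intro poly_mapping_eqI) simp
qed

text \<open>The column-antisymmetric tensors have the basis of all antisymmetrized words whose descents contain
\<open>S\<close>; the row symmetrizer kills those with further descents.\<close>

lemma skew_schur_eq_span:
  "skew_schur X D l = tensors.span (ribbon_vector ` descent_words p S)"
proof -
  let ?f = "relabel \<circ> row_sym"
  interpret F: Vector_Spaces.linear fscale fscale ?f
    by (rule Vector_Spaces.linear_compose[OF linear_row_sym linear_place_perm])
  have col: "col_antisym = tensors.span (antisym_word ` {w \<in> words X p. S \<subseteq> descents w})"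
  proof (intro equalityI subsetI)
    fix t assume t: "t \<in> col_antisym"
    have "t = (\<Sum>w\<in>words X p. fscale (dual_value w t) (antisym_word w))"
      by (rule sum_antisym_word) (use t in \<open>simp add: col_antisym_def\<close>)
    also have "\<dots> \<in> tensors.span (antisym_word ` {w \<in> words X p. S \<subseteq> descents w})"
    proof (rule tensors.span_sum)
      fix w assume w: "w \<in> words X p"
      show "fscale (dual_value w t) (antisym_word w)
          \<in> tensors.span (antisym_word ` {w \<in> words X p. S \<subseteq> descents w})"
      proof (cases "S \<subseteq> descents w")
        case True
        then show ?thesis using w by (intro tensors.span_scale tensors.span_base) auto
      next
        case False
        then show ?thesis by (simp add: dual_value_col_antisym[OF t w] tensors.span_zero)
      qed
    qed
    finally show "t \<in> tensors.span (antisym_word ` {w \<in> words X p. S \<subseteq> descents w})" .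
  next
    fix t :: "'v list \<Rightarrow>\<^sub>0 'k"
    assume t: "t \<in> tensors.span (antisym_word ` {w \<in> words X p. S \<subseteq> descents w})"
    have "tensors.subspace col_antisym"
      by (rule tensors.subspaceI)
        (auto simp: col_antisym_def place_perm.zero place_perm.add place_perm.scale tensors.scale_right_distrib mult.commute
          intro!: tensors.subspace_0[OF subspace_tensor_power]
          tensors.subspace_add[OF subspace_tensor_power] tensors.subspace_scale[OF subspace_tensor_power])
    then have "tensors.span (antisym_word ` {w \<in> words X p. S \<subseteq> descents w}) \<subseteq> col_antisym"
      by (rule tensors.span_minimal[rotated]) (auto intro: antisym_word_in_col_antisym)
    then show "t \<in> col_antisym" using t by blast
  qed
  have zero: "?f (antisym_word w) = 0" if "w \<in> words X p" "S \<subseteq> descents w" "descents w \<noteq> S" for w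
  proof -
    show ?thesis using that row_sym_antisym_word_eq_0[of w] by (auto simp: place_perm.zero)
  qed
  have "skew_schur X D l = ?f ` tensors.span (antisym_word ` {w \<in> words X p. S \<subseteq> descents w})"
    by (simp add: skew_schur_eq col image_comp)
  also have "\<dots> = tensors.span (?f ` antisym_word ` {w \<in> words X p. S \<subseteq> descents w})"
    by (rule F.span_image[symmetric])
  also have "\<dots> = tensors.span (ribbon_vector ` descent_words p S)"
  proof -
    have rv: "?f (antisym_word w) = ribbon_vector w" for w by (simp add: ribbon_vector_def)
    have "?f ` antisym_word ` {w \<in> words X p. S \<subseteq> descents w}
        \<subseteq> insert 0 (ribbon_vector ` descent_words p S)"
      using zero unfolding rv[symmetric] by (auto simp: descent_words_def)
    then have "tensors.span (?f ` antisym_word ` {w \<in> words X p. S \<subseteq> descents w})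
        \<subseteq> tensors.span (ribbon_vector ` descent_words p S)"
      using tensors.span_mono[of _ "insert 0 (ribbon_vector ` descent_words p S)"]
      by (simp add: tensors.span_insert_0)
    moreover have "ribbon_vector ` descent_words p S
        \<subseteq> ?f ` antisym_word ` {w \<in> words X p. S \<subseteq> descents w}"
      unfolding rv[symmetric] by (auto simp: descent_words_def)
    ultimately show ?thesis using tensors.span_mono by blast
  qed
  finally show ?thesis .
qed

lemma ribbon_vector_independent:
  assumes "(\<Sum>w\<in>descent_words p S. fscale (c w) (ribbon_vector w)) = 0"
    and v: "v \<in> descent_words p S"
  shows "c v = 0"
proof -
  let ?\<Omega> = "descent_words p S"
  let ?t = "\<Sum>w\<in>?\<Omega>. fscale (c w) (antisym_word w)"
  have t: "?t \<in> tensor_power X p"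
    by (intro tensors.subspace_sum tensors.subspace_scale subspace_tensor_power
        antisym_word_in_tensor_power descent_words_in_words)
  have "relabel (row_sym ?t) = 0"
    using assms(1) by (simp add: ribbon_vector_def place_perm.sum place_perm.scale row_sym.sum row_sym.scale)
  then have "row_sym ?t = 0"
    using place_perm_relabel(1)[OF row_sym_in_tensor_power[OF t]] by (simp add: place_perm.zero)
  then have "of_nat (card (young p (- S))) * dual_value v ?t = 0"
    using dual_value_row_sym[OF t v] by (simp add: dual_value.zero)
  moreover have "card (young p (- S)) \<noteq> 0"
    using id_in_young[of p "- S"] finite_young[of p "- S"] by auto
  ultimately have "dual_value v ?t = 0" by simp
  moreover have "dual_value v ?t = (\<Sum>w\<in>?\<Omega>. if w = v then c w else 0)"
    unfolding dual_value.sum dual_value.scale using v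
    by (intro sum.cong refl) (simp add: dual_value_antisym_word descent_words_in_words)
  ultimately show ?thesis using v by (simp add: finite_descent_words)
qed

lemma skew_schur_nonzero_iff: "skew_schur X D l \<noteq> {0 :: 'v list \<Rightarrow>\<^sub>0 'k} \<longleftrightarrow> descent_words p S \<noteq> {}"
proof -
  have nz: "ribbon_vector w \<noteq> 0" if "w \<in> descent_words p S" for w
  proof
    assume "ribbon_vector w = 0"
    then have "(\<Sum>v\<in>descent_words p S. fscale (of_bool (v = w)) (ribbon_vector v)) = 0"
      by (intro sum.neutral ballI) (simp add: tensors.scale_zero_right of_bool_def)
    from ribbon_vector_independent[OF this that] show False by simp
  qed
  show ?thesis
  proof
    assume "skew_schur X D l \<noteq> ({0} :: ('v list \<Rightarrow>\<^sub>0 'k) set)"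
    then show "descent_words p S \<noteq> {}" unfolding skew_schur_eq_span by auto
  next
    assume "descent_words p S \<noteq> {}"
    then obtain w where w: "w \<in> descent_words p S" by blast
    then have "ribbon_vector w \<in> skew_schur X D l"
      unfolding skew_schur_eq_span by (intro tensors.span_base imageI)
    then show "skew_schur X D l \<noteq> ({0} :: ('v list \<Rightarrow>\<^sub>0 'k) set)" using nz[OF w] by auto
  qed
qed

end


section \<open>Comparison of the coactions\<close>

context labeled_ribbon
begin

text \<open>The coefficient of the monomial \<open>e\<close> in the coaction on tensors of degree \<open>p\<close>, as a linear map of the
tensor power.\<close>

definition coact_at :: "'v monomial \<Rightarrow> ('v list \<Rightarrow>\<^sub>0 'k) \<Rightarrow> ('v list \<Rightarrow>\<^sub>0 'k)" where
  "coact_at e t = (\<Sum>c\<in>words X p. \<Sum>a\<in>words X p.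
     if monomial_of_word (zip c a) = e then single a (lookup t c) else 0)"

lemma lookup_mat_coact:
  assumes "t \<in> tensor_power X p"
  shows "lookup (mat_coact X t) e = coact_at e t"
proof -
  have "mat_coact X t = (\<Sum>c\<in>words X p. \<Sum>a\<in>words X (length c).
      single (monomial_of_word (zip c a)) (single a (lookup t c)))"
    unfolding mat_coact_def
    by (rule lsum_superset) (use assms in \<open>auto simp: finite_words finite_X tensor_power_def\<close>)
  also have "lookup \<dots> e = coact_at e t"
    unfolding coact_at_def lookup_sum lookup_single
    by (intro sum.cong) (auto simp: when_def words_def)
  finally show ?thesis .
qed

lemma linear_coact_at: "Vector_Spaces.linear fscale fscale (coact_at e)"
proof unfold_locales
  fix t u :: "'v list \<Rightarrow>\<^sub>0 'k" and c :: 'k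
  show "coact_at e (t + u) = coact_at e t + coact_at e u"
    unfolding coact_at_def sum.distrib[symmetric]
    by (intro sum.cong refl) (simp add: lookup_add single_add)
  show "coact_at e (fscale c t) = fscale c (coact_at e t)"
    unfolding coact_at_def tensors.scale_sum_right
    by (intro sum.cong refl) (simp add: scalars.pscale_single)
qed

sublocale coact_at: Vector_Spaces.linear fscale fscale "coact_at e" for e
  by (rule linear_coact_at)

text \<open>Permuting the places of rows and columns of a matrix coefficient together only reorders the
factors of a commutative monomial.\<close>

lemma coact_at_place_perm:
  assumes t: "t \<in> tensor_power X p" and \<sigma>: "\<sigma> permutes {..<p}"
  shows "coact_at e (place_perm \<sigma> t) = place_perm \<sigma> (coact_at e t)"
proof -
  have reindex: "(\<Sum>c\<in>words X p. g c) = (\<Sum>c\<in>words X p. g (permute_list \<sigma> c))"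
    for g :: "'v list \<Rightarrow> ('v list \<Rightarrow>\<^sub>0 'k)"
    by (rule sum.reindex_bij_betw[OF bij_betw_permute_list_words[OF \<sigma>], symmetric])
  have "coact_at e (place_perm \<sigma> t) = (\<Sum>c\<in>words X p. \<Sum>a\<in>words X p.
      if monomial_of_word (zip (permute_list \<sigma> c) (permute_list \<sigma> a)) = e
      then single (permute_list \<sigma> a) (lookup (place_perm \<sigma> t) (permute_list \<sigma> c)) else 0)"
    unfolding coact_at_def by (subst reindex, rule sum.cong[OF refl], rule reindex)
  also have "\<dots> = (\<Sum>c\<in>words X p. \<Sum>a\<in>words X p.
      place_perm \<sigma> (if monomial_of_word (zip c a) = e then single a (lookup t c) else 0))"
  proof (intro sum.cong refl)
    fix c a assume c: "c \<in> words X p" and a: "a \<in> words X p"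
    have "mset (zip (permute_list \<sigma> c) (permute_list \<sigma> a)) = mset (zip c a)"
      using c a \<sigma> by (simp add: words_def permute_list_zip[symmetric])
    from monomial_of_word_cong[OF this]
    show "(if monomial_of_word (zip (permute_list \<sigma> c) (permute_list \<sigma> a)) = e
        then single (permute_list \<sigma> a) (lookup (place_perm \<sigma> t) (permute_list \<sigma> c)) else 0)
      = place_perm \<sigma> (if monomial_of_word (zip c a) = e then single a (lookup t c) else 0)"
      by (simp add: lookup_place_perm[OF finite_X t \<sigma> c] place_perm_single place_perm.zero)
  qed
  also have "\<dots> = place_perm \<sigma> (coact_at e t)"
    by (simp only: coact_at_def place_perm.sum)
  finally show ?thesis .
qed

lemma coact_at_antisym_word:
  assumes w: "w \<in> words X p"
  shows "coact_at e (antisym_word w) = (\<Sum>v\<in>words X p. fscale (mat_coeff e w v) (antisym_word v))"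
proof -
  let ?W = "words X p" and ?m = "\<lambda>c a. of_bool (monomial_of_word (zip c a) = e) :: 'k"
  have single: "single a x = (\<Sum>v\<in>?W. fscale (x * \<beta> v a) (antisym_word v))" if "a \<in> ?W" for a x
  proof -
    have "dual_value v (single a x) = x * \<beta> v a" for v
    proof -
      have "dual_value v (single a x) = (\<Sum>c\<in>?W. if c = a then x * \<beta> v a else 0)"
        unfolding dual_value_def by (intro sum.cong refl) (simp add: lookup_single when_def)
      then show ?thesis using that by (simp add: finite_words finite_X)
    qed
    then show ?thesis using sum_antisym_word[OF tensor_power_single[OF that], of x] by simp
  qed
  have "coact_at e (antisym_word w) = (\<Sum>c\<in>?W. \<Sum>a\<in>?W. \<Sum>v\<in>?W.
      fscale (?m c a * (antisym w c * \<beta> v a)) (antisym_word v))"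
    unfolding coact_at_def by (intro sum.cong refl) (simp add: single)
  also have "\<dots> = (\<Sum>v\<in>?W. \<Sum>c\<in>?W. \<Sum>a\<in>?W. fscale (?m c a * (antisym w c * \<beta> v a)) (antisym_word v))"
    by (subst (2) sum.swap, subst sum.swap) (rule refl)
  also have "\<dots> = (\<Sum>v\<in>?W. fscale (mat_coeff e w v) (antisym_word v))"
  proof (rule sum.cong[OF refl])
    fix v assume "v \<in> ?W"
    then have "mat_coeff e w v = (\<Sum>c\<in>?W. \<Sum>a\<in>?W. ?m c a * (antisym w c * \<beta> v a))"
      using w by (simp add: mat_coeff_def pairing_mat_el words_def)
    then show "(\<Sum>c\<in>?W. \<Sum>a\<in>?W. fscale (?m c a * (antisym w c * \<beta> v a)) (antisym_word v))
        = fscale (mat_coeff e w v) (antisym_word v)"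
      by (simp only: tensors.scale_sum_left)
  qed
  finally show ?thesis .
qed

lemma ribbon_vector_in_tensor_power: "w \<in> words X p \<Longrightarrow> ribbon_vector w \<in> tensor_power X p"
  unfolding ribbon_vector_def
  by (intro place_perm_in_tensor_power[OF finite_X _ inv_\<tau>_permutes] row_sym_in_tensor_power
      antisym_word_in_tensor_power)

text \<open>On the whole tensor power the sum runs over all words \<open>v\<close>.  If the descents of
\<open>v\<close> do not contain \<open>S\<close>, then the matrix coefficient is zero in the coordinate ring; if \<open>v\<close> has
a descent outside \<open>S\<close>, then its ribbon vector is zero.\<close>

lemma coact_at_ribbon_vector:
  assumes w: "w \<in> descent_words p S"
  shows "coact_at e (ribbon_vector w)
    = (\<Sum>v\<in>descent_words p S. fscale (mat_coeff e w v) (ribbon_vector v))"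
proof -
  have wp: "w \<in> words X p" and wS: "descents w = S" using w by (auto simp: descent_words_def)
  note t = antisym_word_in_tensor_power[OF wp]
  have "coact_at e (row_sym (antisym_word w)) = row_sym (coact_at e (antisym_word w))"
    unfolding row_sym_def coact_at.sum
    by (intro sum.cong refl coact_at_place_perm t young_permutes)
  then have "coact_at e (ribbon_vector w) = relabel (row_sym (coact_at e (antisym_word w)))"
    unfolding ribbon_vector_def
    by (simp add: coact_at_place_perm[OF row_sym_in_tensor_power[OF t] inv_\<tau>_permutes])
  also have "\<dots> = (\<Sum>v\<in>words X p. fscale (mat_coeff e w v) (ribbon_vector v))"
    by (simp add: coact_at_antisym_word[OF wp] row_sym.sum row_sym.scale place_perm.sum place_perm.scale ribbon_vector_def)
  also have "\<dots> = (\<Sum>v\<in>descent_words p S. fscale (mat_coeff e w v) (ribbon_vector v))"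
  proof (rule sum.mono_neutral_right)
    show "\<forall>v\<in>words X p - descent_words p S. fscale (mat_coeff e w v) (ribbon_vector v) = 0"
    proof
      fix v assume v: "v \<in> words X p - descent_words p S"
      then consider "\<not> S \<subseteq> descents v" | "\<not> descents v \<subseteq> S" by (auto simp: descent_words_def)
      then show "fscale (mat_coeff e w v) (ribbon_vector v) = 0"
      proof cases
        case 1
        then show ?thesis using mat_coeff_eq_0[OF wp, of v e] v wS by simp
      next
        case 2
        then show ?thesis using row_sym_antisym_word_eq_0[of v] v by (simp add: ribbon_vector_def place_perm.zero)
      qed
    qed
  qed (auto simp: finite_words finite_X descent_words_def)
  finally show ?thesis .
qed

text \<open>Send \<open>y w\<close> to the ribbon vector of \<open>w\<close>.  Both are bases with the same matrix coefficients.\<close>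

theorem comodule_iso_skew_schur:
  fixes s :: "'k \<Rightarrow> 'm::ab_group_add \<Rightarrow> 'm"
  assumes s: "vector_space s" and \<rho>: "Vector_Spaces.linear s (pscale s) \<rho>"
    and basis: "ribbon_basis p S s W \<rho> y"
  shows "comodule_iso (mat_O X) s W (as_mat_rep \<rho>) fscale (skew_schur X D l) (mat_coact X)"
proof -
  interpret M: vector_space s by fact
  interpret \<rho>: Vector_Spaces.linear s "pscale s" \<rho> by fact
  interpret MT: vector_space_pair s "fscale :: 'k \<Rightarrow> ('v list \<Rightarrow>\<^sub>0 'k) \<Rightarrow> _" by unfold_locales
  let ?\<Omega> = "descent_words p S"
  note fin = finite_descent_words[of p S]
  have W: "W = M.span (y ` ?\<Omega>)"
    and indep: "\<And>c w. (\<Sum>w\<in>?\<Omega>. s (c w) (y w)) = 0 \<Longrightarrow> w \<in> ?\<Omega> \<Longrightarrow> c w = 0"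
    and rep: "\<And>w e. w \<in> ?\<Omega> \<Longrightarrow>
      lookup (as_mat_rep \<rho> (y w)) e = (\<Sum>v\<in>?\<Omega>. s (mat_coeff e w v) (y v))"
    using basis by (auto simp: ribbon_basis_def)
  have inj: "inj_on y ?\<Omega>"
  proof (rule inj_onI, rule ccontr)
    fix v w assume vw: "v \<in> ?\<Omega>" "w \<in> ?\<Omega>" "y v = y w" "v \<noteq> w"
    have "(\<Sum>u\<in>?\<Omega>. s (of_bool (u = v) - of_bool (u = w)) (y u))
        = (\<Sum>u\<in>?\<Omega>. if u = v then y u else 0) - (\<Sum>u\<in>?\<Omega>. if u = w then y u else 0)"
      unfolding sum_subtractf[symmetric] by (intro sum.cong refl) (auto simp: M.scale_left_diff_distrib)
    also have "\<dots> = 0" using vw fin by simp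
    finally have "of_bool (v = v) - of_bool (v = w) = (0 :: 'k)" by (rule indep) (rule vw)
    then show False using vw by simp
  qed
  have "M.independent (y ` ?\<Omega>)"
  proof (rule M.independent_if_scalars_zero)
    fix f x assume f: "(\<Sum>x\<in>y ` ?\<Omega>. s (f x) x) = 0" and x: "x \<in> y ` ?\<Omega>"
    then obtain w where w: "w \<in> ?\<Omega>" "x = y w" by auto
    have "(\<Sum>w\<in>?\<Omega>. s (f (y w)) (y w)) = 0" using f by (simp add: sum.reindex[OF inj])
    from indep[OF this w(1)] show "f x = 0" by (simp add: w(2))
  qed (use fin in auto)
  from MT.linear_independent_extend[OF this, of "\<lambda>x. ribbon_vector (inv_into ?\<Omega> y x)"]
  obtain f where f: "Vector_Spaces.linear s fscale f"
    and f_y: "\<And>w. w \<in> ?\<Omega> \<Longrightarrow> f (y w) = ribbon_vector w"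
    using inj by auto
  interpret f: Vector_Spaces.linear s fscale f by fact
  have expand: "\<exists>c. m = (\<Sum>w\<in>?\<Omega>. s (c w) (y w))" if m: "m \<in> W" for m
  proof -
    obtain u where "m = (\<Sum>x\<in>y ` ?\<Omega>. s (u x) x)"
      using m fin by (auto simp: W M.span_finite)
    then have "m = (\<Sum>w\<in>?\<Omega>. s (u (y w)) (y w))" by (simp add: sum.reindex[OF inj])
    then show ?thesis by (intro exI[of _ "\<lambda>w. u (y w)"])
  qed
  have f_sum: "f (\<Sum>w\<in>?\<Omega>. s (c w) (y w)) = (\<Sum>w\<in>?\<Omega>. fscale (c w) (ribbon_vector w))" for c
    unfolding f.sum f.scale by (intro sum.cong refl) (simp add: f_y)
  have "inj_on f W"
    unfolding W
  proof (subst f.inj_on_iff_eq_0)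
    show "\<forall>m\<in>M.span (y ` ?\<Omega>). f m = 0 \<longrightarrow> m = 0"
    proof (intro ballI impI)
      fix m assume "m \<in> M.span (y ` ?\<Omega>)" and 0: "f m = 0"
      then obtain c where m: "m = (\<Sum>w\<in>?\<Omega>. s (c w) (y w))" using expand W by blast
      have "(\<Sum>w\<in>?\<Omega>. fscale (c w) (ribbon_vector w)) = 0" using 0 f_sum m by simp
      then have "c w = 0" if "w \<in> ?\<Omega>" for w using that by (rule ribbon_vector_independent)
      then show "m = 0" by (simp add: m)
    qed
  qed simp
  moreover have "f ` W = skew_schur X D l"
  proof -
    have "f ` y ` ?\<Omega> = ribbon_vector ` ?\<Omega>" using f_y by (auto simp: image_image)
    then show ?thesis unfolding W skew_schur_eq_span f.span_image[symmetric] by simp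
  qed
  ultimately have bij: "bij_betw f W (skew_schur X D l)" by (simp add: bij_betw_def)
  have compat: "mat_coact X (f m) = Poly_Mapping.map f (as_mat_rep \<rho> m)" if m: "m \<in> W" for m
  proof (rule poly_mapping_eqI)
    fix e
    let ?L = "\<lambda>m. lookup (as_mat_rep \<rho> m) e"
    have lin: "Vector_Spaces.linear s s ?L"
      unfolding M.lookup_as_mat_rep
      by unfold_locales (auto simp: \<rho>.add \<rho>.scale M.contract_add M.contract_pscale)
    interpret L: Vector_Spaces.linear s s ?L by (rule lin)
    obtain c where c: "m = (\<Sum>w\<in>?\<Omega>. s (c w) (y w))" using expand[OF m] by blast
    have "f m \<in> tensor_power X p"
      unfolding c f_sum
      by (intro tensors.subspace_sum tensors.subspace_scale subspace_tensor_power
          ribbon_vector_in_tensor_power descent_words_in_words)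
    then have "lookup (mat_coact X (f m)) e = coact_at e (f m)" by (rule lookup_mat_coact)
    also have "\<dots> = (\<Sum>w\<in>?\<Omega>. fscale (c w) (coact_at e (ribbon_vector w)))"
      unfolding c f_sum coact_at.sum coact_at.scale ..
    also have "\<dots> = (\<Sum>w\<in>?\<Omega>. fscale (c w) (f (?L (y w))))"
      by (intro sum.cong refl) (simp add: rep coact_at_ribbon_vector f_sum)
    also have "\<dots> = f (?L m)" unfolding c L.sum L.scale f.sum f.scale ..
    also have "\<dots> = lookup (Poly_Mapping.map f (as_mat_rep \<rho> m)) e"
      by (simp add: lookup_map_zero f.zero)
    finally show "lookup (mat_coact X (f m)) e = lookup (Poly_Mapping.map f (as_mat_rep \<rho> m)) e" .
  qed
  interpret P: vector_space "pscale fscale :: 'k \<Rightarrow> ('v monomial \<Rightarrow>\<^sub>0 ('v list \<Rightarrow>\<^sub>0 'k)) \<Rightarrow> _"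
    by (rule tensors.vector_space_pscale)
  show ?thesis
    unfolding comodule_iso_def
    using f bij compat P.subspace_0[OF tensors.subspace_subspace_tensor] by auto
qed

end


section \<open>Rim hooks are ribbons\<close>

definition content :: "nat \<times> nat \<Rightarrow> int" where
  "content x = int (snd x) - int (fst x)"

lemma block_add_block_compl: "block S t + block (- S) t = t"
  by (induction t) (auto simp: block_Suc block_def[of _ 0])

lemma ribbon_path_content:
  assumes "ribbon_path D p S b" "t < p"
  shows "content (b t) = content (b 0) + int t"
  using ribbon_path_col[OF assms] ribbon_path_row[OF assms] block_add_block_compl[of S t]
  by (simp add: content_def)

lemma ribbon_path_adjacent:
  assumes "ribbon_path D p S b" "Suc t < p"
  shows "adjacent (b t) (b (Suc t))"
  using assms by (auto simp: ribbon_path_def ribbon_step_def adjacent_def split: if_splits)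

lemma adjacent_sym: "adjacent x y \<Longrightarrow> adjacent y x"
  by (auto simp: adjacent_def)

lemma ribbon_path_connected:
  assumes "ribbon_path D p S b"
  shows "connected_diagram D"
proof -
  let ?R = "{(x, y). x \<in> D \<and> y \<in> D \<and> adjacent x y}"
  have D: "D = b ` {..<p}" using assms by (simp add: ribbon_path_def bij_betw_def)
  have sym: "sym (?R\<^sup>*)" by (intro sym_rtrancl symI) (auto intro: adjacent_sym)
  have le: "(b s, b t) \<in> ?R\<^sup>*" if "s \<le> t" "t < p" for s t
    using that
  proof (induction t rule: dec_induct)
    case (step t)
    then have "(b t, b (Suc t)) \<in> ?R"
      using ribbon_path_adjacent[OF assms, of t] by (auto simp: D)
    then show ?case using step by (auto intro: rtrancl_into_rtrancl)
  qed simp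
  have "(b s, b t) \<in> ?R\<^sup>*" if "s < p" "t < p" for s t
    using le[of s t] le[of t s] that symD[OF sym, of "b t" "b s"] by (cases "s \<le> t") auto
  then show ?thesis unfolding connected_diagram_def by (auto simp: D)
qed

lemma ribbon_path_no_square:
  assumes "ribbon_path D p S b"
  shows "\<nexists>i j. {(i, j), (Suc i, j), (i, Suc j), (Suc i, Suc j)} \<subseteq> D"
proof (rule notI, elim exE)
  fix i j assume "{(i, j), (Suc i, j), (i, Suc j), (Suc i, Suc j)} \<subseteq> D"
  moreover have "D = b ` {..<p}" using assms by (simp add: ribbon_path_def bij_betw_def)
  ultimately obtain s t where st: "s < p" "t < p" "b s = (i, j)" "b t = (Suc i, Suc j)"
    by (auto simp: image_iff)
  then have "int s = int t"
    using ribbon_path_content[OF assms, of s] ribbon_path_content[OF assms, of t]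
    by (simp add: content_def)
  then show False using st by simp
qed

text \<open>Adjacent boxes have contents that differ by one, so a walk cannot jump over the step from \<open>k\<close> to
\<open>k + 1\<close>.\<close>

lemma content_crossing:
  assumes "(x, y) \<in> {(x, y). x \<in> D \<and> y \<in> D \<and> adjacent x y}\<^sup>*" "content x \<le> k" "k < content y"
  shows "\<exists>u\<in>D. \<exists>v\<in>D. adjacent u v \<and> content u = k \<and> content v = k + 1"
  using assms
proof (induction rule: rtrancl_induct)
  case base
  then show ?case by simp
next
  case (step y z)
  show ?case
  proof (cases "k < content y")
    case True
    then show ?thesis using step by blast
  next
    case False
    have "content z \<le> content y + 1" using step.hyps(2) by (auto simp: adjacent_def content_def)
    then have "content y = k" "content z = k + 1" using False step.prems by auto
    then show ?thesis using step.hyps(2) by blast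
  qed
qed

lemma skew_diagram_finite:
  assumes "is_partition lam"
  shows "finite (skew_diagram lam mu)"
proof (rule finite_subset)
  have "lam i \<le> lam 0" for i using assms by (simp add: is_partition_def antimonoD)
  then show "skew_diagram lam mu \<subseteq> {i. lam i \<noteq> 0} \<times> {..<lam 0}"
    by (auto simp: skew_diagram_def young_diagram_def intro: less_le_trans)
  show "finite ({i. lam i \<noteq> 0} \<times> {..<lam 0})" using assms by (simp add: is_partition_def)
qed

text \<open>If two boxes lie on the same diagonal, then a skew diagram contains the 2 x 2 square
at the upper left one of them.\<close>

lemma rim_hook_inj_content:
  assumes "rim_hook lam mu"
  shows "inj_on content (skew_diagram lam mu)"
proof -
  let ?D = "skew_diagram lam mu"
  have lam: "antimono lam" and mu: "antimono mu"
    and sq: "\<nexists>i j. {(i, j), (Suc i, j), (i, Suc j), (Suc i, Suc j)} \<subseteq> ?D"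
    using assms by (auto simp: rim_hook_def is_partition_def)
  have no: False if ij: "(i, j) \<in> ?D" and kl: "(i + Suc d, j + Suc d) \<in> ?D" for i j d
  proof -
    have l: "j + Suc d < lam (i + Suc d)" "lam (i + Suc d) \<le> lam (Suc i)" "lam (Suc i) \<le> lam i"
      using kl lam by (auto simp: skew_diagram_def young_diagram_def antimono_def)
    have m: "mu i \<le> j" "mu (Suc i) \<le> mu i"
      using ij mu by (auto simp: skew_diagram_def young_diagram_def antimono_def)
    have "{(i, j), (Suc i, j), (i, Suc j), (Suc i, Suc j)} \<subseteq> ?D"
      using l m by (auto simp: skew_diagram_def young_diagram_def)
    then show False using sq by blast
  qed
  show ?thesis
  proof (rule inj_onI)
    fix x y assume xy: "x \<in> ?D" "y \<in> ?D" "content x = content y"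
    obtain i j k l where x: "x = (i, j)" and y: "y = (k, l)" by (cases x, cases y) auto
    have c: "int j - int i = int l - int k" using xy(3) by (simp add: x y content_def)
    consider "i = k" | "i < k" | "k < i" by linarith
    then show "x = y"
    proof cases
      case 1
      then show ?thesis using c by (simp add: x y)
    next
      case 2
      then obtain d where "k = i + Suc d" using less_iff_Suc_add by auto
      moreover then have "l = j + Suc d" using c by simp
      ultimately show ?thesis using no[of i j d] xy by (simp add: x y)
    next
      case 3
      then obtain d where "i = k + Suc d" using less_iff_Suc_add by auto
      moreover then have "j = l + Suc d" using c by simp
      ultimately show ?thesis using no[of k l d] xy by (simp add: x y)
    qed
  qed
qed

text \<open>Connectedness makes the set of contents an interval, and it provides for each \<open>k\<close> in it
except the last a pair of adjacent boxes with contents \<open>k\<close> and \<open>k + 1\<close>.  As contents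
determine boxes, these are the consecutive boxes of the walk.\<close>

theorem rim_hook_ribbon_path:
  assumes "rim_hook lam mu"
  shows "\<exists>p S b. ribbon_path (skew_diagram lam mu) p S b"
proof -
  let ?D = "skew_diagram lam mu"
  note inj = rim_hook_inj_content[OF assms]
  have conn: "connected_diagram ?D" using assms by (simp add: rim_hook_def)
  have fin: "finite ?D" using assms by (intro skew_diagram_finite) (simp add: rim_hook_def)
  show ?thesis
  proof (cases "?D = {}")
    case True
    then have "ribbon_path ?D 0 {} (\<lambda>_. (0, 0))" by (simp add: ribbon_path_def bij_betw_def)
    then show ?thesis by blast
  next
    case False
    define p where "p = card ?D"
    define m where "m = Min (content ` ?D)"
    define M where "M = Max (content ` ?D)"
    have mM: "m \<in> content ` ?D" "M \<in> content ` ?D" using fin False by (simp_all add: m_def M_def)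
    have range: "m \<le> content x" "content x \<le> M" if "x \<in> ?D" for x
      using that fin by (simp_all add: m_def M_def)
    have cross: "\<exists>u\<in>?D. \<exists>v\<in>?D. adjacent u v \<and> content u = k \<and> content v = k + 1"
      if "m \<le> k" "k < M" for k
    proof -
      obtain x y where "x \<in> ?D" "y \<in> ?D" "content x = m" "content y = M" using mM by auto
      then show ?thesis using that conn content_crossing[of x y ?D k] by (auto simp: connected_diagram_def)
    qed
    have img: "content ` ?D = {m..M}"
    proof (intro equalityI subsetI)
      fix k assume "k \<in> {m..M}"
      then show "k \<in> content ` ?D" using cross[of k] mM(2) by (cases "k = M") auto
    qed (use range in auto)
    have "card {m..M} = p" using card_image[OF inj] by (simp add: img p_def)
    moreover have "m \<le> M" using mM range by auto
    ultimately have M: "M = m + int p - 1" by auto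
    define b where "b t = inv_into ?D content (m + int t)" for t
    have b: "b t \<in> ?D" "content (b t) = m + int t" if "t < p" for t
      using that inv_into_into[of "m + int t" content ?D] f_inv_into_f[of "m + int t" content ?D]
      by (simp_all add: b_def img M)
    have unique: "x = b t" if "x \<in> ?D" "content x = m + int t" "t < p" for x t
      using inj_onD[OF inj, of x "b t"] b[of t] that by simp
    have bij: "bij_betw b {..<p} ?D"
    proof (rule bij_betwI[where g = "\<lambda>x. nat (content x - m)"])
      show "(\<lambda>x. nat (content x - m)) \<in> ?D \<rightarrow> {..<p}" using range M by fastforce
      fix x assume x: "x \<in> ?D"
      then have "x = b (nat (content x - m))" using range[OF x] M by (intro unique) auto
      then show "b (nat (content x - m)) = x" by simp
    qed (use b in auto)
    define S where "S = {t. Suc t < p \<and> snd (b (Suc t)) = snd (b t)}"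
    have step: "fst (b t) = Suc (fst (b (Suc t))) \<and> snd (b (Suc t)) = snd (b t)
        \<or> fst (b (Suc t)) = fst (b t) \<and> snd (b (Suc t)) = Suc (snd (b t))" if t: "Suc t < p" for t
    proof -
      obtain u v where "u \<in> ?D" "v \<in> ?D" "adjacent u v" "content u = m + int t" "content v = m + int t + 1"
        using cross[of "m + int t"] t M by auto
      then have "u = b t" "v = b (Suc t)" using t by (auto intro!: unique)
      then show ?thesis
        using \<open>adjacent u v\<close> \<open>content u = m + int t\<close> \<open>content v = m + int t + 1\<close>
        by (auto simp: adjacent_def content_def)
    qed
    have "ribbon_path ?D p S b"
      using bij step unfolding ribbon_path_def ribbon_step_def by (fastforce simp: S_def)
    then show ?thesis by blast
  qed
qed

text \<open>Add the boxes one at a time at the upper right end, which is kept at the end of row \<open>0\<close>.  A step to the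
right lengthens row \<open>0\<close> of the outer partition.  A step up pushes both partitions down by one row and
starts with a new row \<open>0\<close>, which consists of the single box above the last one.\<close>

lemma ribbon_exists:
  assumes "S \<subseteq> {t. Suc t < p}"
  shows "\<exists>lam mu b. is_partition lam \<and> is_partition mu \<and> mu \<le> lam \<and>
    ribbon_path (skew_diagram lam mu) p S b \<and> (0 < p \<longrightarrow> 0 < lam 0 \<and> b (p - 1) = (0, lam 0 - 1))"
  using assms
proof (induction p arbitrary: S)
  case 0
  then have "ribbon_path (skew_diagram (\<lambda>_. 0) (\<lambda>_. 0)) 0 S (\<lambda>_. (0, 0))"
    by (simp add: ribbon_path_def skew_diagram_def young_diagram_def bij_betw_def)
  then show ?case
    by (intro exI[of _ "\<lambda>_. 0"] exI[of _ "\<lambda>_. (0, 0)"]) (simp add: is_partition_def antimono_def)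
next
  case (Suc p)
  show ?case
  proof (cases "p = 0")
    case True
    let ?lam = "\<lambda>i :: nat. if i = 0 then 1 else 0 :: nat"
    have "skew_diagram ?lam (\<lambda>_. 0) = {(0, 0)}"
      by (auto simp: skew_diagram_def young_diagram_def split: if_splits)
    then have "ribbon_path (skew_diagram ?lam (\<lambda>_. 0)) (Suc p) S (\<lambda>_. (0, 0))"
      using True Suc.prems by (auto simp: ribbon_path_def bij_betw_def lessThan_Suc)
    moreover have "is_partition ?lam" "is_partition (\<lambda>_. 0)"
      by (auto simp: is_partition_def antimono_def)
    ultimately show ?thesis
      using True
      by - (rule exI[of _ ?lam], rule exI[of _ "\<lambda>_. 0"], rule exI[of _ "\<lambda>_. (0, 0)"], simp add: le_fun_def)
  next
    case False
    define S' where "S' = S \<inter> {t. Suc t < p}"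
    obtain lam mu b where lam: "is_partition lam" and mu: "is_partition mu" and le: "mu \<le> lam"
      and path: "ribbon_path (skew_diagram lam mu) p S' b"
      and pos: "0 < lam 0" and last: "b (p - 1) = (0, lam 0 - 1)"
      using Suc.IH[of S'] False by (auto simp: S'_def)
    have bij: "bij_betw b {..<p} (skew_diagram lam mu)" using path by (simp add: ribbon_path_def)
    have steps: "ribbon_step (t \<in> S) (b t) (b (Suc t))" if "Suc t < p" for t
      using path that by (auto simp: ribbon_path_def S'_def)
    have "(0, lam 0 - 1) \<in> skew_diagram lam mu"
      using bij_betwE[OF bij] False last by (metis diff_less lessThan_iff neq0_conv zero_less_one)
    then have mu0: "mu 0 \<le> lam 0 - 1" by (auto simp: skew_diagram_def young_diagram_def)
    have path_extend: "ribbon_path (insert x D) (Suc p) S c"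
      if D: "bij_betw c {..<p} D" "c p = x" "x \<notin> D"
        and old: "\<And>t. Suc t < p \<Longrightarrow> ribbon_step (t \<in> S) (c t) (c (Suc t))"
        and new: "ribbon_step (p - 1 \<in> S) (c (p - 1)) x" for x D c
    proof -
      have "bij_betw c (insert p {..<p}) (insert (c p) D)"
        using D notIn_Un_bij_betw[of p "{..<p}" c D] by simp
      moreover have "ribbon_step (t \<in> S) (c t) (c (Suc t))" if "Suc t < Suc p" for t
      proof (cases "Suc t = p")
        case True
        then have "t = p - 1" by simp
        then show ?thesis using new D(2) True by auto
      next
        case False
        then show ?thesis using old[of t] that by simp
      qed
      ultimately show ?thesis
        using Suc.prems D(2) unfolding ribbon_path_def by (auto simp: lessThan_Suc)
    qed
    show ?thesis
    proof (cases "p - 1 \<in> S")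
      case False
      let ?lam = "lam(0 := Suc (lam 0))" and ?b = "b(p := (0, lam 0))"
      have "skew_diagram ?lam mu = insert (0, lam 0) (skew_diagram lam mu)"
        using mu0 by (auto simp: skew_diagram_def young_diagram_def split: if_splits)
      moreover have "ribbon_path (insert (0, lam 0) (skew_diagram lam mu)) (Suc p) S ?b"
      proof (rule path_extend)
        show "bij_betw ?b {..<p} (skew_diagram lam mu)"
          using bij by (rule bij_betw_cong[THEN iffD1, rotated]) simp
      qed (use steps last pos False \<open>p \<noteq> 0\<close> in \<open>auto simp: ribbon_step_def skew_diagram_def young_diagram_def\<close>)
      moreover have "finite {i. ?lam i \<noteq> 0}"
        by (rule finite_subset[of _ "insert 0 {i. lam i \<noteq> 0}"]) (use lam in \<open>auto simp: is_partition_def\<close>)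
      then have "is_partition ?lam"
        using lam by (auto simp: is_partition_def antimono_def le_SucI)
      moreover have "mu \<le> ?lam" using le by (auto simp: le_fun_def le_SucI)
      ultimately have "is_partition ?lam \<and> is_partition mu \<and> mu \<le> ?lam \<and>
          ribbon_path (skew_diagram ?lam mu) (Suc p) S ?b \<and>
          (0 < Suc p \<longrightarrow> 0 < ?lam 0 \<and> ?b (Suc p - 1) = (0, ?lam 0 - 1))"
        using mu by (simp del: fun_upd_apply) simp
      then show ?thesis by blast
    next
      case True
      let ?lam = "case_nat (lam 0) lam" and ?mu = "case_nat (lam 0 - 1) mu"
      let ?b = "\<lambda>t. if t < p then (Suc (fst (b t)), snd (b t)) else (0, lam 0 - 1)"
      let ?D = "(\<lambda>x. (Suc (fst x), snd x)) ` skew_diagram lam mu"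
      have skew: "skew_diagram ?lam ?mu = insert (0, lam 0 - 1) ?D"
      proof (rule set_eqI)
        fix x :: "nat \<times> nat"
        obtain i j where x: "x = (i, j)" by force
        show "x \<in> skew_diagram ?lam ?mu \<longleftrightarrow> x \<in> insert (0, lam 0 - 1) ?D"
          using pos unfolding x by (cases i) (force simp: skew_diagram_def young_diagram_def image_iff)+
      qed
      have "ribbon_path (insert (0, lam 0 - 1) ?D) (Suc p) S ?b"
      proof (rule path_extend)
        have "bij_betw ((\<lambda>x. (Suc (fst x), snd x)) \<circ> b) {..<p} ?D"
          by (rule bij_betw_trans[OF bij]) (auto simp: bij_betw_def inj_on_def prod_eq_iff)
        then show "bij_betw ?b {..<p} ?D"
          by (rule bij_betw_cong[THEN iffD1, rotated]) simp
      next
        fix t assume "Suc t < p"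
        then show "ribbon_step (t \<in> S) (?b t) (?b (Suc t))"
          using steps[of t] by (auto simp: ribbon_step_def split: if_splits)
      qed (use last True \<open>p \<noteq> 0\<close> in \<open>auto simp: ribbon_step_def\<close>)
      moreover have "mu i \<le> lam 0 - 1" for i
        using mu mu0 antimonoD[of mu 0 i] by (simp add: is_partition_def)
      then have "antimono ?lam" "antimono ?mu"
        using lam mu
        by (auto simp: is_partition_def antimono_def split: nat.splits intro: order_trans)
      moreover have "finite {i. case_nat a f i \<noteq> 0}" if "finite {i. f i \<noteq> 0}" for a and f :: "nat \<Rightarrow> nat"
      proof (rule finite_subset)
        show "{i. case_nat a f i \<noteq> 0} \<subseteq> insert 0 (Suc ` {i. f i \<noteq> 0})"
        proof
          fix i assume "i \<in> {i. case_nat a f i \<noteq> 0}"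
          then show "i \<in> insert 0 (Suc ` {i. f i \<noteq> 0})" by (cases i) auto
        qed
      qed (use that in simp)
      moreover have "?mu \<le> ?lam" using le by (auto simp: le_fun_def split: nat.splits)
      ultimately have "is_partition ?lam \<and> is_partition ?mu \<and> ?mu \<le> ?lam \<and>
          ribbon_path (skew_diagram ?lam ?mu) (Suc p) S ?b \<and>
          (0 < Suc p \<longrightarrow> 0 < ?lam 0 \<and> ?b (Suc p - 1) = (0, ?lam 0 - 1))"
        using lam mu pos unfolding skew by (simp add: is_partition_def)
      then show ?thesis by blast
    qed
  qed
qed

theorem ribbon_path_rim_hook:
  assumes "S \<subseteq> {t. Suc t < p}"
  shows "\<exists>lam mu b. rim_hook lam mu \<and> ribbon_path (skew_diagram lam mu) p S b"
proof -
  obtain lam mu b where h: "is_partition lam" "is_partition mu" "mu \<le> lam"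
    "ribbon_path (skew_diagram lam mu) p S b"
    using ribbon_exists[OF assms] by blast
  have "young_diagram mu \<subseteq> young_diagram lam"
    using h(3) by (auto simp: young_diagram_def le_fun_def intro: less_le_trans)
  then have "rim_hook lam mu"
    using h ribbon_path_connected[OF h(4)] ribbon_path_no_square[OF h(4)] by (simp add: rim_hook_def)
  then show ?thesis using h(4) by blast
qed


section \<open>The classification\<close>

theorem proposition1p3:
  fixes scaleV :: "'k::{alg_closed_field, field_char_0} \<Rightarrow> 'v::ab_group_add \<Rightarrow> 'v"
    and X :: "'v set"
  assumes "finite_dimensional_vector_space scaleV X"
  shows
    "(\<forall>(s :: 'k \<Rightarrow> 'm::ab_group_add \<Rightarrow> 'm) W \<rho>.
        simple_comodule (end_SV X) s W \<rho> \<longrightarrow>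
        (\<exists>lam mu. rim_hook lam mu \<and>
           (\<forall>l. labeling (skew_diagram lam mu) l \<longrightarrow>
              skew_schur X (skew_diagram lam mu) l \<noteq> ({0} :: ('v list \<Rightarrow>\<^sub>0 'k) set) \<and>
              comodule_iso (mat_O X) s W (as_mat_rep \<rho>)
                fscale (skew_schur X (skew_diagram lam mu) l) (mat_coact X))))
     \<and>
     (\<forall>lam mu l. rim_hook lam mu \<and> labeling (skew_diagram lam mu) l \<and>
        skew_schur X (skew_diagram lam mu) l \<noteq> ({0} :: ('v list \<Rightarrow>\<^sub>0 'k) set) \<longrightarrow>
        (\<exists>(W :: ('v list \<Rightarrow>\<^sub>0 'k) set) \<rho>.
           simple_comodule (end_SV X) fscale W \<rho> \<and>
           comodule_iso (mat_O X) fscale W (as_mat_rep \<rho>)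
             fscale (skew_schur X (skew_diagram lam mu) l) (mat_coact X)))"
proof -
  have "finite X"
    using assms by (rule finite_dimensional_vector_space.finite_Basis)
  moreover obtain r :: "'v \<Rightarrow> nat" where "inj_on r X"
    using finite_imp_inj_to_nat_seg[OF \<open>finite X\<close>] by blast
  ultimately interpret ordered_alphabet X r by unfold_locales
  obtain \<beta> :: "'v list \<Rightarrow> 'v list \<Rightarrow> 'k" where "dual_basis \<beta>"
    using dual_basis_exists by blast
  then interpret ordered_alphabet_dual X r \<beta> by unfold_locales
  show ?thesis
  proof (intro conjI allI impI)
    fix s :: "'k \<Rightarrow> 'm::ab_group_add \<Rightarrow> 'm" and W \<rho>
    assume simple: "simple_comodule (end_SV X) s W \<rho>"
    interpret end_comodule X r \<beta> s W \<rho>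
      using simple by unfold_locales (simp add: simple_comodule_def)
    obtain p S y where nonempty: "descent_words p S \<noteq> {}" and basis: "ribbon_basis p S s W \<rho> y"
      using simple_has_ribbon_basis[OF simple] by blast
    have "S \<subseteq> {t. Suc t < p}"
      using nonempty by (auto simp: descent_words_def descents_def words_def)
    then obtain lam mu b where hook: "rim_hook lam mu"
      and path: "ribbon_path (skew_diagram lam mu) p S b"
      using ribbon_path_rim_hook by blast
    show "\<exists>lam mu. rim_hook lam mu \<and>
       (\<forall>l. labeling (skew_diagram lam mu) l \<longrightarrow>
          skew_schur X (skew_diagram lam mu) l \<noteq> ({0} :: ('v list \<Rightarrow>\<^sub>0 'k) set) \<and>
          comodule_iso (mat_O X) s W (as_mat_rep \<rho>)
            fscale (skew_schur X (skew_diagram lam mu) l) (mat_coact X))"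
    proof (intro exI conjI allI impI)
      show "rim_hook lam mu" by (rule hook)
      fix l assume "labeling (skew_diagram lam mu) l"
      then interpret labeled_ribbon X r \<beta> "skew_diagram lam mu" p S b l
        using path by unfold_locales
      show "skew_schur X (skew_diagram lam mu) l \<noteq> ({0} :: ('v list \<Rightarrow>\<^sub>0 'k) set)"
        using nonempty by (simp add: skew_schur_nonzero_iff)
      show "comodule_iso (mat_O X) s W (as_mat_rep \<rho>)
          fscale (skew_schur X (skew_diagram lam mu) l) (mat_coact X)"
        by (rule comodule_iso_skew_schur[OF vector_space_axioms coact.linear_axioms basis])
    qed
  next
    fix lam mu l
    assume h: "rim_hook lam mu \<and> labeling (skew_diagram lam mu) l \<and>
      skew_schur X (skew_diagram lam mu) l \<noteq> ({0} :: ('v list \<Rightarrow>\<^sub>0 'k) set)"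
    obtain p S b where path: "ribbon_path (skew_diagram lam mu) p S b"
      using rim_hook_ribbon_path h by blast
    interpret labeled_ribbon X r \<beta> "skew_diagram lam mu" p S b l
      using path h by unfold_locales auto
    have "descent_words p S \<noteq> {}"
      using h by (simp add: skew_schur_nonzero_iff)
    then have "simple_comodule (end_SV X) fscale (descent_space p S) (descent_coact p S)"
      by (rule simple_comodule_descent_space)
    moreover have "comodule_iso (mat_O X) fscale (descent_space p S) (as_mat_rep (descent_coact p S))
        fscale (skew_schur X (skew_diagram lam mu) l) (mat_coact X)"
      by (rule comodule_iso_skew_schur[OF tensors.vector_space_axioms linear_descent_coact
            ribbon_basis_descent_space])
    ultimately show "\<exists>(W :: ('v list \<Rightarrow>\<^sub>0 'k) set) \<rho>.
        simple_comodule (end_SV X) fscale W \<rho> \<and>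
        comodule_iso (mat_O X) fscale W (as_mat_rep \<rho>)
          fscale (skew_schur X (skew_diagram lam mu) l) (mat_coact X)" by blast
  qed
qed

end
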